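(* Let $\widetilde D\subset\mathbb{R}^3$ be any ellipsoid of semi-axes of length $p_1,p_2$ and $p_3$, and let $\lambda=\lambda'+i\lambda''$ ($\lambda',\lambda''\in\mathbb{R}$, $\lambda''\neq0$) be such that $|\lambda''|\ll1$ and $|\lambda'|<1/2$. Then $$\Im(\mathrm{Tr}(M(\lambda,\widetilde D)))\le\frac{|\widetilde D|\left(3\lambda'^2+\lambda'-\frac14+(s_1^2+s_2^2+s_3^2)\right)}{|\lambda''|(\lambda''^2+4\lambda'^2)}+\frac{3|\lambda''||\widetilde D|}{\lambda''^2+4\lambda'^2}+O\Big(\frac{\lambda''^2}{4\lambda'^2+\lambda''^2}\Big),$$ where for $j=1,2,3$, $$s_j=-\frac{p_1p_2p_3}2\int_0^\infty\frac1{(p_j^2+s)\sqrt{(p_1^2+s)(p_2^2+s)(p_3^2+s)}}\,ds.$$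
   Context: For a domain $D\subset\mathbb{R}^3$ with outward unit normal $\nu=(\nu_1,\nu_2,\nu_3)$, $\mathcal{K}_D^*[\psi](x)=\frac1{4\pi}\int_{\partial D}\frac{(x-y)\cdot\nu(x)}{|x-y|^3}\psi(y)d\sigma(y)$, $x\in\partial D$, and the polarization tensor is the $3\times3$ matrix with entries $M_{l,m}(\lambda,D)=\int_{\partial D}x_l(\lambda Id-\mathcal{K}_D^* )^{-1}[\nu_m](x)\,d\sigma(x)$. $|\widetilde D|$ is the volume. The $O$-term is understood as $\lambda''\to0$. *)

theory Defs
  imports "HOL-Analysis.Analysis" "HOL-Library.Landau_Symbols"
begin

text \<open>
  A regular parametrised patch of \<open>S\<close>: an injective C1 immersion \<open>r\<close> of an open
  (not necessarily connected) set \<open>U\<close> of parameters into \<open>S\<close>.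
\<close>

definition area_density :: "(real^2 \<Rightarrow> real^3) \<Rightarrow> real^2 \<Rightarrow> real" where
  "area_density r u =
     norm (cross3 (frechet_derivative r (at u) (axis 1 1)) (frechet_derivative r (at u) (axis 2 1)))"

definition regular_patch :: "(real^3) set \<Rightarrow> (real^2) set \<Rightarrow> (real^2 \<Rightarrow> real^3) \<Rightarrow> bool" where
  "regular_patch S U r \<longleftrightarrow>
     open U \<and> inj_on r U \<and> r ` U \<subseteq> S \<and>
     (\<forall>u\<in>U. r differentiable (at u)) \<and>
     (\<forall>v. continuous_on U (\<lambda>u. frechet_derivative r (at u) v)) \<and>
     (\<forall>u\<in>U. area_density r u \<noteq> 0)"

text \<open>
  The surface measure of \<open>S\<close>, as a Borel measure on the whole space that vanishes off \<open>S\<close>: on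
  every regular patch it is given by the surface element \<open>|r\<^sub>u \<times> r\<^sub>v| du dv\<close>.  For a compact C1
  surface \<open>S\<close> there is exactly one such measure, because \<open>S\<close> is covered by finitely many patches.
\<close>

definition is_surface_measure :: "(real^3) set \<Rightarrow> (real^3) measure \<Rightarrow> bool" where
  "is_surface_measure S \<sigma> \<longleftrightarrow>
     space \<sigma> = UNIV \<and> sets \<sigma> = sets borel \<and> emeasure \<sigma> (- S) = 0 \<and>
     (\<forall>U r A. regular_patch S U r \<longrightarrow> A \<in> sets borel \<longrightarrow>
        emeasure \<sigma> (A \<inter> r ` U) =
          (\<integral>\<^sup>+ u \<in> {u \<in> U. r u \<in> A}. ennreal (area_density r u) \<partial>lborel))"

definition surface_measure :: "(real^3) set \<Rightarrow> (real^3) measure" where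
  "surface_measure S = (THE \<sigma>. is_surface_measure S \<sigma>)"

abbreviation boundary_measure :: "(real^3) set \<Rightarrow> (real^3) measure" where
  "boundary_measure D \<equiv> surface_measure (frontier D)"

text \<open>
  The outward unit normal at \<open>x\<close>: up to an error \<open>o(|y - x|)\<close>, the domain near \<open>x\<close> is the half
  space \<open>(y - x) \<bullet> n < 0\<close>.
\<close>

definition outward_normal :: "(real^3) set \<Rightarrow> real^3 \<Rightarrow> real^3" where
  "outward_normal D x =
     (THE n. norm n = 1 \<and>
        (\<forall>\<epsilon>>0. \<forall>\<^sub>F y in nhds x.
           (y \<in> D \<longrightarrow> (y - x) \<bullet> n \<le> \<epsilon> * norm (y - x)) \<and>
           (y \<notin> D \<longrightarrow> (y - x) \<bullet> n \<ge> - \<epsilon> * norm (y - x))))"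

definition NP_operator :: "(real^3) set \<Rightarrow> (real^3 \<Rightarrow> complex) \<Rightarrow> real^3 \<Rightarrow> complex" where
  "NP_operator D \<psi> x =
     (1 / (4 * pi)) *\<^sub>R
       (\<integral>y. (((x - y) \<bullet> outward_normal D x) / norm (x - y) ^ 3) *\<^sub>R \<psi> y \<partial>boundary_measure D)"

definition boundary_L2 :: "(real^3) set \<Rightarrow> (real^3 \<Rightarrow> complex) set" where
  "boundary_L2 D =
     {\<psi> \<in> borel_measurable (boundary_measure D).
        integrable (boundary_measure D) (\<lambda>x. (cmod (\<psi> x))\<^sup>2)}"

text \<open>
  A representative of \<open>(\<lambda> Id - K\<^sub>D\<^sup>*)\<^sup>-\<^sup>1 [g]\<close> in \<open>L\<^sup>2(\<partial>D)\<close>.  For smooth \<open>D\<close> and non-real \<open>\<lambda>\<close> the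
  operator \<open>\<lambda> Id - K\<^sub>D\<^sup>*\<close> is invertible on \<open>L\<^sup>2(\<partial>D)\<close>, so the representative is determined up to null
  sets, which the integrals below do not see.
\<close>

definition NP_resolvent ::
    "complex \<Rightarrow> (real^3) set \<Rightarrow> (real^3 \<Rightarrow> complex) \<Rightarrow> real^3 \<Rightarrow> complex" where
  "NP_resolvent l D g =
     (SOME \<psi>. \<psi> \<in> boundary_L2 D \<and>
        (AE x in boundary_measure D. l * \<psi> x - NP_operator D \<psi> x = g x))"

definition polarization_tensor :: "complex \<Rightarrow> (real^3) set \<Rightarrow> complex^3^3" where
  "polarization_tensor l D =
     (\<chi> i m. \<integral>x. (x $ i) *\<^sub>R NP_resolvent l D (\<lambda>y. of_real (outward_normal D y $ m)) x
               \<partial>boundary_measure D)"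

text \<open>
  The solid ellipsoid with centre \<open>c\<close> whose \<open>j\<close>-th semi-axis has length \<open>p $ j\<close> and the direction
  of the \<open>j\<close>-th column of the orthogonal matrix \<open>Q\<close>.
\<close>

definition ellipsoid :: "real^3 \<Rightarrow> real^3^3 \<Rightarrow> real^3 \<Rightarrow> (real^3) set" where
  "ellipsoid c Q p = {x. (\<Sum>j\<in>UNIV. (((x - c) \<bullet> column j Q) / p $ j)\<^sup>2) < 1}"

definition s_coeff :: "real^3 \<Rightarrow> 3 \<Rightarrow> real" where
  "s_coeff p j =
     - (p $ 1 * p $ 2 * p $ 3 / 2) *
       (LBINT s:{0..}. 1 / (((p $ j)\<^sup>2 + s) *
          sqrt (((p $ 1)\<^sup>2 + s) * ((p $ 2)\<^sup>2 + s) * ((p $ 3)\<^sup>2 + s))))"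

end

theory Submission
  imports Defs "HOL-Real_Asymp.Real_Asymp"
begin

text \<open>
  On an ellipsoid \<open>c + L S\<^sup>2\<close> the stereographic projection from a point \<open>y\<close> turns the kernel times the surface element into the smooth
  density \<open>\<bar>det L\<bar> / (4 \<pi> \<bar>L R (u\<^sub>1, u\<^sub>2, 1)\<bar>\<^sup>3)\<close> on the plane, where the rotation \<open>R\<close> takes the third
  axis to the direction of \<open>L\<^sup>-\<^sup>1 (y - c)\<close>.  Elementary integration
  then shows that constants and the coordinates \<open>\<omega>\<^sub>j\<close> along the axes are eigenfunctions of the adjoint
  of \<open>K\<^sup>*\<close>, with eigenvalues \<open>1/2\<close> and \<open>e\<^sub>j = 1/2 + s\<^sub>j\<close>; since \<open>x \<mapsto> (x - y) \<bullet> \<nu>(x)\<close> is symmetric up to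
  a weight, the components of the normal are eigenfunctions of \<open>K\<^sup>*\<close> itself.  Pairing the resolvent equation with
  \<open>\<omega>\<^sub>j\<close> gives \<open>Tr M = \<Sum>\<^sub>j \<bar>D\<bar> / (\<lambda> - e\<^sub>j)\<close>, without using the uniqueness of the resolvent.
  As \<open>s\<^sub>1 + s\<^sub>2 + s\<^sub>3 = -1\<close>, the first numerator of the bound is \<open>\<Sum>\<^sub>j (\<lambda>' + e\<^sub>j)\<^sup>2\<close>, and the estimate holds termwise,
  with vanishing remainder, because
  \<open>((\<lambda>' - e)\<^sup>2 + \<lambda>''\<^sup>2) ((\<lambda>' + e)\<^sup>2 + \<lambda>''\<^sup>2) - \<lambda>''\<^sup>2 (\<lambda>''\<^sup>2 + 4 \<lambda>'\<^sup>2) = d (d + 2 \<lambda>''\<^sup>2)\<close> for \<open>d = e\<^sup>2 - \<lambda>'\<^sup>2\<close>, which is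
  nonnegative for small \<open>\<lambda>''\<close>.
\<close>

subsection \<open>One-dimensional integrals\<close>

text \<open>The kernel is weakly singular at x = y, so a chart around y would call for a limiting
  argument. Projecting from y itself sends the singularity to infinity. If w is the direction of the
  chord from y, the factor 1/|x - y|^3 contributes |w|^6, the numerator |w|^-2 and the area element
  of the sphere |w|^-4. These powers cancel, and the length factor \<open>wt\<close> of the normal
  cancels as well. Every pole is needed for this, so the measure behind the \<open>THE\<close> in
  \<open>surface_measure\<close> has to be available in all rotated charts. The pole is the fixed
  variable, so the integral runs over x: the computation concerns the adjoint, and the weighted
  symmetry carries it back to the operator. The coordinates give the tensor of a centred ellipsoid;
  the constants show that the resolvent has mean zero, which removes the centre. Since
  \<open>NP_resolvent\<close> is a choice, a solution must be exhibited before anything can be said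
  about the chosen one. In the final estimate the range of \<lambda>'' depends on \<lambda>' and the
  eigenvalues, which is compatible with a limit at fixed \<lambda>'.\<close>

lemma has_bochner_integral_real_line_FTC:
  fixes f F :: "real \<Rightarrow> real"
  assumes "\<And>x. DERIV F x :> f x" "continuous_on UNIV f" "\<And>x. 0 \<le> f x"
    and "(F \<longlongrightarrow> a) at_bot" "(F \<longlongrightarrow> b) at_top"
  shows "has_bochner_integral lborel f (b - a)"
proof -
  have c: "isCont f x" for x
    using assms(2) by (simp add: continuous_on_eq_continuous_at)
  have l: "((F \<circ> real_of_ereal) \<longlongrightarrow> a) (at_right (-\<infinity>))" "((F \<circ> real_of_ereal) \<longlongrightarrow> b) (at_left \<infinity>)"
    using assms(4,5) by (simp_all add: ereal_tendsto_simps)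
  have "set_integrable lborel (einterval (-\<infinity>) \<infinity>) f" "(LBINT x=-\<infinity>..\<infinity>. f x) = b - a"
    by (rule interval_integral_FTC_nonneg[where F=F, OF _ _ _ _ l]; use assms c in simp)+
  then show ?thesis
    by (simp add: has_bochner_integral_iff interval_lebesgue_integral_def set_lebesgue_integral_def set_integrable_def)
qed

lemma integral_one_plus_sq_32: "has_bochner_integral lborel (\<lambda>t::real. 1 / sqrt (t\<^sup>2 + 1) ^ 3) 2"
proof -
  have p: "t\<^sup>2 + 1 > 0" for t :: real by (simp add: add_nonneg_pos)
  have "has_bochner_integral lborel (\<lambda>t::real. 1 / sqrt (t\<^sup>2 + 1) ^ 3) (1 - (-1))"
  proof (rule has_bochner_integral_real_line_FTC[where F="\<lambda>t. t / sqrt (t\<^sup>2 + 1)"])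
    fix x :: real
    have s: "sqrt (x\<^sup>2 + 1) * sqrt (x\<^sup>2 + 1) = x\<^sup>2 + 1" "sqrt (x\<^sup>2 + 1) > 0" using p[of x] by auto
    show "DERIV (\<lambda>t. t / sqrt (t\<^sup>2 + 1)) x :> 1 / sqrt (x\<^sup>2 + 1) ^ 3"
      using p[of x] s
      by (auto intro!: derivative_eq_intros simp: field_simps power2_eq_square power3_eq_cube)
  next
    show "((\<lambda>t. t / sqrt (t\<^sup>2 + 1)) \<longlongrightarrow> -1) at_bot" by real_asymp
    show "((\<lambda>t. t / sqrt (t\<^sup>2 + 1)) \<longlongrightarrow> 1) at_top" by real_asymp
  qed (use p in \<open>auto intro!: continuous_intros simp: less_imp_neq[symmetric] less_imp_le\<close>)
  then show ?thesis by simp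
qed


lemma integral_one_plus_sq_52: "has_bochner_integral lborel (\<lambda>t::real. 1 / sqrt (t\<^sup>2 + 1) ^ 5) (4 / 3)"
proof -
  have p: "t\<^sup>2 + 1 > 0" for t :: real by (simp add: add_nonneg_pos)
  have "has_bochner_integral lborel (\<lambda>t::real. 1 / sqrt (t\<^sup>2 + 1) ^ 5) (2/3 - (-2/3))"
  proof (rule has_bochner_integral_real_line_FTC
      [where F="\<lambda>t. t / (3 * sqrt (t\<^sup>2 + 1) ^ 3) + 2 * t / (3 * sqrt (t\<^sup>2 + 1))"])
    fix x :: real
    define r where "r = sqrt (x\<^sup>2 + 1)"
    have r: "r > 0" "x\<^sup>2 = r\<^sup>2 - 1" using p[of x] by (auto simp: r_def)
    have "DERIV (\<lambda>t. t / (3 * sqrt (t\<^sup>2 + 1) ^ 3) + 2 * t / (3 * sqrt (t\<^sup>2 + 1))) x :>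
       (3 * r ^ 3 - x * (3 * (3 * r\<^sup>2 * (x / r)))) / (3 * r ^ 3)\<^sup>2 + (2 * (3 * r) - 2 * x * (3 * (x / r))) / (3 * r)\<^sup>2"
      using p[of x] r(1) unfolding r_def
      by (auto intro!: derivative_eq_intros simp: field_simps power2_eq_square)
    also have "(3 * r ^ 3 - x * (3 * (3 * r\<^sup>2 * (x / r)))) / (3 * r ^ 3)\<^sup>2 + (2 * (3 * r) - 2 * x * (3 * (x / r))) / (3 * r)\<^sup>2
       = (r\<^sup>2 - 3 * x\<^sup>2) / (3 * r ^ 5) + (2 * (r\<^sup>2 - x\<^sup>2)) / (3 * r ^ 3)"
      using r(1) by (simp add: divide_simps power2_eq_square) (simp add: algebra_simps eval_nat_numeral)
    also have "\<dots> = 1 / r ^ 5"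
      using r(1) unfolding r(2) by (simp add: divide_simps) (simp add: algebra_simps eval_nat_numeral)
    finally show "DERIV (\<lambda>t. t / (3 * sqrt (t\<^sup>2 + 1) ^ 3) + 2 * t / (3 * sqrt (t\<^sup>2 + 1))) x :> 1 / sqrt (x\<^sup>2 + 1) ^ 5"
      by (simp add: r_def)
  next
    show "((\<lambda>t. t / (3 * sqrt (t\<^sup>2 + 1) ^ 3) + 2 * t / (3 * sqrt (t\<^sup>2 + 1))) \<longlongrightarrow> -2/3) at_bot" by real_asymp
    show "((\<lambda>t. t / (3 * sqrt (t\<^sup>2 + 1) ^ 3) + 2 * t / (3 * sqrt (t\<^sup>2 + 1))) \<longlongrightarrow> 2/3) at_top" by real_asymp
  qed (use p in \<open>auto intro!: continuous_intros simp: less_imp_neq[symmetric] less_imp_le\<close>)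
  then show ?thesis by simp
qed

lemma integral_one_plus_sq_1: "has_bochner_integral lborel (\<lambda>t::real. 1 / (t\<^sup>2 + 1)) pi"
proof -
  have p: "t\<^sup>2 + 1 > 0" for t :: real by (simp add: add_nonneg_pos)
  have "has_bochner_integral lborel (\<lambda>t::real. 1 / (t\<^sup>2 + 1)) (pi/2 - (-pi/2))"
  proof (rule has_bochner_integral_real_line_FTC[where F=arctan])
    fix x :: real
    show "DERIV arctan x :> 1 / (x\<^sup>2 + 1)"
      using p[of x] by (auto intro!: derivative_eq_intros simp: field_simps)
    show "(arctan \<longlongrightarrow> -pi/2) at_bot" using tendsto_arctan_at_bot by simp
    show "(arctan \<longlongrightarrow> pi/2) at_top" by (rule tendsto_arctan_at_top)
  qed (use p in \<open>auto intro!: continuous_intros simp: less_imp_neq[symmetric] less_imp_le\<close>)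
  then show ?thesis by simp
qed

lemma integral_one_plus_sq_2: "has_bochner_integral lborel (\<lambda>t::real. 1 / (t\<^sup>2 + 1)\<^sup>2) (pi / 2)"
proof -
  have p: "t\<^sup>2 + 1 > 0" for t :: real by (simp add: add_nonneg_pos)
  have "has_bochner_integral lborel (\<lambda>t::real. 1 / (t\<^sup>2 + 1)\<^sup>2) (pi/4 - (-pi/4))"
  proof (rule has_bochner_integral_real_line_FTC[where F="\<lambda>t. (t / (t\<^sup>2 + 1) + arctan t) / 2"])
    fix x :: real
    have "DERIV (\<lambda>t. (t / (t\<^sup>2 + 1) + arctan t) / 2) x :>
        ((1 * (x\<^sup>2 + 1) - x * (2 * x)) / ((x\<^sup>2 + 1) * (x\<^sup>2 + 1)) + inverse (1 + x\<^sup>2)) / 2"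
      using p[of x] by (auto intro!: derivative_eq_intros)
    also have "((1 * (x\<^sup>2 + 1) - x * (2 * x)) / ((x\<^sup>2 + 1) * (x\<^sup>2 + 1)) + inverse (1 + x\<^sup>2)) / 2 = 1 / (x\<^sup>2 + 1)\<^sup>2"
      using p[of x] by (simp add: divide_simps) (simp add: algebra_simps eval_nat_numeral)
    finally show "DERIV (\<lambda>t. (t / (t\<^sup>2 + 1) + arctan t) / 2) x :> 1 / (x\<^sup>2 + 1)\<^sup>2" .
  next
    have "((\<lambda>t::real. (t / (t\<^sup>2 + 1) + arctan t) / 2) \<longlongrightarrow> (0 + (-(pi/2))) / 2) at_bot"
      by (intro tendsto_intros tendsto_arctan_at_bot) (real_asymp | simp)+
    then show "((\<lambda>t::real. (t / (t\<^sup>2 + 1) + arctan t) / 2) \<longlongrightarrow> -pi/4) at_bot" by simp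
    have "((\<lambda>t::real. (t / (t\<^sup>2 + 1) + arctan t) / 2) \<longlongrightarrow> (0 + (pi/2)) / 2) at_top"
      by (intro tendsto_intros tendsto_arctan_at_top) (real_asymp | simp)+
    then show "((\<lambda>t::real. (t / (t\<^sup>2 + 1) + arctan t) / 2) \<longlongrightarrow> pi/4) at_top" by simp
  qed (use p in \<open>auto intro!: continuous_intros simp: less_imp_neq[symmetric] less_imp_le\<close>)
  then show ?thesis by simp
qed

text \<open>Reflection preserves Lebesgue measure. A non-integrable \<open>g\<close> is covered too,
  because its Bochner integral is 0 by convention.\<close>

lemma integral_odd_eq_0:
  fixes g :: "real \<Rightarrow> real"
  assumes "\<And>t. g (- t) = - g t"
  shows "integral\<^sup>L lborel g = 0"
proof -
  have "integral\<^sup>L lborel g = \<bar>-1\<bar> *\<^sub>R integral\<^sup>L lborel (\<lambda>t. g (0 + (-1) * t))"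
    by (rule lborel_integral_real_affine) simp
  then show ?thesis using assms by simp
qed


text \<open>Completing the square: \<open>x = - \<beta> / \<alpha> + sqrt E / \<alpha> * t\<close>
  turns the quadratic into \<open>E / \<alpha> * (t\<^sup>2 + 1)\<close>, homogeneity of
  \<open>g\<close> splits off \<kappa>, and the odd part of the linear factor integrates to 0.
  Integrability of the odd part is asked for only if \<open>m \<noteq> 0\<close>, because it fails
  for \<open>g q = 1 / q\<close>.\<close>

lemma has_bochner_integral_quadratic_subst:
  fixes g :: "real \<Rightarrow> real"
  assumes "\<alpha> > 0" "\<alpha> * \<delta> - \<beta>\<^sup>2 = E" "E > 0"
    and I: "has_bochner_integral lborel (\<lambda>t. g (t\<^sup>2 + 1)) I"
    and J: "m \<noteq> 0 \<Longrightarrow> integrable lborel (\<lambda>t. t * g (t\<^sup>2 + 1))"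
    and hom: "\<And>q. q > 0 \<Longrightarrow> g (E / \<alpha> * q) = \<kappa> * g q"
  shows "has_bochner_integral lborel (\<lambda>x. (m * x + k) * g (\<alpha> * x\<^sup>2 + 2 * \<beta> * x + \<delta>))
           ((k - m * \<beta> / \<alpha>) * (sqrt E / \<alpha> * \<kappa> * I))"
proof -
  let ?c = "sqrt E / \<alpha>"
  have c: "?c > 0" using assms by simp
  have q: "g (\<alpha> * (- \<beta> / \<alpha> + ?c * t)\<^sup>2 + 2 * \<beta> * (- \<beta> / \<alpha> + ?c * t) + \<delta>) = \<kappa> * g (t\<^sup>2 + 1)" for t
  proof -
    have "\<alpha> * (- \<beta> / \<alpha> + ?c * t)\<^sup>2 + 2 * \<beta> * (- \<beta> / \<alpha> + ?c * t) + \<delta> = ((sqrt E)\<^sup>2 * t\<^sup>2 + (\<alpha> * \<delta> - \<beta>\<^sup>2)) / \<alpha>"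
      using assms(1) by (simp add: field_simps power2_eq_square)
    also have "\<dots> = E / \<alpha> * (t\<^sup>2 + 1)" using assms(1-3) by (simp add: field_simps)
    finally show ?thesis using hom[of "t\<^sup>2 + 1"] by (simp add: add_nonneg_pos)
  qed
  have "has_bochner_integral lborel (\<lambda>t. (m * ?c * \<kappa>) * (t * g (t\<^sup>2 + 1))) 0"
  proof (cases "m = 0")
    case False
    then have "has_bochner_integral lborel (\<lambda>t. t * g (t\<^sup>2 + 1)) 0"
      using J integral_odd_eq_0[of "\<lambda>t. t * g (t\<^sup>2 + 1)"] by (simp add: has_bochner_integral_iff)
    from has_bochner_integral_mult_right[OF this, of "m * ?c * \<kappa>"] show ?thesis by simp
  qed (simp add: has_bochner_integral_zero)
  then have "has_bochner_integral lborel (\<lambda>t. ((k - m * \<beta> / \<alpha>) * \<kappa>) * g (t\<^sup>2 + 1)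
      + (m * ?c * \<kappa>) * (t * g (t\<^sup>2 + 1))) (((k - m * \<beta> / \<alpha>) * \<kappa>) * I + 0)"
    by (intro has_bochner_integral_add has_bochner_integral_mult_right I) 
  then have "has_bochner_integral lborel (\<lambda>t. (m * (- \<beta> / \<alpha> + ?c * t) + k) *
      g (\<alpha> * (- \<beta> / \<alpha> + ?c * t)\<^sup>2 + 2 * \<beta> * (- \<beta> / \<alpha> + ?c * t) + \<delta>)) ((k - m * \<beta> / \<alpha>) * \<kappa> * I)"
    unfolding q by (simp add: algebra_simps)
  moreover have "((k - m * \<beta> / \<alpha>) * (?c * \<kappa> * I)) /\<^sub>R \<bar>?c\<bar> = (k - m * \<beta> / \<alpha>) * \<kappa> * I"
  proof -
    have "((k - m * \<beta> / \<alpha>) * (c * \<kappa> * I)) /\<^sub>R \<bar>c\<bar> = (k - m * \<beta> / \<alpha>) * \<kappa> * I" if "c > 0" for c :: real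
      using that by simp
    from this[OF c] show ?thesis .
  qed
  ultimately show ?thesis
    using c assms(1,3) by (subst lborel_has_bochner_integral_real_affine_iff[where c="?c" and t="- \<beta> / \<alpha>"]) (simp_all add: mult.assoc)
qed

lemma has_bochner_integral_quadratic_32:
  fixes \<alpha> \<beta> \<delta> E :: real
  assumes "\<alpha> > 0" "\<alpha> * \<delta> - \<beta>\<^sup>2 = E" "E > 0"
  shows "has_bochner_integral lborel (\<lambda>x. 1 / sqrt (\<alpha> * x\<^sup>2 + 2 * \<beta> * x + \<delta>) ^ 3) (2 * sqrt \<alpha> / E)"
proof -
  \<comment> \<open>Writing \<alpha> and E as squares makes the identity for the constant
    rational.\<close>
  define x where "x = sqrt \<alpha>"
  define y where "y = sqrt E"
  have *: "\<alpha> = x\<^sup>2" "E = y\<^sup>2" "x > 0" "y > 0" using assms by (auto simp: x_def y_def)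
  have e: "sqrt E / \<alpha> * (1 / sqrt (E / \<alpha>) ^ 3) * 2 = 2 * sqrt \<alpha> / E"
    using *(3,4) unfolding *(1,2) by (simp add: real_sqrt_divide field_simps eval_nat_numeral)
  show ?thesis
    using has_bochner_integral_quadratic_subst[where g="\<lambda>q. 1 / sqrt q ^ 3" and m=0 and k=1
        and \<kappa>="1 / sqrt (E / \<alpha>) ^ 3", OF assms integral_one_plus_sq_32]
    unfolding e by (simp add: real_sqrt_mult real_sqrt_divide power_mult_distrib power_divide)
qed

lemma has_bochner_integral_quadratic_1:
  fixes \<alpha> \<beta> \<delta> E :: real
  assumes "\<alpha> > 0" "\<alpha> * \<delta> - \<beta>\<^sup>2 = E" "E > 0"
  shows "has_bochner_integral lborel (\<lambda>x. 1 / (\<alpha> * x\<^sup>2 + 2 * \<beta> * x + \<delta>)) (pi / sqrt E)"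
proof -
  have e: "sqrt E / \<alpha> * (\<alpha> / E) * pi = pi / sqrt E"
    using assms by (simp add: field_simps)
  show ?thesis
    using has_bochner_integral_quadratic_subst[where g="\<lambda>q. 1 / q" and m=0 and k=1
        and \<kappa>="\<alpha> / E", OF assms integral_one_plus_sq_1]
    unfolding e by simp
qed

lemma has_bochner_integral_quadratic_52:
  fixes \<alpha> \<beta> \<delta> E :: real
  assumes "\<alpha> > 0" "\<alpha> * \<delta> - \<beta>\<^sup>2 = E" "E > 0"
  shows "has_bochner_integral lborel (\<lambda>x. (m * x + k) / sqrt (\<alpha> * x\<^sup>2 + 2 * \<beta> * x + \<delta>) ^ 5)
     ((k - m * \<beta> / \<alpha>) * (4 / 3 * \<alpha> * sqrt \<alpha> / E\<^sup>2))"
proof -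
  define x where "x = sqrt \<alpha>"
  define y where "y = sqrt E"
  have *: "\<alpha> = x\<^sup>2" "E = y\<^sup>2" "x > 0" "y > 0" using assms by (auto simp: x_def y_def)
  have e: "sqrt E / \<alpha> * (1 / sqrt (E / \<alpha>) ^ 5) * (4 / 3) = 4 / 3 * \<alpha> * sqrt \<alpha> / E\<^sup>2"
    using *(3,4) unfolding *(1,2) by (simp add: real_sqrt_divide field_simps eval_nat_numeral)
  have "integrable lborel (\<lambda>t::real. t * (1 / sqrt (t\<^sup>2 + 1) ^ 5))"
  proof (rule Bochner_Integration.integrable_bound)
    show "integrable lborel (\<lambda>t::real. 1 / sqrt (t\<^sup>2 + 1) ^ 3)"
      using integral_one_plus_sq_32 by (simp add: has_bochner_integral_iff)
    have "\<bar>t\<bar> * (1 / sqrt (t\<^sup>2 + 1) ^ 5) \<le> 1 / sqrt (t\<^sup>2 + 1) ^ 3" for t :: real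
    proof -
      define r where "r = sqrt (t\<^sup>2 + 1)"
      have r: "r \<ge> 1" "\<bar>t\<bar> \<le> r" by (auto simp: r_def intro: real_le_rsqrt)
      have "r * 1 \<le> r * r" by (intro mult_left_mono) (use r in auto)
      then have "\<bar>t\<bar> \<le> r * r" using r by linarith
      then have "\<bar>t\<bar> * (1 / r ^ 5) \<le> (r * r) * (1 / r ^ 5)" using r by (intro mult_right_mono) auto
      also have "\<dots> = 1 / r ^ 3" using r by (simp add: field_simps eval_nat_numeral)
      finally show ?thesis by (simp add: r_def)
    qed
    then show "AE t in lborel. norm (t * (1 / sqrt (t\<^sup>2 + 1) ^ 5)) \<le> norm (1 / sqrt (t\<^sup>2 + 1) ^ 3 :: real)"
      by (simp add: abs_mult)
  qed simp
  then show ?thesis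
    using has_bochner_integral_quadratic_subst[where g="\<lambda>q. 1 / sqrt q ^ 5" and m=m and k=k
        and \<kappa>="1 / sqrt (E / \<alpha>) ^ 5", OF assms integral_one_plus_sq_52]
    unfolding e by (simp add: real_sqrt_mult real_sqrt_divide power_mult_distrib power_divide)
qed

lemma has_bochner_integral_quadratic_2:
  fixes \<alpha> \<beta> \<delta> E :: real
  assumes "\<alpha> > 0" "\<alpha> * \<delta> - \<beta>\<^sup>2 = E" "E > 0"
  shows "has_bochner_integral lborel (\<lambda>x. (m * x + k) / (\<alpha> * x\<^sup>2 + 2 * \<beta> * x + \<delta>)\<^sup>2)
     ((k - m * \<beta> / \<alpha>) * (pi * \<alpha> / (2 * E * sqrt E)))"
proof -
  define x where "x = sqrt \<alpha>"
  define y where "y = sqrt E"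
  have *: "\<alpha> = x\<^sup>2" "E = y\<^sup>2" "x > 0" "y > 0" using assms by (auto simp: x_def y_def)
  have e: "sqrt E / \<alpha> * (\<alpha>\<^sup>2 / E\<^sup>2) * (pi / 2) = pi * \<alpha> / (2 * E * sqrt E)"
    using *(3,4) unfolding *(1,2) by (simp add: real_sqrt_divide field_simps eval_nat_numeral)
  have "integrable lborel (\<lambda>t::real. t * (1 / (t\<^sup>2 + 1)\<^sup>2))"
  proof (rule Bochner_Integration.integrable_bound)
    show "integrable lborel (\<lambda>t::real. 1 / (t\<^sup>2 + 1))"
      using integral_one_plus_sq_1 by (simp add: has_bochner_integral_iff)
    have "\<bar>t\<bar> * (1 / (t\<^sup>2 + 1)\<^sup>2) \<le> 1 / (t\<^sup>2 + 1)" for t :: real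
    proof -
      have "0 \<le> (\<bar>t\<bar> - 1)\<^sup>2" by simp
      then have "\<bar>t\<bar> \<le> t\<^sup>2 + 1" by (simp add: power2_diff)
      moreover have p: "t\<^sup>2 + 1 > 0" by (simp add: add_nonneg_pos)
      ultimately have "\<bar>t\<bar> * (1 / (t\<^sup>2 + 1)\<^sup>2) \<le> (t\<^sup>2 + 1) * (1 / (t\<^sup>2 + 1)\<^sup>2)"
        by (intro mult_right_mono) auto
      then show ?thesis using p by (simp add: power2_eq_square)
    qed
    then show "AE t in lborel. norm (t * (1 / (t\<^sup>2 + 1)\<^sup>2)) \<le> norm (1 / (t\<^sup>2 + 1) :: real)"
      by (simp add: abs_mult)
  qed simp
  then show ?thesis
    using has_bochner_integral_quadratic_subst[where g="\<lambda>q. 1 / q\<^sup>2" and m=m and k=k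
        and \<kappa>="\<alpha>\<^sup>2 / E\<^sup>2", OF assms integral_one_plus_sq_2]
    unfolding e by (simp add: power_mult_distrib power_divide)
qed

subsection \<open>Integrals over the plane\<close>

lemma nn_integral_has_bochner_integral:
  fixes f :: "'a \<Rightarrow> real"
  assumes "has_bochner_integral M f I" "\<And>x. 0 \<le> f x"
  shows "(\<integral>\<^sup>+x. ennreal (f x) \<partial>M) = ennreal I"
  using assms by (subst nn_integral_eq_integral) (auto simp: has_bochner_integral_iff)

lemma borel_measurable_vector_2 [measurable]:
  "(\<lambda>(x::real, y::real). vector [x, y] :: real^2) \<in> borel \<Otimes>\<^sub>M borel \<rightarrow>\<^sub>M borel"
proof -
  have "(\<lambda>p. vector [fst p, snd p] :: real^2) = (\<lambda>p. fst p *\<^sub>R axis 1 1 + snd p *\<^sub>R axis 2 (1::real))"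
    by (auto simp: fun_eq_iff vec_eq_iff forall_2 axis_def)
  then show ?thesis unfolding case_prod_beta by simp
qed

text \<open>Lebesgue measure is determined by its values on boxes. This gives access to the theorems
  of Tonelli and Fubini on \<open>real^2\<close>.\<close>

lemma lborel_vec2: "(lborel :: (real^2) measure) = distr (lborel \<Otimes>\<^sub>M lborel) borel (\<lambda>(x, y). vector [x, y])"
proof (rule lborel_eqI)
  fix l u :: "real^2"
  assume lu: "\<And>b. b \<in> Basis \<Longrightarrow> l \<bullet> b \<le> u \<bullet> b"
  have B: "Basis = {axis 1 1, axis 2 1 :: real^2}"
    by (auto simp: Basis_vec_def) (metis exhaust_2)
  have ne: "(axis 1 1 :: real^2) \<noteq> axis 2 1" by (simp add: axis_eq_axis)
  have l: "l $ 1 \<le> u $ 1" "l $ 2 \<le> u $ 2" 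
    using lu[of "axis 1 1"] lu[of "axis 2 1"] by (simp_all add: B cart_eq_inner_axis)
  have "(\<lambda>(x, y). vector [x, y]) -` box l u \<inter> space (lborel \<Otimes>\<^sub>M lborel) = {l $ 1<..<u $ 1} \<times> {l $ 2<..<u $ 2}"
    by (auto simp: mem_box B cart_eq_inner_axis[symmetric] space_pair_measure)
  then have "emeasure (distr (lborel \<Otimes>\<^sub>M lborel) borel (\<lambda>(x, y). vector [x, y])) (box l u)
      = emeasure (lborel \<Otimes>\<^sub>M lborel) ({l $ 1<..<u $ 1} \<times> {l $ 2<..<u $ 2})"
    by (subst emeasure_distr) simp_all
  also have "\<dots> = ennreal (u $ 1 - l $ 1) * ennreal (u $ 2 - l $ 2)"
    using l by (subst lborel.emeasure_pair_measure_Times) simp_all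
  also have "\<dots> = ennreal (\<Prod>b\<in>Basis. (u - l) \<bullet> b)"
    using l ne by (simp add: B cart_eq_inner_axis[symmetric] ennreal_mult inner_diff_left)
  finally show "emeasure (distr (lborel \<Otimes>\<^sub>M lborel) borel (\<lambda>(x, y). vector [x, y])) (box l u) = (\<Prod>b\<in>Basis. (u - l) \<bullet> b)" .
qed simp

lemma nn_integral_vec2:
  fixes f :: "real^2 \<Rightarrow> ennreal"
  assumes [measurable]: "f \<in> borel_measurable borel"
  shows "(\<integral>\<^sup>+u. f u \<partial>lborel) = (\<integral>\<^sup>+y. \<integral>\<^sup>+x. f (vector [x, y]) \<partial>lborel \<partial>lborel)"
proof -
  have "(\<integral>\<^sup>+u. f u \<partial>lborel) = (\<integral>\<^sup>+p. f (vector [fst p, snd p]) \<partial>(lborel \<Otimes>\<^sub>M lborel))"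
    by (subst lborel_vec2, subst nn_integral_distr) (auto simp: case_prod_beta)
  also have "\<dots> = (\<integral>\<^sup>+y. \<integral>\<^sup>+x. f (vector [x, y]) \<partial>lborel \<partial>lborel)"
    by (subst lborel_pair.nn_integral_snd[symmetric]) (auto simp: case_prod_beta)
  finally show ?thesis .
qed

lemma integral_vec2:
  fixes f :: "real^2 \<Rightarrow> real"
  assumes f: "integrable lborel f"
  shows "(\<integral>u. f u \<partial>lborel) = (\<integral>y. \<integral>x. f (vector [x, y]) \<partial>lborel \<partial>lborel)"
proof -
  have [measurable]: "f \<in> borel_measurable borel" using f by auto
  have "integrable (distr (lborel \<Otimes>\<^sub>M lborel) borel (\<lambda>(x, y). vector [x, y])) f"
    using f by (subst (asm) lborel_vec2)
  then have i: "integrable (lborel \<Otimes>\<^sub>M lborel) (\<lambda>(x, y). f (vector [x, y]))"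
    unfolding case_prod_beta by (subst (asm) integrable_distr_eq) simp_all
  have "(\<integral>u. f u \<partial>lborel) = (\<integral>p. f (vector [fst p, snd p]) \<partial>(lborel \<Otimes>\<^sub>M lborel))"
    by (subst lborel_vec2, subst integral_distr) (auto simp: case_prod_beta)
  also have "\<dots> = (\<integral>y. \<integral>x. f (vector [x, y]) \<partial>lborel \<partial>lborel)"
    using lborel_pair.integral_snd[OF i, symmetric] unfolding case_prod_beta .
  finally show ?thesis .
qed

section \<open>Quadratic forms on the affine plane at height one\<close>

definition lift3 :: "real^2 \<Rightarrow> real^3" where
  "lift3 u = vector [u $ 1, u $ 2, 1]"

lemma lift3_nth [simp]: "lift3 u $ 1 = u $ 1" "lift3 u $ 2 = u $ 2" "lift3 u $ 3 = 1"
  by (simp_all add: lift3_def)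

lemma lift3_neq_0 [simp]: "lift3 u \<noteq> 0" "0 \<noteq> lift3 u"
  by (metis lift3_nth(3) zero_index zero_neq_one)+

lemma lift3_eq: "lift3 u = u $ 1 *\<^sub>R axis 1 1 + u $ 2 *\<^sub>R axis 2 1 + axis 3 1"
  by (simp add: vec_eq_iff forall_3 axis_def)

lemma continuous_on_lift3 [continuous_intros]:
  "continuous_on S f \<Longrightarrow> continuous_on S (\<lambda>x. lift3 (f x))"
  unfolding lift3_eq by (intro continuous_intros)

lemma borel_measurable_lift3 [measurable]: "lift3 \<in> borel_measurable borel"
  by (intro borel_measurable_continuous_onI continuous_intros)

lemma norm_lift3_ge_1: "norm (lift3 u) \<ge> 1"
  using component_le_norm_cart[of "lift3 u" 3] by simp

lemma continuous_on_matrix_vector_mult [continuous_intros]: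
  fixes A :: "real^'n^'m"
  shows "continuous_on S f \<Longrightarrow> continuous_on S (\<lambda>x. A *v f x)"
  by (rule bounded_linear.continuous_on[OF matrix_vector_mul_bounded_linear])

locale posdef3 =
  fixes C :: "real^3^3"
  assumes sym: "transpose C = C" and pos: "x \<noteq> 0 \<Longrightarrow> x \<bullet> (C *v x) > 0"
begin

definition form :: "real^3 \<Rightarrow> real" where "form x = x \<bullet> (C *v x)"

lemma symD: "C $ 2 $ 1 = C $ 1 $ 2" "C $ 3 $ 1 = C $ 1 $ 3" "C $ 3 $ 2 = C $ 2 $ 3"
proof -
  have "C $ i $ j = C $ j $ i" for i j
    by (subst sym[symmetric]) (simp add: transpose_def)
  then show "C $ 2 $ 1 = C $ 1 $ 2" "C $ 3 $ 1 = C $ 1 $ 3" "C $ 3 $ 2 = C $ 2 $ 3" by auto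
qed

abbreviation "a11 \<equiv> C $ 1 $ 1"
abbreviation "a12 \<equiv> C $ 1 $ 2"
abbreviation "a13 \<equiv> C $ 1 $ 3"
abbreviation "a22 \<equiv> C $ 2 $ 2"
abbreviation "a23 \<equiv> C $ 2 $ 3"
abbreviation "a33 \<equiv> C $ 3 $ 3"

lemma form_expand: "form x = a11 * (x $ 1)\<^sup>2 + 2 * (a12 * x $ 2 + a13 * x $ 3) * x $ 1
    + (a22 * (x $ 2)\<^sup>2 + 2 * a23 * x $ 2 * x $ 3 + a33 * (x $ 3)\<^sup>2)"
  by (simp add: form_def inner_vec_def matrix_vector_mult_def sum_3 symD power2_eq_square algebra_simps)

lemma form_pos: "x \<noteq> 0 \<Longrightarrow> form x > 0"
  using pos by (simp add: form_def)

text \<open>For fixed y the form is quadratic in x, and \<open>m2\<close>, \<open>n2\<close>,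
  \<open>k2\<close> are the coefficients of its negated reduced discriminant as a quadratic in y.
  The same operation applied to that quadratic gives \<open>a11 * det C\<close>.\<close>

abbreviation "m2 \<equiv> a11 * a22 - a12\<^sup>2"
abbreviation "n2 \<equiv> a11 * a23 - a12 * a13"
abbreviation "k2 \<equiv> a11 * a33 - a13\<^sup>2"

lemma a11_pos: "a11 > 0"
  using form_pos[of "axis 1 1"] by (simp add: form_expand) (simp add: axis_def)

lemma m2_pos: "m2 > 0"
proof -
  \<comment> \<open>This vector is orthogonal to the first row of \<open>C\<close> and has third
    entry 0, so only the second row contributes to the form.\<close>
  have "form (vector [- a12, a11, 0]) > 0"
    using a11_pos by (intro form_pos) (auto simp: vec_eq_iff forall_3)
  also have "form (vector [- a12, a11, 0]) = a11 * m2"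
    by (simp add: form_expand power2_eq_square algebra_simps)
  finally show ?thesis using a11_pos by (simp add: zero_less_mult_iff)
qed

lemma det_C: "a11 * det C = m2 * k2 - n2\<^sup>2"
  by (simp add: det_3 symD power2_eq_square algebra_simps)

lemma det_pos: "det C > 0"
proof -
  \<comment> \<open>The third column of the adjugate: \<open>C\<close> maps it to
    \<open>det C\<close> times the third unit vector, and its third entry is
    \<open>m2\<close>.\<close>
  have "form (vector [a12 * a23 - a13 * a22, - n2, m2]) > 0"
    using m2_pos by (intro form_pos) (auto simp: vec_eq_iff forall_3)
  also have "form (vector [a12 * a23 - a13 * a22, - n2, m2]) = det C * m2"
    by (simp add: form_expand det_3 symD power2_eq_square algebra_simps)
  finally show ?thesis using m2_pos by (simp add: zero_less_mult_iff)
qed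

lemma continuous_on_form [continuous_intros]: "continuous_on S f \<Longrightarrow> continuous_on S (\<lambda>x. form (f x))"
  unfolding form_def by (intro continuous_intros)

lemma borel_measurable_form [measurable]: "form \<in> borel_measurable borel"
  by (intro borel_measurable_continuous_onI continuous_intros)

lemma form_slice: "form (lift3 (vector [x, y])) = a11 * x\<^sup>2 + 2 * (a12 * y + a13) * x + (a22 * y\<^sup>2 + 2 * a23 * y + a33)"
  by (simp add: form_expand)

lemma slice_disc: "a11 * (a22 * y\<^sup>2 + 2 * a23 * y + a33) - (a12 * y + a13)\<^sup>2 = m2 * y\<^sup>2 + 2 * n2 * y + k2"
  by (simp add: power2_eq_square algebra_simps)

lemma disc_disc: "m2 * k2 - n2\<^sup>2 = a11 * det C" "a11 * det C > 0"
proof -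
  show "m2 * k2 - n2\<^sup>2 = a11 * det C" using det_C by simp
  show "a11 * det C > 0" using a11_pos det_pos by simp
qed

lemma slice_disc_pos: "m2 * y\<^sup>2 + 2 * n2 * y + k2 > 0"
proof -
  have "m2 * (m2 * y\<^sup>2 + 2 * n2 * y + k2) = (m2 * y + n2)\<^sup>2 + (m2 * k2 - n2\<^sup>2)"
    by (simp add: power2_eq_square algebra_simps)
  also have "\<dots> > 0" using disc_disc by (intro add_nonneg_pos) auto
  finally show ?thesis using m2_pos by (simp add: zero_less_mult_iff)
qed

lemma form_lift3_nonneg: "form (lift3 u) \<ge> 0"
  using form_pos[of "lift3 u"] by simp

text \<open>Integration over x turns the power -3/2 of the form into the power -1 of the quadratic
  in y given by \<open>slice_disc\<close>, which the arctangent integral then handles.\<close>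

lemma nn_integral_form_32: "(\<integral>\<^sup>+u. ennreal (1 / sqrt (form (lift3 u)) ^ 3) \<partial>lborel) = ennreal (2 * pi / sqrt (det C))"
proof -
  have "(\<integral>\<^sup>+x. ennreal (1 / sqrt (form (lift3 (vector [x, y]))) ^ 3) \<partial>lborel)
      = ennreal (2 * sqrt a11 * (1 / (m2 * y\<^sup>2 + 2 * n2 * y + k2)))" for y
  proof -
    have "(\<integral>\<^sup>+x. ennreal (1 / sqrt (form (lift3 (vector [x, y]))) ^ 3) \<partial>lborel)
       = ennreal (2 * sqrt a11 / (m2 * y\<^sup>2 + 2 * n2 * y + k2))"
      using has_bochner_integral_quadratic_32[OF a11_pos slice_disc slice_disc_pos, of y]
      unfolding form_slice[symmetric] by (subst nn_integral_eq_integral) (auto simp: has_bochner_integral_iff form_lift3_nonneg)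
    then show ?thesis by simp
  qed
  then have "(\<integral>\<^sup>+u. ennreal (1 / sqrt (form (lift3 u)) ^ 3) \<partial>lborel)
     = (\<integral>\<^sup>+y. ennreal (2 * sqrt a11 * (1 / (m2 * y\<^sup>2 + 2 * n2 * y + k2))) \<partial>lborel)"
    by (subst nn_integral_vec2) auto
  also have "\<dots> = ennreal (2 * sqrt a11 * (pi / sqrt (a11 * det C)))"
    using has_bochner_integral_mult_right[OF has_bochner_integral_quadratic_1[OF m2_pos disc_disc], of "2 * sqrt a11"]
    by (rule nn_integral_has_bochner_integral) (use a11_pos slice_disc_pos in \<open>auto intro!: mult_nonneg_nonneg less_imp_le\<close>)
  also have "2 * sqrt a11 * (pi / sqrt (a11 * det C)) = 2 * pi / sqrt (det C)"
    using a11_pos by (simp add: real_sqrt_mult)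
  finally show ?thesis .
qed

text \<open>The level sets of the form on the plane are ellipses centred at the multiple of
  \<open>z\<close> with height one, where the form is minimal; so the linear factor is averaged to
  its value at that centre. In coordinates, the powers are -5/2 in x and then -2 in y.\<close>

lemma integral_form_52:
  assumes int: "integrable lborel (\<lambda>u. (a \<bullet> lift3 u) / sqrt (form (lift3 u)) ^ 5)"
    and z: "C *v z = axis 3 1"
  shows "(\<integral>u. (a \<bullet> lift3 u) / sqrt (form (lift3 u)) ^ 5 \<partial>lborel) = 2 * pi / 3 * (a \<bullet> z) / sqrt (det C)"
proof -
  let ?D = "\<lambda>y. m2 * y\<^sup>2 + 2 * n2 * y + k2"
  let ?m = "a $ 2 - a $ 1 * a12 / a11"
  let ?k = "a $ 3 - a $ 1 * a13 / a11"
  let ?c = "4 / 3 * a11 * sqrt a11"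
  have "(\<integral>x. (a \<bullet> lift3 (vector [x, y])) / sqrt (form (lift3 (vector [x, y]))) ^ 5 \<partial>lborel)
      = ?c * ((?m * y + ?k) / (?D y)\<^sup>2)" for y
  proof -
    have "(\<integral>x. (a $ 1 * x + (a $ 2 * y + a $ 3)) / sqrt (a11 * x\<^sup>2 + 2 * (a12 * y + a13) * x + (a22 * y\<^sup>2 + 2 * a23 * y + a33)) ^ 5 \<partial>lborel)
        = (a $ 2 * y + a $ 3 - a $ 1 * (a12 * y + a13) / a11) * (4 / 3 * a11 * sqrt a11 / (?D y)\<^sup>2)"
      using has_bochner_integral_quadratic_52[OF a11_pos slice_disc slice_disc_pos, of "a $ 1" "a $ 2 * y + a $ 3" y]
      by (simp add: has_bochner_integral_iff)
    also have "a $ 2 * y + a $ 3 - a $ 1 * (a12 * y + a13) / a11 = ?m * y + ?k"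
      using a11_pos by (simp add: field_simps)
    finally have "(\<integral>x. (a $ 1 * x + (a $ 2 * y + a $ 3)) / sqrt (form (lift3 (vector [x, y]))) ^ 5 \<partial>lborel)
        = (?m * y + ?k) * (?c / (?D y)\<^sup>2)"
      unfolding form_slice .
    moreover have "a \<bullet> lift3 (vector [x, y]) = a $ 1 * x + (a $ 2 * y + a $ 3)" for x
      by (simp add: inner_vec_def sum_3)
    ultimately show ?thesis
      by simp
  qed
  then have "(\<integral>u. (a \<bullet> lift3 u) / sqrt (form (lift3 u)) ^ 5 \<partial>lborel) = (\<integral>y. ?c * ((?m * y + ?k) / (?D y)\<^sup>2) \<partial>lborel)"
    by (subst integral_vec2[OF int]) simp
  also have "\<dots> = ?c * ((?k - ?m * n2 / m2) * (pi * m2 / (2 * (a11 * det C) * sqrt (a11 * det C))))"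
    by (intro has_bochner_integral_integral_eq has_bochner_integral_mult_right
        has_bochner_integral_quadratic_2[OF m2_pos disc_disc])
  also have "\<dots> = 2 * pi / 3 * ((?k * m2 - ?m * n2) / det C) / sqrt (det C)"
  proof -
    have *: "4 / 3 * A * r * ((k - m * n / M) * (pi * M / (2 * (A * d) * (r * s))))
       = 2 * pi / 3 * ((k * M - m * n) / d) / s" if "M \<noteq> 0" "r \<noteq> 0" "A \<noteq> 0" "d \<noteq> 0" "s \<noteq> 0" for k m n M A d r s :: real
      using that by (simp add: field_simps)
    show ?thesis
      unfolding real_sqrt_mult
      by (rule *) (use m2_pos a11_pos det_pos in auto)
  qed
  also have "(?k * m2 - ?m * n2) / det C = a \<bullet> z"
  proof -
    \<comment> \<open>Cramer's rule: both sides are sent by the injective matrix \<open>C\<close> to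
      \<open>det C\<close> times the third unit vector.\<close>
    have "det C *\<^sub>R z = vector [a12 * a23 - a13 * a22, - n2, m2]"
    proof -
      let ?w = "vector [a12 * a23 - a13 * a22, - n2, m2] :: real^3"
      have "C *v ?w = det C *\<^sub>R axis 3 1"
        by (simp add: vec_eq_iff forall_3 matrix_vector_mult_def sum_3 axis_def symD det_3 power2_eq_square algebra_simps)
      then have "C *v (?w - det C *\<^sub>R z) = 0"
        by (simp add: z matrix_vector_mult_diff_distrib matrix_vector_mult_scaleR)
      then have "?w - det C *\<^sub>R z = 0" using pos[of "?w - det C *\<^sub>R z"] by (metis inner_zero_right less_irrefl)
      then show ?thesis by simp
    qed
    then have "det C * (a \<bullet> z) = a \<bullet> vector [a12 * a23 - a13 * a22, - n2, m2]"
      by (metis inner_scaleR_right)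
    also have "\<dots> = ?k * m2 - ?m * n2"
      using a11_pos by (simp add: inner_vec_def sum_3 power2_eq_square field_simps)
    finally show ?thesis using det_pos by (simp add: field_simps)
  qed
  finally show ?thesis .
qed

end

text \<open>The integrand is the area element of the unit sphere under stereographic projection,
  hence the value. It also serves as the dominating function for areas and moments.\<close>

lemma integral_lift3_4:
  "has_bochner_integral lborel (\<lambda>u. 4 / norm (lift3 u) ^ 4) (4 * pi)"
proof -
  have n: "norm (lift3 (vector [x, y])) ^ 4 = (1 * x\<^sup>2 + 2 * 0 * x + (1 + y\<^sup>2))\<^sup>2" for x y
  proof -
    have "norm (lift3 (vector [x, y])) ^ 4 = (lift3 (vector [x, y]) \<bullet> lift3 (vector [x, y]))\<^sup>2"
      by (simp add: dot_square_norm)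
    then show ?thesis by (simp add: inner_vec_def sum_3 power2_eq_square algebra_simps)
  qed
  have "(\<integral>\<^sup>+x. ennreal (4 / norm (lift3 (vector [x, y])) ^ 4) \<partial>lborel) = ennreal (2 * pi * (1 / sqrt (1 * y\<^sup>2 + 2 * 0 * y + 1) ^ 3))" for y
  proof -
    have p: "1 + y\<^sup>2 > 0" by (simp add: add_pos_nonneg)
    have e: "(\<lambda>x. 4 / norm (lift3 (vector [x, y])) ^ 4) = (\<lambda>x. (0 * x + 4) / (1 * x\<^sup>2 + 2 * 0 * x + (1 + y\<^sup>2))\<^sup>2)"
      using n by simp
    have "(\<integral>\<^sup>+x. ennreal (4 / norm (lift3 (vector [x, y])) ^ 4) \<partial>lborel) = ennreal ((4 - 0 * 0 / 1) * (pi * 1 / (2 * (1 + y\<^sup>2) * sqrt (1 + y\<^sup>2))))"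
      using has_bochner_integral_quadratic_2[of 1 "1 + y\<^sup>2" 0 "1 + y\<^sup>2" 0 4] p
      by (subst nn_integral_eq_integral) (auto simp: e[unfolded fun_eq_iff] has_bochner_integral_iff)
    also have "(4 - 0 * 0 / 1) * (pi * 1 / (2 * (1 + y\<^sup>2) * sqrt (1 + y\<^sup>2))) = 2 * pi * (1 / sqrt (1 * y\<^sup>2 + 2 * 0 * y + 1) ^ 3)"
    proof -
      have "(4 - 0 * 0 / 1) * (pi * 1 / (2 * Y * s)) = 2 * pi * (1 / (Y * s))" for Y s :: real
        by (simp add: divide_simps)
      moreover have "sqrt (1 * y\<^sup>2 + 2 * 0 * y + 1) ^ 3 = (1 + y\<^sup>2) * sqrt (1 + y\<^sup>2)"
        using p by (simp add: power3_eq_cube add.commute)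
      ultimately show ?thesis by metis
    qed
    finally show ?thesis .
  qed
  then have "(\<integral>\<^sup>+u. ennreal (4 / norm (lift3 u) ^ 4) \<partial>lborel) = (\<integral>\<^sup>+y. ennreal (2 * pi * (1 / sqrt (1 * y\<^sup>2 + 2 * 0 * y + 1) ^ 3)) \<partial>lborel)"
    by (subst nn_integral_vec2) auto
  also have "\<dots> = ennreal (2 * pi * (2 * sqrt 1 / 1))"
    using has_bochner_integral_mult_right[OF has_bochner_integral_quadratic_32[of 1 1 0 1], of "2 * pi"]
    by (subst nn_integral_eq_integral) (auto simp: has_bochner_integral_iff)
  finally show ?thesis
    by (intro has_bochner_integral_nn_integral) auto
qed

subsection \<open>Stereographic charts\<close>

lemma nn_integral_change_of_variables:
  fixes f :: "real^'m::{finite,wellorder} \<Rightarrow> real" and g :: "real^'m::_ \<Rightarrow> real^'m::_"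
  assumes S: "S \<in> sets borel" and gS: "g ` S \<in> sets borel"
    and der: "\<And>x. x \<in> S \<Longrightarrow> (g has_derivative g' x) (at x within S)"
    and inj: "inj_on g S"
    and f [measurable]: "f \<in> borel_measurable borel" and nonneg: "\<And>x. 0 \<le> f x"
    and fin: "(\<integral>\<^sup>+x. ennreal (f x) \<partial>lborel) < \<infinity>"
  shows "(\<integral>\<^sup>+x. ennreal (\<bar>det (matrix (g' x))\<bar> * f (g x)) * indicator S x \<partial>lborel)
    = (\<integral>\<^sup>+x. ennreal (f x) * indicator (g ` S) x \<partial>lborel)"
proof -
  have "integrable lborel f"
    using fin nonneg by (intro integrableI_nonneg) auto
  then have "f absolutely_integrable_on UNIV"
    unfolding set_integrable_def by (simp add: integrable_completion)
  then have "f absolutely_integrable_on (g ` S)"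
    by (rule set_integrable_subset) (use gS in auto)
  \<comment> \<open>The change of variables theorem concerns functions with values in
    \<open>real^'n\<close>, so \<open>f\<close> is carried along as a function into
    \<open>real^1\<close>.\<close>
  then have "(\<lambda>x. vec (f x) :: real^1) absolutely_integrable_on (g ` S)"
    by (simp add: absolutely_integrable_on_1_iff)
  moreover have "S \<in> sets lebesgue" using S by auto
  ultimately have *: "(\<lambda>x. \<bar>det (matrix (g' x))\<bar> *\<^sub>R (vec (f (g x)) :: real^1)) absolutely_integrable_on S \<and>
    integral S (\<lambda>x. \<bar>det (matrix (g' x))\<bar> *\<^sub>R (vec (f (g x)) :: real^1)) = integral (g ` S) (\<lambda>x. vec (f x))"
    by (intro has_absolute_integral_change_of_variables[THEN iffD2] der inj conjI refl)
  have "(\<lambda>x. \<bar>det (matrix (g' x))\<bar> * f (g x)) absolutely_integrable_on S"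
    using conjunct1[OF *] unfolding absolutely_integrable_on_1_iff by simp
  moreover have "integral S (\<lambda>x. \<bar>det (matrix (g' x))\<bar> * f (g x)) = integral (g ` S) f"
    using arg_cong[OF conjunct2[OF *], of "\<lambda>v. v $ 1"] unfolding integral_on_1_eq by simp
  ultimately have "((\<lambda>x. \<bar>det (matrix (g' x))\<bar> * f (g x)) has_integral integral (g ` S) f) S"
    unfolding has_integral_iff using set_lebesgue_integral_eq_integral(1) by blast
  moreover have "(f has_integral integral (g ` S) f) (g ` S)"
    using \<open>f absolutely_integrable_on (g ` S)\<close> unfolding has_integral_iff
    using set_lebesgue_integral_eq_integral(1) by blast
  ultimately show ?thesis
    using nonneg by (simp add: nn_integral_has_integral_lebesgue')
qed

text \<open>The cross product is alternating and bilinear, so precomposition with a plane map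
  multiplies it by the determinant. This is what makes the area elements of two patches
  comparable.\<close>

lemma cross3_linear_image_R2:
  fixes T :: "real^2 \<Rightarrow> real^3" and N :: "real^2 \<Rightarrow> real^2"
  assumes T: "linear T" and N: "linear N"
  shows "cross3 (T (N (axis 1 1))) (T (N (axis 2 1))) = det (matrix N) *\<^sub>R cross3 (T (axis 1 1)) (T (axis 2 1))"
proof -
  have e: "x = x $ 1 *\<^sub>R axis 1 1 + x $ 2 *\<^sub>R axis 2 1" for x :: "real^2"
    by (simp add: vec_eq_iff forall_2 axis_def)
  have Te: "T x = x $ 1 *\<^sub>R T (axis 1 1) + x $ 2 *\<^sub>R T (axis 2 1)" for x
    by (subst e[of x]) (simp add: T linear_add linear_scale)
  show ?thesis
    unfolding Te[of "N (axis 1 1)"] Te[of "N (axis 2 1)"]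
    by (simp add: matrix_def det_2 cross_add_left cross_add_right cross_mult_left cross_mult_right
        cross_skew[of "T (axis 2 1)" "T (axis 1 1)"] algebra_simps flip: scaleR_left_diff_distrib)
qed

text \<open>The second intersection of the unit sphere with the line through the north pole in
  direction \<open>lift3 u\<close>. Parametrising by the direction makes the chord from the pole a
  multiple of \<open>lift3 u\<close>, which is the form the kernel needs; it differs from the usual
  projection by the sign of \<open>u\<close>.\<close>

definition stereo :: "real^2 \<Rightarrow> real^3" where
  "stereo u = axis 3 1 - (2 / (norm (lift3 u))\<^sup>2) *\<^sub>R lift3 u"

definition stereo_inv :: "real^3 \<Rightarrow> real^2" where
  "stereo_inv v = vector [- v $ 1 / (1 - v $ 3), - v $ 2 / (1 - v $ 3)]"

lemma norm_lift3: "(norm (lift3 u))\<^sup>2 = 1 + u \<bullet> u"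
  by (simp add: power2_norm_eq_inner inner_vec_def sum_3 sum_2)

lemma norm_lift3_pos: "1 + u \<bullet> u > (0::real)" for u :: "'a::real_inner"
  by (simp add: add_pos_nonneg)

lemma stereo_alt: "stereo u = axis 3 1 - (2 / (1 + u \<bullet> u)) *\<^sub>R lift3 u"
  by (simp add: stereo_def norm_lift3)

lemma norm_stereo [simp]: "norm (stereo u) = 1"
proof -
  define s where "s = 1 + u \<bullet> u"
  have s: "s > 0" "lift3 u \<bullet> lift3 u = s" "axis 3 1 \<bullet> lift3 u = 1" "axis 3 1 \<bullet> (axis 3 1 :: real^3) = 1"
    using norm_lift3_pos[of u] by (simp_all add: s_def inner_vec_def sum_3 sum_2 axis_def)
  have "stereo u \<bullet> stereo u = 1 - 2 * (2 / s) + (2 / s)\<^sup>2 * s"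
    unfolding stereo_alt s_def[symmetric]
    using s(2-) by (simp add: inner_diff_left inner_diff_right inner_commute[of "lift3 u" "axis 3 1"] power2_eq_square)
  also have "\<dots> = 1" using s(1) by (simp add: field_simps power2_eq_square)
  finally show ?thesis by (simp add: norm_eq_1)
qed

lemma stereo_nth: "stereo u $ 1 = - (2 / (1 + u \<bullet> u)) * u $ 1" "stereo u $ 2 = - (2 / (1 + u \<bullet> u)) * u $ 2"
  "stereo u $ 3 = 1 - 2 / (1 + u \<bullet> u)"
  by (simp_all add: stereo_alt axis_def)

lemma stereo_inv_stereo [simp]: "stereo_inv (stereo u) = u"
  using norm_lift3_pos[of u] by (simp add: stereo_inv_def vec_eq_iff forall_2 stereo_nth)

lemma stereo_neq_pole: "stereo u \<noteq> axis 3 1"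
  using norm_lift3_pos[of u] by (auto simp: vec_eq_iff forall_3 stereo_nth axis_def)

lemma unit_nth3_eq_1: "norm v = 1 \<Longrightarrow> v $ 3 = 1 \<longleftrightarrow> v = axis 3 (1::real)" for v :: "real^3"
proof
  assume "norm v = 1" "v $ 3 = 1"
  then have "v $ 1 * v $ 1 + v $ 2 * v $ 2 = 0"
    by (simp add: norm_eq_1 inner_vec_def sum_3)
  then show "v = axis 3 1" using \<open>v $ 3 = 1\<close>
    by (simp add: vec_eq_iff forall_3 axis_def sum_squares_eq_zero_iff)
qed (simp add: axis_def)

lemma stereo_stereo_inv:
  assumes "norm v = 1" "v \<noteq> axis 3 1"
  shows "stereo (stereo_inv v) = v"
proof -
  define d where "d = 1 - v $ 3"
  have d: "d \<noteq> 0" "v $ 3 = 1 - d" using assms unit_nth3_eq_1[of v] by (auto simp: d_def)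
  have "v $ 1 * v $ 1 + v $ 2 * v $ 2 = 1 - v $ 3 * v $ 3"
    using assms(1) by (simp add: norm_eq_1 inner_vec_def sum_3)
  also have "\<dots> = 2 * d - d * d" by (simp add: d(2) algebra_simps)
  finally have q: "v $ 1 * v $ 1 + v $ 2 * v $ 2 = 2 * d - d * d" .
  have "stereo_inv v \<bullet> stereo_inv v = (v $ 1 * v $ 1 + v $ 2 * v $ 2) / (d * d)"
    by (simp add: stereo_inv_def inner_vec_def sum_2 d_def[symmetric] add_divide_distrib)
  also have "\<dots> = 2 / d - 1" using d(1) unfolding q by (simp add: field_simps)
  finally have s: "1 + stereo_inv v \<bullet> stereo_inv v = 2 / d" by simp
  show ?thesis
    using d(1) by (auto simp: vec_eq_iff forall_3 stereo_nth s) (simp_all add: stereo_inv_def d_def[symmetric] d(2))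
qed

definition stereo' :: "real^2 \<Rightarrow> real^2 \<Rightarrow> real^3" where
  "stereo' u h = (4 * (u \<bullet> h) / (1 + u \<bullet> u)\<^sup>2) *\<^sub>R lift3 u - (2 / (1 + u \<bullet> u)) *\<^sub>R vector [h $ 1, h $ 2, 0]"

lemma has_derivative_stereo: "(stereo has_derivative stereo' u) (at u)"
proof -
  have p: "1 + u \<bullet> u \<noteq> 0" using norm_lift3_pos[of u] by simp
  have l: "bounded_linear (\<lambda>h::real^2. vector [h $ 1, h $ 2, 0] :: real^3)"
    by (rule linear_conv_bounded_linear[THEN iffD1]) (auto intro!: linearI simp: vec_eq_iff forall_3)
  have "lift3 = (\<lambda>h. vector [h $ 1, h $ 2, 0] + axis 3 1)"
    by (auto simp: vec_eq_iff forall_3 axis_def)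
  then have dl: "(lift3 has_derivative (\<lambda>h. vector [h $ 1, h $ 2, 0])) (at u)"
    using has_derivative_add_const[OF bounded_linear_imp_has_derivative[OF l], of "axis 3 1" "at u"] by simp
  have ds: "((\<lambda>u. 2 / (1 + u \<bullet> u)) has_derivative (\<lambda>h. - (4 * (u \<bullet> h) / (1 + u \<bullet> u)\<^sup>2))) (at u)"
    using p by (auto intro!: derivative_eq_intros simp: fun_eq_iff inner_commute power2_eq_square)
  have "stereo' u = (\<lambda>h. 0 - ((2 / (1 + u \<bullet> u)) *\<^sub>R vector [h $ 1, h $ 2, 0] + (- (4 * (u \<bullet> h) / (1 + u \<bullet> u)\<^sup>2)) *\<^sub>R lift3 u))"
    by (auto simp: fun_eq_iff stereo'_def)
  then show ?thesis
    unfolding stereo_alt[abs_def]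
    using has_derivative_diff[OF has_derivative_const has_derivative_scaleR[OF ds dl]] by simp
qed

lemma cross3_stereo':
  "cross3 (stereo' u (axis 1 1)) (stereo' u (axis 2 1)) = - (4 / (1 + u \<bullet> u)\<^sup>2) *\<^sub>R stereo u"
proof -
  define s where "s = 1 + u \<bullet> u"
  have s: "s \<noteq> 0" "u $ 1 * u $ 1 + u $ 2 * u $ 2 = s - 1"
    using norm_lift3_pos[of u] by (auto simp: s_def inner_vec_def sum_2)
  have a: "stereo' u (axis 1 1) = vector [4 * u $ 1 * u $ 1 / s\<^sup>2 - 2 / s, 4 * u $ 1 * u $ 2 / s\<^sup>2, 4 * u $ 1 / s\<^sup>2]"
    and b: "stereo' u (axis 2 1) = vector [4 * u $ 1 * u $ 2 / s\<^sup>2, 4 * u $ 2 * u $ 2 / s\<^sup>2 - 2 / s, 4 * u $ 2 / s\<^sup>2]"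
    by (simp_all add: stereo'_def s_def[symmetric] vec_eq_iff forall_3 inner_axis) (simp_all add: axis_def)
  have "(4 * u $ 1 * u $ 1 / s\<^sup>2 - 2 / s) * (4 * u $ 2 * u $ 2 / s\<^sup>2 - 2 / s) - 4 * u $ 1 * u $ 2 / s\<^sup>2 * (4 * u $ 1 * u $ 2 / s\<^sup>2)
      = 4 / s\<^sup>2 - 8 * (u $ 1 * u $ 1 + u $ 2 * u $ 2) / (s\<^sup>2 * s)"
    using s(1) by (simp add: field_simps power2_eq_square)
  also have "\<dots> = - (4 / s\<^sup>2) * (1 - 2 / s)"
    using s(1) unfolding s(2) by (simp add: field_simps power2_eq_square)
  finally have c3: "(4 * u $ 1 * u $ 1 / s\<^sup>2 - 2 / s) * (4 * u $ 2 * u $ 2 / s\<^sup>2 - 2 / s) - 4 * u $ 1 * u $ 2 / s\<^sup>2 * (4 * u $ 1 * u $ 2 / s\<^sup>2)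
      = - (4 / s\<^sup>2) * (1 - 2 / s)" .
  have c1: "4 * u $ 1 * u $ 2 / s\<^sup>2 * (4 * u $ 2 / s\<^sup>2) - 4 * u $ 1 / s\<^sup>2 * (4 * u $ 2 * u $ 2 / s\<^sup>2 - 2 / s) = - (4 / s\<^sup>2) * (- (2 / s) * u $ 1)"
    and c2: "4 * u $ 1 / s\<^sup>2 * (4 * u $ 1 * u $ 2 / s\<^sup>2) - (4 * u $ 1 * u $ 1 / s\<^sup>2 - 2 / s) * (4 * u $ 2 / s\<^sup>2) = - (4 / s\<^sup>2) * (- (2 / s) * u $ 2)"
    using s(1) by (simp_all add: field_simps power2_eq_square)
  show ?thesis
    unfolding a b cross3_def s_def[symmetric]
    by (simp only: vec_eq_iff forall_3 vector_3 c1 c2 c3 vector_scaleR_component real_scaleR_def stereo_nth s_def[symmetric] simp_thms)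
qed

subsection \<open>The surface measure of an ellipsoid\<close>

lemma borel_Collect_continuous_on:
  fixes r :: "'a::euclidean_space \<Rightarrow> 'b::euclidean_space"
  assumes "open V" "continuous_on V r" "A \<in> sets borel"
  shows "{u \<in> V. r u \<in> A} \<in> sets borel"
proof -
  have [measurable]: "(\<lambda>u. indicator V u *\<^sub>R r u) \<in> borel_measurable borel"
    using assms by (intro borel_measurable_continuous_on_indicator) auto
  have "{u \<in> V. r u \<in> A} = V \<inter> (\<lambda>u. indicator V u *\<^sub>R r u) -` A"
    by auto
  also have "\<dots> \<in> sets borel"
    using assms measurable_sets[OF \<open>(\<lambda>u. indicator V u *\<^sub>R r u) \<in> borel_measurable borel\<close> assms(3)] by auto
  finally show ?thesis .
qed

text \<open>Continuous images of Borel sets need not be Borel, but an open set is a countable union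
  of compact sets, and these have compact images.\<close>

lemma borel_continuous_image_open:
  fixes r :: "'a::euclidean_space \<Rightarrow> 'b::euclidean_space"
  assumes "open V" "continuous_on V r"
  shows "r ` V \<in> sets borel"
proof -
  obtain K where K: "\<And>n::nat. compact (K n)" "\<And>n. K n \<subseteq> V" "\<Union>(range K) = V"
    using open_Union_compact_subsets[OF assms(1)] by metis
  have "compact (r ` K n)" for n
    using K assms(2) by (meson compact_continuous_image continuous_on_subset)
  then have "(\<Union>n. r ` K n) \<in> sets borel"
    by (intro sets.countable_UN) (auto intro: borel_compact)
  also have "(\<Union>n. r ` K n) = r ` V" using K(3) by auto
  finally show ?thesis .
qed

lemma stereo_inv_differentiable:
  assumes "v $ 3 \<noteq> 1"
  shows "stereo_inv differentiable (at v)"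
proof -
  have nth: "((\<lambda>v::real^3. v $ i) has_derivative (\<lambda>h. h $ i)) (at v)" for i
    by (rule bounded_linear_imp_has_derivative) (rule bounded_linear_vec_nth)
  have nd: "(\<lambda>v::real^3. v $ i) differentiable (at v)" for i
    using nth differentiable_def by blast
  have eq: "stereo_inv = (\<lambda>v. (- v $ 1 / (1 - v $ 3)) *\<^sub>R axis 1 1 + (- v $ 2 / (1 - v $ 3)) *\<^sub>R axis 2 1)"
    by (auto simp: stereo_inv_def fun_eq_iff vec_eq_iff forall_2 axis_def)
  show ?thesis
    unfolding eq using assms
    by (intro differentiable_add differentiable_scaleR differentiable_divide
        differentiable_minus differentiable_diff differentiable_const nd; simp)
qed

lemma one_plus_inner_neq_0 [simp]: "1 + u \<bullet> u \<noteq> (0::real)"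
  using norm_lift3_pos[of u] by simp

lemma continuous_on_stereo [continuous_intros]: "continuous_on S f \<Longrightarrow> continuous_on S (\<lambda>x. stereo (f x))"
  unfolding stereo_alt by (intro continuous_intros ballI one_plus_inner_neq_0)

lemma borel_measurable_stereo [measurable]: "stereo \<in> borel_measurable borel"
  by (intro borel_measurable_continuous_onI continuous_intros)

lemma invertible_matrix_inv:
  fixes M :: "real^'n^'n"
  assumes "det M \<noteq> 0"
  shows "M ** matrix_inv M = mat 1" "matrix_inv M ** M = mat 1"
proof -
  have "\<exists>N. M ** N = mat 1 \<and> N ** M = mat 1"
    using assms by (simp add: invertible_det_nz[symmetric] invertible_def)
  then have "M ** matrix_inv M = mat 1 \<and> matrix_inv M ** M = mat 1"
    unfolding matrix_inv_def by (rule someI_ex)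
  then show "M ** matrix_inv M = mat 1" "matrix_inv M ** M = mat 1" by auto
qed

lemma orthogonal_matrix_sphere:
  fixes R :: "real^'n^'n"
  assumes "orthogonal_matrix R"
  shows "(*v) R ` sphere 0 1 = sphere 0 1"
proof -
  have n: "norm (A *v x) = norm x" if "orthogonal_matrix A" for A :: "real^'n^'n" and x
    using that orthogonal_transformation_norm[of "(*v) A" x]
    by (simp add: orthogonal_transformation_matrix)
  have "x \<in> (*v) R ` sphere 0 1" if "norm x = 1" for x
  proof (rule image_eqI)
    show "x = R *v (transpose R *v x)"
      using assms by (simp add: matrix_vector_mul_assoc orthogonal_matrix_def del: transpose_matrix_vector)
    show "transpose R *v x \<in> sphere 0 1"
      using n[of "transpose R" x] assms that by (simp add: orthogonal_matrix_transpose del: transpose_matrix_vector)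
  qed
  then show ?thesis using n[OF assms] by auto
qed

section \<open>Affine images of the unit sphere and their stereographic chart\<close>

locale ellipsoid_chart =
  fixes c :: "real^3" and M :: "real^3^3"
  assumes det_M: "det M \<noteq> 0"
begin

definition pt :: "real^3 \<Rightarrow> real^3" where "pt v = c + M *v v"

definition coord :: "real^3 \<Rightarrow> real^3" where "coord x = matrix_inv M *v (x - c)"

definition surf :: "(real^3) set" where "surf = pt ` sphere 0 1"

text \<open>The length of the unnormalised normal \<open>transpose (matrix_inv M) *v v\<close> at
  \<open>pt v\<close>. Times \<open>\<bar>det M\<bar>\<close> it is the factor by which
  \<open>M\<close> stretches the area of the sphere at the point \<open>v\<close>.\<close>

definition wt :: "real^3 \<Rightarrow> real" where "wt v = norm (transpose (matrix_inv M) *v v)"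

definition chart :: "real^2 \<Rightarrow> real^3" where "chart u = pt (stereo u)"

lemma invertible_M: "M ** matrix_inv M = mat 1" "matrix_inv M ** M = mat 1"
  using invertible_matrix_inv[OF det_M] by auto

lemma coord_pt [simp]: "coord (pt v) = v"
  by (simp add: coord_def pt_def matrix_vector_mul_assoc invertible_M)

lemma pt_coord [simp]: "pt (coord x) = x"
  by (simp add: coord_def pt_def matrix_vector_mul_assoc invertible_M)

lemma surf_iff: "x \<in> surf \<longleftrightarrow> norm (coord x) = 1"
  unfolding surf_def by (auto intro: image_eqI[of _ _ "coord x"])

lemma continuous_on_pt [continuous_intros]: "continuous_on S f \<Longrightarrow> continuous_on S (\<lambda>x. pt (f x))"
  unfolding pt_def by (intro continuous_intros)

lemma continuous_on_coord [continuous_intros]: "continuous_on S f \<Longrightarrow> continuous_on S (\<lambda>x. coord (f x))"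
  unfolding coord_def by (intro continuous_intros)

lemma continuous_on_wt [continuous_intros]: "continuous_on S f \<Longrightarrow> continuous_on S (\<lambda>x. wt (f x))"
  unfolding wt_def by (intro continuous_intros)

lemma continuous_on_chart [continuous_intros]: "continuous_on S f \<Longrightarrow> continuous_on S (\<lambda>x. chart (f x))"
  unfolding chart_def by (intro continuous_intros)

lemma borel_measurable_chart [measurable]: "chart \<in> borel_measurable borel"
  and borel_measurable_coord [measurable]: "coord \<in> borel_measurable borel"
  and borel_measurable_pt [measurable]: "pt \<in> borel_measurable borel"
  and borel_measurable_wt [measurable]: "wt \<in> borel_measurable borel"
  by (intro borel_measurable_continuous_onI continuous_intros)+

lemma closed_surf: "closed surf"
  unfolding surf_def by (intro compact_imp_closed compact_continuous_image continuous_intros compact_sphere)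

lemma surf_borel [measurable]: "surf \<in> sets borel"
  using closed_surf by simp

lemma wt_pos: "v \<noteq> 0 \<Longrightarrow> wt v > 0"
proof -
  assume v: "v \<noteq> 0"
  have "transpose M *v (transpose (matrix_inv M) *v v) = v"
    by (simp add: matrix_vector_mul_assoc invertible_M del: transpose_matrix_vector flip: matrix_transpose_mul)
  then show "wt v > 0" using v by (auto simp: wt_def)
qed

lemma inj_pt: "inj pt"
  by (rule inj_on_inverseI[where g=coord]) simp

lemma inj_chart: "inj chart"
  by (rule inj_on_inverseI[where g="\<lambda>x. stereo_inv (coord x)"]) (simp add: chart_def)

lemma chart_in_surf: "chart u \<in> surf"
  by (simp add: surf_iff chart_def)

lemma chart_neq_pole: "chart u \<noteq> pt (axis 3 1)"
  unfolding chart_def by (metis coord_pt stereo_neq_pole)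

lemma chart_stereo_inv: "x \<in> surf \<Longrightarrow> x \<noteq> pt (axis 3 1) \<Longrightarrow> chart (stereo_inv (coord x)) = x"
  unfolding chart_def surf_iff by (metis pt_coord stereo_stereo_inv)

lemma range_chart: "range chart = surf - {pt (axis 3 1)}"
  using chart_in_surf chart_neq_pole chart_stereo_inv by (auto simp: image_iff) metis

lemma has_derivative_chart: "(chart has_derivative (\<lambda>h. M *v stereo' u h)) (at u)"
proof -
  have "((\<lambda>u. c + M *v stereo u) has_derivative (\<lambda>h. 0 + M *v stereo' u h)) (at u)"
    by (intro has_derivative_add has_derivative_const
        bounded_linear.has_derivative[OF matrix_vector_mul_bounded_linear has_derivative_stereo])
  then show ?thesis by (simp add: chart_def[abs_def] pt_def)
qed

lemma frechet_chart: "frechet_derivative chart (at u) = (\<lambda>h. M *v stereo' u h)"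
  using frechet_derivative_at[OF has_derivative_chart] by simp

lemma area_density_chart:
  "area_density chart u = \<bar>det M\<bar> * wt (stereo u) * (4 / norm (lift3 u) ^ 4)"
proof -
  let ?N = "transpose (matrix_inv M)"
  let ?X = "cross3 (M *v stereo' u (axis 1 1)) (M *v stereo' u (axis 2 1))"
  \<comment> \<open>Inserting \<open>transpose M\<close> brings in the cofactor identity: it takes
    the cross product of two images under \<open>M\<close> to \<open>det M\<close> times the cross
    product of the originals.\<close>
  have "?X = ?N *v (transpose M *v ?X)"
    by (simp add: matrix_vector_mul_assoc invertible_M del: transpose_matrix_vector flip: matrix_transpose_mul)
  also have "\<dots> = det M *\<^sub>R (- (4 / (1 + u \<bullet> u)\<^sup>2)) *\<^sub>R (?N *v stereo u)"
    unfolding cross_matrix_mult cross3_stereo' by (simp only: matrix_vector_mult_scaleR)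
  finally have "norm ?X = \<bar>det M\<bar> * (4 / (1 + u \<bullet> u)\<^sup>2) * wt (stereo u)"
    by (simp add: wt_def abs_mult)
  moreover have "norm (lift3 u) ^ 4 = (1 + u \<bullet> u)\<^sup>2"
    by (simp flip: norm_lift3)
  ultimately show ?thesis
    by (simp add: area_density_def frechet_chart)
qed

lemma area_density_chart_pos: "area_density chart u > 0"
proof -
  have "stereo u \<noteq> 0" using norm_stereo[of u] by force
  then show ?thesis
    using det_M wt_pos[of "stereo u"] unfolding area_density_chart
    by (intro mult_pos_pos divide_pos_pos zero_less_power) auto
qed

lemma regular_patch_chart: "regular_patch surf UNIV chart"
  unfolding regular_patch_def
proof (intro conjI ballI allI)
  show "inj_on chart UNIV" by (rule inj_chart)
  show "chart ` UNIV \<subseteq> surf" using chart_in_surf by auto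
  show "chart differentiable at u" for u
    using has_derivative_chart differentiable_def by blast
  show "continuous_on UNIV (\<lambda>u. frechet_derivative chart (at u) v)" for v
    unfolding frechet_chart stereo'_def
    by (intro continuous_intros) auto
  show "area_density chart u \<noteq> 0" for u using area_density_chart_pos[of u] by simp
qed simp

lemma borel_measurable_area_chart [measurable]: "area_density chart \<in> borel_measurable borel"
  unfolding area_density_chart[abs_def] by measurable

lemma wt_bound: "\<exists>K\<ge>0. \<forall>v. norm v = 1 \<longrightarrow> wt v \<le> K"
proof -
  obtain K where K: "K \<ge> 0" "\<And>v. norm (transpose (matrix_inv M) *v v) \<le> norm v * K"
    using bounded_linear.nonneg_bounded[OF matrix_vector_mul_bounded_linear] by blast
  have "wt v \<le> K" if "norm v = 1" for v
    using K(2)[of v] that unfolding wt_def by simp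
  then show ?thesis using K(1) by blast
qed

text \<open>The weight is bounded on the sphere, so the area is at most a multiple of the area of
  the sphere. The change of variables and the finiteness of the surface measure rest on
  this.\<close>

lemma nn_integral_area_chart_finite: "(\<integral>\<^sup>+u. ennreal (area_density chart u) \<partial>lborel) < \<infinity>"
proof -
  obtain K where K: "K \<ge> 0" "\<And>v. norm v = 1 \<Longrightarrow> wt v \<le> K" using wt_bound by blast
  have "area_density chart u \<le> \<bar>det M\<bar> * K * (4 / norm (lift3 u) ^ 4)" for u
    unfolding area_density_chart using K(2)[of "stereo u"] by (intro mult_right_mono mult_left_mono) auto
  then have "(\<integral>\<^sup>+u. ennreal (area_density chart u) \<partial>lborel) \<le> (\<integral>\<^sup>+u. ennreal (\<bar>det M\<bar> * K * (4 / norm (lift3 u) ^ 4)) \<partial>lborel)"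
    by (intro nn_integral_mono ennreal_leI)
  also have "\<dots> = ennreal (\<bar>det M\<bar> * K * (4 * pi))"
    using K(1) by (intro nn_integral_has_bochner_integral has_bochner_integral_mult_right integral_lift3_4) auto
  finally show ?thesis by (simp add: order_le_less_trans)
qed

text \<open>A single chart carries the whole measure: the pole it omits receives mass 0, and no
  gluing of charts occurs.\<close>

definition patch_measure :: "(real^3) measure" where
  "patch_measure = distr (density lborel (\<lambda>u. ennreal (area_density chart u))) borel chart"

lemma emeasure_patch_measure:
  assumes "A \<in> sets borel"
  shows "emeasure patch_measure A = (\<integral>\<^sup>+u. ennreal (area_density chart u) * indicator (chart -` A) u \<partial>lborel)"
proof -
  have "chart -` A \<in> sets borel" using assms by (rule measurable_sets_borel[OF borel_measurable_chart])
  then show ?thesis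
    unfolding patch_measure_def using assms by (simp add: emeasure_distr emeasure_density)
qed

text \<open>Any other patch is the stereographic chart composed with a plane map, away from at most one parameter.\<close>

lemma patch_measure_regular_patch:
  assumes reg: "regular_patch surf V r" and A: "A \<in> sets borel"
  shows "emeasure patch_measure (A \<inter> r ` V) = (\<integral>\<^sup>+u\<in>{u \<in> V. r u \<in> A}. ennreal (area_density r u) \<partial>lborel)"
proof -
  have V: "open V" and inj: "inj_on r V" and into: "r ` V \<subseteq> surf"
    and diff: "\<And>u. u \<in> V \<Longrightarrow> r differentiable (at u)"
    using reg by (auto simp: regular_patch_def)
  have cont: "continuous_on V r"
    using diff differentiable_imp_continuous_within by (auto intro!: continuous_at_imp_continuous_on)
  \<comment> \<open>Where \<open>r\<close> avoids the pole, the plane map is the inverse chart after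
    \<open>r\<close>.\<close>
  define V' where "V' = {u \<in> V. r u \<in> - {pt (axis 3 1)}}"
  have V': "open V'" "V' \<subseteq> V"
    using continuous_open_preimage[OF cont V, of "- {pt (axis 3 1)}"]
    by (auto simp: V'_def vimage_def Int_def)
  define \<phi> where "\<phi> = (\<lambda>u. stereo_inv (coord (r u)))"
  have chart_\<phi>: "chart (\<phi> u) = r u" if "u \<in> V'" for u
    unfolding \<phi>_def using that into by (intro chart_stereo_inv) (auto simp: V'_def)
  have d\<phi>: "(\<phi> has_derivative frechet_derivative \<phi> (at u)) (at u)" if "u \<in> V'" for u
  proof -
    have "norm (coord (r u)) = 1" "coord (r u) \<noteq> axis 3 1"
      using that into by (auto simp: V'_def surf_iff[symmetric]) (metis pt_coord)
    then have "stereo_inv differentiable (at (coord (r u)))"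
      by (intro stereo_inv_differentiable) (simp add: unit_nth3_eq_1)
    moreover have "(\<lambda>u. coord (r u)) differentiable (at u)"
    proof -
      have "r differentiable (at u)" using diff that V'(2) by auto
      then obtain r' where "(r has_derivative r') (at u)"
        unfolding differentiable_def by blast
      then have "((\<lambda>u. matrix_inv M *v (r u - c)) has_derivative (\<lambda>h. matrix_inv M *v (r' h - 0))) (at u)"
        by (intro bounded_linear.has_derivative[OF matrix_vector_mul_bounded_linear] has_derivative_diff has_derivative_const)
      then show ?thesis unfolding coord_def differentiable_def by blast
    qed
    ultimately have "\<phi> differentiable (at u)"
      unfolding \<phi>_def using differentiable_compose[of stereo_inv "\<lambda>u. coord (r u)" u UNIV] by simp
    then show ?thesis by (simp add: frechet_derivative_works)
  qed
  have area: "area_density r u = \<bar>det (matrix (frechet_derivative \<phi> (at u)))\<bar> * area_density chart (\<phi> u)"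
    if u: "u \<in> V'" for u
  proof -
    let ?\<phi>' = "frechet_derivative \<phi> (at u)"
    let ?T = "\<lambda>h. M *v stereo' (\<phi> u) h"
    have "((\<lambda>u. chart (\<phi> u)) has_derivative (\<lambda>h. ?T (?\<phi>' h))) (at u)"
      using has_derivative_compose[OF d\<phi>[OF u] has_derivative_chart] .
    then have "(r has_derivative (\<lambda>h. ?T (?\<phi>' h))) (at u)"
      using V'(1) u chart_\<phi> by (rule has_derivative_transform_within_open)
    then have fr: "frechet_derivative r (at u) = (\<lambda>h. ?T (?\<phi>' h))"
      by (metis frechet_derivative_at)
    have "linear ?T" using has_derivative_chart by (blast intro: has_derivative_linear)
    moreover have "linear ?\<phi>'" using d\<phi>[OF u] by (rule has_derivative_linear)
    ultimately have "cross3 (?T (?\<phi>' (axis 1 1))) (?T (?\<phi>' (axis 2 1)))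
        = det (matrix ?\<phi>') *\<^sub>R cross3 (?T (axis 1 1)) (?T (axis 2 1))"
      by (rule cross3_linear_image_R2)
    then show ?thesis
      by (simp add: area_density_def fr frechet_chart)
  qed
  have inj\<phi>: "inj_on \<phi> V'"
    using inj V'(2) chart_\<phi> by (metis (no_types, lifting) inj_on_def subsetD)
  define B where "B = {u \<in> V'. r u \<in> A}"
  have B: "B \<in> sets borel" "B \<subseteq> V'"
    using V' cont A unfolding B_def by (auto intro!: borel_Collect_continuous_on intro: continuous_on_subset)
  have rV: "r ` V \<in> sets borel" by (rule borel_continuous_image_open[OF V cont])
  \<comment> \<open>The image of \<open>B\<close> must be Borel for the change of variables.
    Recognising it as a preimage under the chart settles this and also identifies the
    measure.\<close>
  have \<phi>B: "\<phi> ` B = chart -` (A \<inter> r ` V)"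
  proof (intro set_eqI iffI)
    fix w assume "w \<in> chart -` (A \<inter> r ` V)"
    then obtain u where u: "u \<in> V" "chart w = r u" "r u \<in> A" by auto
    then have "u \<in> B" using chart_neq_pole[of w] by (auto simp: B_def V'_def)
    moreover have "\<phi> u = w" unfolding \<phi>_def u(2)[symmetric] chart_def by simp
    ultimately show "w \<in> \<phi> ` B" by blast
  qed (use chart_\<phi> V' in \<open>auto simp: B_def\<close>)
  have "emeasure patch_measure (A \<inter> r ` V) = (\<integral>\<^sup>+u. ennreal (area_density chart u) * indicator (\<phi> ` B) u \<partial>lborel)"
    unfolding \<phi>B using A rV by (intro emeasure_patch_measure) auto
  also have "\<dots> = (\<integral>\<^sup>+u. ennreal (\<bar>det (matrix (frechet_derivative \<phi> (at u)))\<bar> * area_density chart (\<phi> u)) * indicator B u \<partial>lborel)"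
  proof (rule nn_integral_change_of_variables[symmetric])
    show "\<phi> ` B \<in> sets borel"
      unfolding \<phi>B using A rV by (intro measurable_sets_borel[OF borel_measurable_chart]) auto
    show "(\<phi> has_derivative frechet_derivative \<phi> (at x)) (at x within B)" if "x \<in> B" for x
      using d\<phi> B that by (meson has_derivative_at_withinI subsetD)
    show "inj_on \<phi> B" using inj\<phi> B(2) by (rule inj_on_subset)
    show "0 \<le> area_density chart u" for u using area_density_chart_pos[of u] by simp
    show "B \<in> sets borel" by (rule B(1))
    show "area_density chart \<in> borel_measurable borel" by (rule borel_measurable_area_chart)
    show "(\<integral>\<^sup>+u. ennreal (area_density chart u) \<partial>lborel) < \<infinity>" by (rule nn_integral_area_chart_finite)
  qed
  also have "\<dots> = (\<integral>\<^sup>+u. ennreal (area_density r u) * indicator B u \<partial>lborel)"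
  proof (rule nn_integral_cong)
    fix u show "ennreal (\<bar>det (matrix (frechet_derivative \<phi> (at u)))\<bar> * area_density chart (\<phi> u)) * indicator B u
      = ennreal (area_density r u) * indicator B u"
      using area[of u] B(2) by (cases "u \<in> B") auto
  qed
  also have "\<dots> = (\<integral>\<^sup>+u\<in>{u \<in> V. r u \<in> A}. ennreal (area_density r u) \<partial>lborel)"
  proof (rule nn_integral_cong_AE)
    have "r ` (V - V') \<subseteq> {pt (axis 3 1)}" by (auto simp: V'_def)
    then have "finite (r ` (V - V'))" by (rule finite_subset) simp
    then have "finite (V - V')"
      by (rule finite_imageD) (rule inj_on_subset[OF inj Diff_subset])
    then have "V - V' \<in> null_sets lborel" by (rule finite_imp_null_set_lborel)
    then have "AE u in lborel. u \<notin> V - V'" by (rule AE_not_in)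
    then show "AE u in lborel. ennreal (area_density r u) * indicator B u = ennreal (area_density r u) * indicator {u \<in> V. r u \<in> A} u"
      by eventually_elim (use V' in \<open>auto simp: B_def indicator_def\<close>)
  qed
  finally show ?thesis .
qed

lemma is_surface_measure_patch_measure: "is_surface_measure surf patch_measure"
  unfolding is_surface_measure_def
proof (intro conjI allI impI)
  have "chart -` (- surf) = {}" using chart_in_surf by auto
  then show "emeasure patch_measure (- surf) = 0"
    by (subst emeasure_patch_measure) auto
qed (auto simp: patch_measure_def[THEN arg_cong[where f=sets]] patch_measure_def[THEN arg_cong[where f=space]] patch_measure_regular_patch)

end

section \<open>Change of pole and uniqueness of the surface measure\<close>

context ellipsoid_chart
begin

text \<open>Replacing \<open>M\<close> by \<open>M ** R\<close> changes how the sphere parametrises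
  the ellipsoid but not the ellipsoid; the pole moves to \<open>pt (R *v axis 3 1)\<close>, which
  can be any point of the surface.\<close>

lemma rotate: "orthogonal_matrix R \<Longrightarrow> ellipsoid_chart (M ** R)"
  using det_M det_orthogonal_matrix[of R] by unfold_locales (auto simp: det_mul)

lemma pt_rotate: "orthogonal_matrix R \<Longrightarrow> ellipsoid_chart.pt c (M ** R) v = pt (R *v v)"
  by (simp add: pt_def ellipsoid_chart.pt_def[OF rotate] matrix_vector_mul_assoc)

lemma surf_rotate:
  assumes R: "orthogonal_matrix R"
  shows "ellipsoid_chart.surf c (M ** R) = surf"
proof -
  have "ellipsoid_chart.surf c (M ** R) = pt ` ((*v) R ` sphere 0 1)"
    by (simp add: ellipsoid_chart.surf_def[OF rotate[OF R]] pt_rotate[OF R] image_image)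
  then show ?thesis by (simp add: orthogonal_matrix_sphere[OF R] surf_def)
qed

text \<open>One chart misses a single point; a second chart with a different pole shows that it is null.\<close>

lemma is_surface_measure_unique:
  assumes "is_surface_measure surf \<sigma>"
  shows "\<sigma> = patch_measure"
proof (rule measure_eqI)
  have sets: "sets \<sigma> = sets borel" and off: "emeasure \<sigma> (- surf) = 0"
    and patch: "\<And>U r A. regular_patch surf U r \<Longrightarrow> A \<in> sets borel \<Longrightarrow>
      emeasure \<sigma> (A \<inter> r ` U) = (\<integral>\<^sup>+u\<in>{u \<in> U. r u \<in> A}. ennreal (area_density r u) \<partial>lborel)"
    using assms by (auto simp: is_surface_measure_def)
  show "sets \<sigma> = sets patch_measure" by (simp add: sets patch_measure_def)
  obtain R :: "real^3^3" where R: "orthogonal_matrix R" "R *v axis 3 1 = - axis 3 1"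
    using orthogonal_matrix_exists_basis[of "- axis 3 1 :: real^3"] by (metis norm_axis_1 norm_minus_cancel)
  interpret N: ellipsoid_chart c "M ** R" by (rule rotate[OF R(1)])
  have "(- axis 3 1 :: real^3) \<noteq> axis 3 1"
    by (auto simp: vec_eq_iff axis_def)
  then have "pt (axis 3 1) \<in> N.surf" "pt (axis 3 1) \<noteq> N.pt (axis 3 1)"
    using inj_pt[THEN injD, of "axis 3 1" "- axis 3 1"]
    by (auto simp: surf_rotate[OF R(1)] surf_iff pt_rotate[OF R(1)] R(2))
  then have "pt (axis 3 1) \<in> range N.chart" unfolding N.range_chart by simp
  then have "emeasure \<sigma> {pt (axis 3 1)} = emeasure \<sigma> ({pt (axis 3 1)} \<inter> N.chart ` UNIV)"
    by (intro arg_cong[where f="emeasure \<sigma>"]) auto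
  also have "\<dots> = (\<integral>\<^sup>+u\<in>{u \<in> UNIV. N.chart u \<in> {pt (axis 3 1)}}. ennreal (area_density N.chart u) \<partial>lborel)"
    using N.regular_patch_chart by (intro patch) (simp_all add: surf_rotate[OF R(1)])
  also have "\<dots> = 0"
  proof -
    have "finite (N.chart -` {pt (axis 3 1)})"
      by (intro finite_vimageI N.inj_chart) auto
    then have "{u \<in> UNIV. N.chart u \<in> {pt (axis 3 1)}} \<in> null_sets lborel"
      by (intro finite_imp_null_set_lborel) (simp add: vimage_def)
    then have "AE u in lborel. u \<notin> {u \<in> UNIV. N.chart u \<in> {pt (axis 3 1)}}" by (rule AE_not_in)
    then have "AE u in lborel. ennreal (area_density N.chart u) * indicator {u \<in> UNIV. N.chart u \<in> {pt (axis 3 1)}} u = 0"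
      by eventually_elim simp
    then have "(\<integral>\<^sup>+u\<in>{u \<in> UNIV. N.chart u \<in> {pt (axis 3 1)}}. ennreal (area_density N.chart u) \<partial>lborel)
        = (\<integral>\<^sup>+u. 0 \<partial>(lborel :: (real^2) measure))"
      by (rule nn_integral_cong_AE)
    then show ?thesis by simp
  qed
  finally have pole: "emeasure \<sigma> {pt (axis 3 1)} = 0" .
  fix A assume "A \<in> sets \<sigma>"
  then have A: "A \<in> sets borel" by (simp add: sets)
  have rb: "range chart \<in> sets borel"
    by (intro borel_continuous_image_open continuous_intros) auto
  have null: "- range chart \<in> null_sets \<sigma>"
  proof -
    have "- surf \<in> null_sets \<sigma>" "{pt (axis 3 1)} \<in> null_sets \<sigma>"
      using off pole by (auto simp: null_sets_def sets)
    then have "- surf \<union> {pt (axis 3 1)} \<in> null_sets \<sigma>" by (rule null_sets.Un)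
    moreover have "- range chart \<subseteq> - surf \<union> {pt (axis 3 1)}" by (auto simp: range_chart)
    moreover have "- range chart \<in> sets \<sigma>" using rb by (simp add: sets)
    ultimately show ?thesis using null_sets_subset by blast
  qed
  have "AE x in \<sigma>. x \<notin> - range chart" using null by (rule AE_not_in)
  then have "AE x in \<sigma>. x \<in> A \<longleftrightarrow> x \<in> A \<inter> chart ` UNIV"
    by eventually_elim auto
  then have "emeasure \<sigma> A = emeasure \<sigma> (A \<inter> chart ` UNIV)"
    using A rb by (intro emeasure_eq_AE) (simp_all add: sets)
  also have "\<dots> = (\<integral>\<^sup>+u\<in>{u \<in> UNIV. chart u \<in> A}. ennreal (area_density chart u) \<partial>lborel)"
    by (rule patch[OF regular_patch_chart A])
  also have "\<dots> = emeasure patch_measure A"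
    unfolding emeasure_patch_measure[OF A] vimage_def by simp
  finally show "emeasure \<sigma> A = emeasure patch_measure A" .
qed

theorem surface_measure_surf: "surface_measure surf = patch_measure"
  unfolding surface_measure_def
proof (rule the_equality)
  show "is_surface_measure surf patch_measure" by (rule is_surface_measure_patch_measure)
qed (rule is_surface_measure_unique)

lemma surface_measure_rotate:
  assumes "orthogonal_matrix R"
  shows "surface_measure surf = ellipsoid_chart.patch_measure c (M ** R)"
  using ellipsoid_chart.surface_measure_surf[OF rotate[OF assms], of c] by (simp add: surf_rotate[OF assms])

end

subsection \<open>Outward normal\<close>

lemma cart_eq_matrix_vector_mult_transpose:
  fixes A :: "real^'n^'n"
  shows "(A *v x) \<bullet> y = x \<bullet> (transpose A *v y)"
  by (metis dot_lmul_matrix transpose_matrix_vector vector_transpose_matrix inner_commute transpose_transpose)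

context ellipsoid_chart
begin

definition solid :: "(real^3) set" where "solid = {x. norm (coord x) < 1}"

text \<open>The normalised gradient of half the square of \<open>norm (coord x)\<close>.\<close>

definition nrm :: "real^3 \<Rightarrow> real^3" where
  "nrm x = (1 / wt (coord x)) *\<^sub>R (transpose (matrix_inv M) *v coord x)"

lemma pt_image: "pt ` S = {x. coord x \<in> S}"
proof (intro set_eqI iffI)
  fix x assume "x \<in> {x. coord x \<in> S}"
  then have "pt (coord x) \<in> pt ` S" by blast
  then show "x \<in> pt ` S" by simp
qed auto

lemma solid_eq: "solid = (+) c ` (*v) M ` ball 0 1"
proof -
  have "solid = pt ` ball 0 1"
    by (simp add: solid_def pt_image)
  then show ?thesis by (simp add: image_image pt_def[abs_def])
qed

lemma inj_M: "inj ((*v) M)"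
  by (rule inj_on_inverseI[where g="(*v) (matrix_inv M)"]) (simp add: matrix_vector_mul_assoc invertible_M)

lemma frontier_solid: "frontier solid = surf"
proof -
  have "open solid"
    unfolding solid_def by (intro open_Collect_less continuous_intros)
  then have "interior solid = solid" by (rule interior_open)
  have "closure solid = (+) c ` (*v) M ` closure (ball 0 1)"
    unfolding solid_eq closure_translation
    by (rule arg_cong[OF closure_injective_linear_image[OF matrix_vector_mul_linear inj_M, symmetric]])
  also have "closure (ball (0::real^3) 1) = cball 0 1" by simp
  also have "(+) c ` (*v) M ` cball 0 1 = pt ` cball 0 1"
    unfolding image_image pt_def[abs_def] ..
  finally have "closure solid = pt ` cball 0 1" .
  then have "closure solid = {x. norm (coord x) \<le> 1}"
    by (simp add: pt_image)
  then have fr: "frontier solid = {x. norm (coord x) \<le> 1} - solid"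
    unfolding frontier_def \<open>interior solid = solid\<close> by simp
  have "{x. norm (coord x) \<le> 1} - solid = surf" by (intro set_eqI) (auto simp: surf_iff solid_def)
  with fr show ?thesis by simp
qed

lemma measure_solid: "measure lebesgue solid = \<bar>det M\<bar> * (4 / 3 * pi)"
proof -
  have "measure lebesgue solid = \<bar>det M\<bar> * measure lebesgue (ball (0::real^3) 1)"
    unfolding solid_eq measure_translation
    by (subst measure_linear_image) (simp_all add: matrix_vector_mul_linear)
  also have "measure lebesgue (ball (0::real^3) 1) = 4 / 3 * pi"
    using content_ball[of 1 "0::real^3"] by (simp add: unit_ball_vol_3)
  finally show ?thesis .
qed

lemma inner_nrm: "(y - x) \<bullet> nrm x = ((coord y - coord x) \<bullet> coord x) / wt (coord x)"
proof -
  have "y - x = M *v (coord y - coord x)"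
    using pt_coord[of x] pt_coord[of y] by (simp add: pt_def matrix_vector_mult_diff_distrib) (metis add_diff_cancel_left)
  then have "(y - x) \<bullet> (transpose (matrix_inv M) *v coord x)
      = (coord y - coord x) \<bullet> (transpose M *v (transpose (matrix_inv M) *v coord x))"
    by (simp add: cart_eq_matrix_vector_mult_transpose del: transpose_matrix_vector)
  also have "transpose M *v (transpose (matrix_inv M) *v coord x) = coord x"
    by (simp add: matrix_vector_mul_assoc invertible_M del: transpose_matrix_vector flip: matrix_transpose_mul)
  finally show ?thesis by (simp add: nrm_def del: transpose_matrix_vector)
qed

text \<open>Expanding the square of \<open>norm (coord y)\<close> around \<open>coord x\<close> is
  exact at second order. The sign of the first difference tells inside from outside, which gives the
  normal; for \<open>y\<close> on the surface only the last square remains, which gives the symmetry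
  of the kernel.\<close>

lemma inner_nrm_surf:
  assumes "x \<in> surf"
  shows "(y - x) \<bullet> nrm x = ((norm (coord y))\<^sup>2 - 1 - (norm (coord y - coord x))\<^sup>2) / (2 * wt (coord x))"
proof -
  have "coord x \<bullet> coord x = 1" using assms by (simp add: surf_iff norm_eq_1)
  then have "2 * ((coord y - coord x) \<bullet> coord x) = (norm (coord y))\<^sup>2 - 1 - (norm (coord y - coord x))\<^sup>2"
    by (simp add: power2_norm_eq_inner inner_diff_left inner_diff_right inner_commute[of "coord x" "coord y"])
  then have eq: "(coord y - coord x) \<bullet> coord x = ((norm (coord y))\<^sup>2 - 1 - (norm (coord y - coord x))\<^sup>2) / 2"
    by simp
  show ?thesis unfolding inner_nrm eq by (rule divide_divide_eq_left)
qed

lemma wt_coord_pos: "x \<in> surf \<Longrightarrow> wt (coord x) > 0"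
  by (rule wt_pos) (auto simp: surf_iff)

lemma norm_nrm: "x \<in> surf \<Longrightarrow> norm (nrm x) = 1"
  using wt_coord_pos[of x] by (simp add: nrm_def wt_def)

lemma outward_normal_solid:
  assumes x: "x \<in> surf"
  shows "outward_normal solid x = nrm x"
  unfolding outward_normal_def
proof (rule the_equality)
  have w: "wt (coord x) > 0" using wt_coord_pos[OF x] .
  obtain K where K: "K \<ge> 0" "\<And>z. norm (matrix_inv M *v z) \<le> norm z * K"
    using bounded_linear.nonneg_bounded[OF matrix_vector_mul_bounded_linear] by blast
  have cK: "norm (coord y - coord x) \<le> norm (y - x) * K" for y
    using K(2)[of "y - x"] by (simp add: coord_def flip: matrix_vector_mult_diff_distrib)
  show "norm (nrm x) = 1 \<and> (\<forall>\<epsilon>>0. \<forall>\<^sub>F y in nhds x. (y \<in> solid \<longrightarrow> (y - x) \<bullet> nrm x \<le> \<epsilon> * norm (y - x)) \<and>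
     (y \<notin> solid \<longrightarrow> (y - x) \<bullet> nrm x \<ge> - \<epsilon> * norm (y - x)))"
  proof (intro conjI allI impI)
    show "norm (nrm x) = 1" by (rule norm_nrm[OF x])
    fix \<epsilon> :: real assume e: "\<epsilon> > 0"
    \<comment> \<open>\<open>K\<close> is a Lipschitz constant of \<open>coord\<close>, so the
      quadratic error in \<open>inner_nrm_surf\<close> is at most \<open>C - 1\<close> times the
      squared distance; the added 1 keeps \<open>C\<close> positive.\<close>
    define C where "C = K\<^sup>2 / (2 * wt (coord x)) + 1"
    have C: "C > 0" using w by (simp add: C_def add_nonneg_pos)
    have "\<forall>\<^sub>F y in nhds x. dist y x < \<epsilon> / C"
      using e C by (auto simp: eventually_nhds_metric intro!: exI[of _ "\<epsilon> / C"])
    then show "\<forall>\<^sub>F y in nhds x. (y \<in> solid \<longrightarrow> (y - x) \<bullet> nrm x \<le> \<epsilon> * norm (y - x)) \<and>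
     (y \<notin> solid \<longrightarrow> (y - x) \<bullet> nrm x \<ge> - \<epsilon> * norm (y - x))"
    proof eventually_elim
      case (elim y)
      have "(y - x) \<bullet> nrm x \<le> \<epsilon> * norm (y - x)" if "y \<in> solid"
      proof -
        have "(norm (coord y))\<^sup>2 \<le> 1" using that by (simp add: solid_def power_le_one)
        then have "(norm (coord y))\<^sup>2 - 1 - (norm (coord y - coord x))\<^sup>2 \<le> 0"
          using zero_le_power2[of "norm (coord y - coord x)"] by linarith
        then have "(y - x) \<bullet> nrm x \<le> 0"
          unfolding inner_nrm_surf[OF x] using w by (intro divide_nonpos_pos) auto
        also have "0 \<le> \<epsilon> * norm (y - x)" using e by simp
        finally show ?thesis .
      qed
      moreover have "(y - x) \<bullet> nrm x \<ge> - \<epsilon> * norm (y - x)" if "y \<notin> solid"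
      proof -
        have "1 \<le> (norm (coord y))\<^sup>2" using that by (simp add: solid_def one_le_power)
        moreover have "(norm (coord y - coord x))\<^sup>2 \<le> (norm (y - x) * K)\<^sup>2"
          using cK[of y] by (intro power_mono) auto
        ultimately have "- ((norm (y - x) * K)\<^sup>2) \<le> (norm (coord y))\<^sup>2 - 1 - (norm (coord y - coord x))\<^sup>2"
          by linarith
        then have "- ((norm (y - x) * K)\<^sup>2) / (2 * wt (coord x)) \<le> (y - x) \<bullet> nrm x"
          unfolding inner_nrm_surf[OF x] using w by (intro divide_right_mono) auto
        moreover have "(norm (y - x) * K)\<^sup>2 / (2 * wt (coord x)) \<le> \<epsilon> * norm (y - x)"
        proof -
          have "(norm (y - x) * K)\<^sup>2 / (2 * wt (coord x)) = norm (y - x) * (norm (y - x) * (C - 1))"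
            by (simp add: C_def power_mult_distrib power2_eq_square)
          also have "\<dots> \<le> norm (y - x) * \<epsilon>"
          proof (rule mult_left_mono)
            have "norm (y - x) * (C - 1) \<le> norm (y - x) * C" by (intro mult_left_mono) auto
            also have "\<dots> \<le> \<epsilon>" using elim C by (simp add: dist_norm field_simps)
            finally show "norm (y - x) * (C - 1) \<le> \<epsilon>" .
          qed simp
          finally show ?thesis by (simp add: mult.commute)
        qed
        ultimately show ?thesis by linarith
      qed
      ultimately show ?case by blast
    qed
  qed
next
  fix n :: "real^3"
  assume n: "norm n = 1 \<and> (\<forall>\<epsilon>>0. \<forall>\<^sub>F y in nhds x. (y \<in> solid \<longrightarrow> (y - x) \<bullet> n \<le> \<epsilon> * norm (y - x)) \<and>
     (y \<notin> solid \<longrightarrow> (y - x) \<bullet> n \<ge> - \<epsilon> * norm (y - x)))"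
  have w: "wt (coord x) > 0" using wt_coord_pos[OF x] .
  \<comment> \<open>A direction with negative product against \<open>nrm x\<close> enters the solid,
    so a competing normal \<open>n\<close> may not have a positive product with it.\<close>
  have *: "v \<bullet> n \<le> 0" if v: "v \<bullet> nrm x < 0" for v
  proof (rule ccontr)
    assume "\<not> v \<bullet> n \<le> 0"
    then have vn: "v \<bullet> n > 0" "v \<noteq> 0" by auto
    define \<epsilon> where "\<epsilon> = v \<bullet> n / (2 * norm v)"
    have e: "\<epsilon> > 0" using vn by (simp add: \<epsilon>_def)
    define q where "q = matrix_inv M *v v"
    have cq: "coord (x + t *\<^sub>R v) = coord x + t *\<^sub>R q" for t
      by (simp add: coord_def q_def algebra_simps)
    have qx: "q \<bullet> coord x < 0"
    proof -
      have "v \<bullet> nrm x = (q \<bullet> coord x) / wt (coord x)"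
        using inner_nrm[of "x + v" x] cq[of 1] by simp
      then show ?thesis using v w by (simp add: divide_less_0_iff)
    qed
    have lim: "((\<lambda>t. x + t *\<^sub>R v) \<longlongrightarrow> x) (at_right 0)"
      by (auto intro!: tendsto_eq_intros)
    have 1: "\<forall>\<^sub>F t in at_right 0. x + t *\<^sub>R v \<in> solid \<longrightarrow> (t *\<^sub>R v) \<bullet> n \<le> \<epsilon> * norm (t *\<^sub>R v)"
    proof -
      have "\<forall>\<^sub>F y in nhds x. (y \<in> solid \<longrightarrow> (y - x) \<bullet> n \<le> \<epsilon> * norm (y - x)) \<and>
          (y \<notin> solid \<longrightarrow> (y - x) \<bullet> n \<ge> - \<epsilon> * norm (y - x))"
        using n e by blast
      from eventually_compose_filterlim[OF this lim] show ?thesis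
        by eventually_elim simp
    qed
    \<comment> \<open>Below this threshold
      \<open>2 * (q \<bullet> coord x) + t * (q \<bullet> q)\<close> is negative, so
      \<open>x + t *\<^sub>R v\<close> lies in the solid. The 1 in the denominator guards against
      \<open>q = 0\<close>.\<close>
    have "\<forall>\<^sub>F t in at_right 0. t < - (2 * (q \<bullet> coord x)) / (q \<bullet> q + 1)"
    proof (rule order_tendstoD[OF tendsto_ident_at])
      have "q \<bullet> q + 1 > 0" by (simp add: add_nonneg_pos)
      then show "0 < - (2 * (q \<bullet> coord x)) / (q \<bullet> q + 1)" using qx by (intro divide_pos_pos) auto
    qed
    moreover have "\<forall>\<^sub>F t in at_right (0::real). t > 0" by (simp add: eventually_at_right_less)
    ultimately have "\<forall>\<^sub>F t in at_right (0::real). False"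
      using 1
    proof eventually_elim
      case (elim t)
      have "q \<bullet> q + 1 > 0" by (simp add: add_nonneg_pos)
      then have "t * (q \<bullet> q + 1) < - (2 * (q \<bullet> coord x))"
        using elim(1) pos_less_divide_eq by blast
      then have "2 * (q \<bullet> coord x) + t * (q \<bullet> q) < 0" using elim(2) by (simp add: algebra_simps)
      then have "t * (2 * (q \<bullet> coord x) + t * (q \<bullet> q)) < 0" using elim(2) by (simp add: mult_pos_neg)
      moreover have "coord x \<bullet> coord x = 1" using x by (simp add: surf_iff norm_eq_1)
      ultimately have "(coord x + t *\<^sub>R q) \<bullet> (coord x + t *\<^sub>R q) < 1"
        by (simp add: inner_add_left inner_add_right inner_commute[of "coord x" q] algebra_simps)
      then have "x + t *\<^sub>R v \<in> solid" by (simp add: solid_def cq norm_lt_square)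
      then have "t * (v \<bullet> n) \<le> \<epsilon> * (t * norm v)" using elim by simp
      then have "t * (v \<bullet> n) \<le> t * (v \<bullet> n) / 2" using vn(2) by (simp add: \<epsilon>_def)
      moreover have "t * (v \<bullet> n) > 0" using elim(2) vn by simp
      ultimately show False by linarith
    qed
    then show False by simp
  qed
  show "n = nrm x"
  proof (rule ccontr)
    assume ne: "n \<noteq> nrm x"
    have nn: "n \<bullet> n = 1" "nrm x \<bullet> nrm x = 1" using n norm_nrm[OF x] by (simp_all add: norm_eq_1)
    have "(n - nrm x) \<bullet> (n - nrm x) > 0" using ne by simp
    then have "n \<bullet> nrm x < 1"
      using nn by (simp add: inner_diff_left inner_diff_right inner_commute[of "nrm x" n])
    \<comment> \<open>For distinct unit vectors the difference has products of opposite sign with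
      the two, so it is a direction excluded by \<open>*\<close>.\<close>
    then have "(n - nrm x) \<bullet> nrm x < 0" "(n - nrm x) \<bullet> n > 0"
      using nn by (simp_all add: inner_diff_left inner_commute[of "nrm x" n])
    then show False using * by fastforce
  qed
qed

abbreviation \<sigma> :: "(real^3) measure" where "\<sigma> \<equiv> surface_measure surf"

text \<open>Every rotated chart computes the same measure, so each integral below may choose its own
  pole.\<close>

lemma surface_measure_rotated:
  assumes R: "orthogonal_matrix R"
  shows "\<sigma> = distr (density lborel (\<lambda>u. ennreal (\<bar>det M\<bar> * wt (R *v stereo u) * (4 / norm (lift3 u) ^ 4))))
      borel (\<lambda>u. pt (R *v stereo u))"
proof -
  interpret N: ellipsoid_chart c "M ** R" by (rule rotate[OF R])
  have "\<bar>det (M ** R)\<bar> = \<bar>det M\<bar>" using det_orthogonal_matrix[OF R] by (auto simp: det_mul)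
  moreover have "N.wt v = wt (R *v v)" for v
  proof -
    have RR: "R ** transpose R = mat 1" "transpose R ** R = mat 1" using R by (simp_all add: orthogonal_matrix_def)
    have "matrix_inv (M ** R) = transpose R ** matrix_inv M"
    proof -
      have "matrix_inv (M ** R) = matrix_inv (M ** R) ** (M ** (R ** transpose R) ** matrix_inv M)"
        by (simp add: RR invertible_M)
      also have "\<dots> = (matrix_inv (M ** R) ** (M ** R)) ** (transpose R ** matrix_inv M)"
        by (simp only: matrix_mul_assoc)
      finally show ?thesis by (simp add: N.invertible_M)
    qed
    then show ?thesis
      by (simp add: N.wt_def wt_def matrix_transpose_mul matrix_vector_mul_assoc del: transpose_matrix_vector)
  qed
  ultimately have area: "area_density N.chart u = \<bar>det M\<bar> * wt (R *v stereo u) * (4 / norm (lift3 u) ^ 4)" for u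
    by (simp add: N.area_density_chart)
  have chart: "N.chart = (\<lambda>u. pt (R *v stereo u))"
    by (simp add: N.chart_def[abs_def] pt_rotate[OF R])
  show ?thesis
    unfolding surface_measure_rotate[OF R] N.patch_measure_def area unfolding chart ..
qed

end

subsection \<open>The Neumann--Poincare kernel\<close>

lemma borel_measurable_matrix_vector_mult [measurable]:
  fixes A :: "real^'n^'m"
  shows "(*v) A \<in> borel_measurable borel"
  by (intro borel_measurable_continuous_onI continuous_intros)

lemma norm_orthogonal_matrix_mult:
  fixes R :: "real^'n^'n"
  shows "orthogonal_matrix R \<Longrightarrow> norm (R *v x) = norm x"
  using orthogonal_transformation_norm[of "(*v) R" x] by (simp add: orthogonal_transformation_matrix)

lemma posdef3_gram:
  fixes N :: "real^3^3"
  assumes "det N \<noteq> 0"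
  shows "posdef3 (transpose N ** N)"
proof
  show "transpose (transpose N ** N) = transpose N ** N" by (simp add: matrix_transpose_mul)
  fix x :: "real^3" assume x: "x \<noteq> 0"
  have "N *v x \<noteq> 0"
  proof
    assume "N *v x = 0"
    then have "matrix_inv N *v (N *v x) = 0" by simp
    with x show False by (simp add: matrix_vector_mul_assoc invertible_matrix_inv[OF assms])
  qed
  then show "x \<bullet> ((transpose N ** N) *v x) > 0"
    by (simp add: cart_eq_matrix_vector_mult_transpose[symmetric] del: transpose_matrix_vector flip: matrix_vector_mul_assoc)
qed

lemma form_gram:
  fixes N :: "real^3^3"
  assumes "det N \<noteq> 0"
  shows "posdef3.form (transpose N ** N) x = (norm (N *v x))\<^sup>2"
  unfolding posdef3.form_def[OF posdef3_gram[OF assms]] power2_norm_eq_inner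
  by (simp add: cart_eq_matrix_vector_mult_transpose[symmetric] del: transpose_matrix_vector flip: matrix_vector_mul_assoc)

lemma integral_norm_lift3_3:
  fixes N :: "real^3^3"
  assumes "det N \<noteq> 0"
  shows "has_bochner_integral lborel (\<lambda>u. 1 / norm (N *v lift3 u) ^ 3) (2 * pi / \<bar>det N\<bar>)"
proof -
  interpret posdef3 "transpose N ** N" by (rule posdef3_gram[OF assms])
  have "sqrt (det (transpose N ** N)) = \<bar>det N\<bar>" by (simp add: det_mul det_transpose)
  then have "(\<integral>\<^sup>+u. ennreal (1 / norm (N *v lift3 u) ^ 3) \<partial>lborel) = ennreal (2 * pi / \<bar>det N\<bar>)"
    using nn_integral_form_32 by (simp add: form_gram[OF assms])
  then show ?thesis by (intro has_bochner_integral_nn_integral) auto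
qed

lemma borel_measurable_stereo_nth [measurable]: "(\<lambda>u. stereo u $ k) \<in> borel_measurable borel"
  unfolding cart_eq_inner_axis by measurable

text \<open>The integral of the product of two linear functions over the unit sphere, written in
  stereographic coordinates.\<close>

definition sphere_moment :: "real^3 \<Rightarrow> real^3 \<Rightarrow> real" where
  "sphere_moment a b = (\<integral>u. (a \<bullet> stereo u) * (b \<bullet> stereo u) * (4 / norm (lift3 u) ^ 4) \<partial>lborel)"

context ellipsoid_chart
begin

definition jac :: "real^3^3 \<Rightarrow> real^2 \<Rightarrow> real" where
  "jac R u = \<bar>det M\<bar> * wt (R *v stereo u) * (4 / norm (lift3 u) ^ 4)"

lemma borel_measurable_jac [measurable]: "jac R \<in> borel_measurable borel"
  unfolding jac_def[abs_def] by measurable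

lemma jac_nonneg: "jac R u \<ge> 0"
  by (simp add: jac_def wt_def)

lemma surface_measure_eq:
  "orthogonal_matrix R \<Longrightarrow> \<sigma> = distr (density lborel (\<lambda>u. ennreal (jac R u))) borel (\<lambda>u. pt (R *v stereo u))"
  unfolding jac_def by (rule surface_measure_rotated)

lemma sets_\<sigma> [measurable_cong, simp]: "sets \<sigma> = sets borel"
  and space_\<sigma> [simp]: "space \<sigma> = UNIV"
  by (simp_all add: surface_measure_surf patch_measure_def)

lemma AE_surf: "AE x in \<sigma>. x \<in> surf"
proof -
  have "emeasure \<sigma> (- surf) = 0"
    using is_surface_measure_patch_measure by (simp add: surface_measure_surf is_surface_measure_def)
  then have "- surf \<in> null_sets \<sigma>" by (simp add: null_sets_def)
  then have "AE x in \<sigma>. x \<notin> - surf" by (rule AE_not_in)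
  then show ?thesis by simp
qed

lemma finite_measure_\<sigma>: "finite_measure \<sigma>"
proof
  have "emeasure \<sigma> UNIV = (\<integral>\<^sup>+u. ennreal (area_density chart u) * indicator (chart -` UNIV) u \<partial>lborel)"
    unfolding surface_measure_surf by (rule emeasure_patch_measure) simp
  then have "emeasure \<sigma> UNIV < \<infinity>" using nn_integral_area_chart_finite by simp
  then show "emeasure \<sigma> (space \<sigma>) \<noteq> \<infinity>" by simp
qed

lemma integral_\<sigma>:
  fixes f :: "real^3 \<Rightarrow> real"
  assumes R: "orthogonal_matrix R" and f [measurable]: "f \<in> borel_measurable borel"
  shows "integrable \<sigma> f \<longleftrightarrow> integrable lborel (\<lambda>u. jac R u * f (pt (R *v stereo u)))"
    and "integral\<^sup>L \<sigma> f = (\<integral>u. jac R u * f (pt (R *v stereo u)) \<partial>lborel)"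
  unfolding surface_measure_eq[OF R]
  by (simp_all add: integrable_distr_eq integral_distr integrable_density integral_density jac_nonneg)

definition kern :: "real^3 \<Rightarrow> real^3 \<Rightarrow> real" where
  "kern x y = ((x - y) \<bullet> nrm x) / norm (x - y) ^ 3 / (4 * pi)"

lemma borel_measurable_nrm [measurable]: "nrm \<in> borel_measurable borel"
  unfolding nrm_def[abs_def] by measurable

lemma borel_measurable_kern1 [measurable]: "(\<lambda>x. kern x y) \<in> borel_measurable borel" "kern x \<in> borel_measurable borel"
  unfolding kern_def[abs_def] by measurable

lemma kern_eq:
  assumes "x \<in> surf" "y \<in> surf"
  shows "kern x y = (norm (coord x - coord y))\<^sup>2 / (8 * pi * wt (coord x) * norm (x - y) ^ 3)"
proof -
  have "(x - y) \<bullet> nrm x = - ((y - x) \<bullet> nrm x)" by (simp add: inner_diff_left)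
  also have "\<dots> = (norm (coord x - coord y))\<^sup>2 / (2 * wt (coord x))"
    unfolding inner_nrm_surf[OF assms(1)] using assms(2) by (simp add: surf_iff norm_minus_commute)
  finally show ?thesis by (simp add: kern_def)
qed

lemma kern_nonneg: "x \<in> surf \<Longrightarrow> y \<in> surf \<Longrightarrow> kern x y \<ge> 0"
  unfolding kern_eq using wt_coord_pos[of x] by (intro divide_nonneg_nonneg mult_nonneg_nonneg) auto

text \<open>Apart from the factor \<open>wt (coord x)\<close> in the denominator,
  \<open>kern_eq\<close> is symmetric. This weight therefore intertwines the operator with its
  adjoint.\<close>

lemma kern_swap:
  assumes "x \<in> surf" "y \<in> surf"
  shows "kern x y / wt (coord y) = kern y x / wt (coord x)"
  unfolding kern_eq[OF assms] kern_eq[OF assms(2,1)] by (simp add: norm_minus_commute mult_ac)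

lemma diff_eq_coord: "x - y = M *v (coord x - coord y)"
proof -
  have "pt (coord x) - pt (coord y) = M *v (coord x - coord y)"
    unfolding pt_def by (simp add: matrix_vector_mult_diff_distrib)
  then show ?thesis by simp
qed

text \<open>With the pole at \<open>y\<close>, the chord from \<open>y\<close> is a multiple of
  \<open>M *v (R *v lift3 u)\<close>; all powers of \<open>norm (lift3 u)\<close> and the weight
  cancel, and a smooth density remains.\<close>

lemma jac_kern:
  assumes R: "orthogonal_matrix R" and y: "y \<in> surf" "R *v axis 3 1 = coord y"
  shows "jac R u * kern (pt (R *v stereo u)) y = \<bar>det M\<bar> / (4 * pi) * (1 / norm (M *v (R *v lift3 u)) ^ 3)"
proof -
  let ?x = "pt (R *v stereo u)"
  define s where "s = (norm (lift3 u))\<^sup>2"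
  define n where "n = norm (M *v (R *v lift3 u))"
  define w where "w = wt (R *v stereo u)"
  have s: "s > 0" by (simp add: s_def)
  have x: "?x \<in> surf" by (simp add: surf_iff norm_orthogonal_matrix_mult[OF R])
  have "R *v stereo u = coord y - (2 / s) *\<^sub>R (R *v lift3 u)"
    by (simp add: stereo_def s_def y(2)[symmetric] matrix_vector_mult_diff_distrib matrix_vector_mult_scaleR)
  then have cd: "coord ?x - coord y = - (2 / s) *\<^sub>R (R *v lift3 u)" by simp
  have 1: "(norm (coord ?x - coord y))\<^sup>2 = 4 / s"
    using s unfolding cd by (simp add: norm_orthogonal_matrix_mult[OF R] power_mult_distrib power_divide s_def[symmetric])
      (simp add: power2_eq_square)
  have "?x - y = M *v (coord ?x - coord y)" by (rule diff_eq_coord)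
  also have "\<dots> = - (2 / s) *\<^sub>R (M *v (R *v lift3 u))" unfolding cd by (simp only: matrix_vector_mult_scaleR)
  finally have 2: "norm (?x - y) = 2 / s * n" using s by (simp add: n_def)
  have 3: "norm (lift3 u) ^ 4 = s\<^sup>2" by (simp add: s_def)
  have w: "w > 0" using wt_coord_pos[OF x] by (simp add: w_def)
  \<comment> \<open>For \<open>n = 0\<close> both sides are 0, as division by 0 yields 0.\<close>
  have "w * (4 / s\<^sup>2) * (4 / s / (8 * pi * w * (2 / s * n) ^ 3)) = 1 / (4 * pi) * (1 / n ^ 3)"
    using s w by (cases "n = 0") (simp_all add: field_simps power2_eq_square power3_eq_cube)
  then have "\<bar>det M\<bar> * (w * (4 / s\<^sup>2) * (4 / s / (8 * pi * w * (2 / s * n) ^ 3))) = \<bar>det M\<bar> / (4 * pi) * (1 / n ^ 3)"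
    by simp
  then show ?thesis
    unfolding kern_eq[OF x y(1)] jac_def 1 2 3 unfolding coord_pt w_def[symmetric] n_def[symmetric]
    by (simp only: mult.assoc)
qed

lemma kern_integral:
  fixes F :: "real^3 \<Rightarrow> real"
  assumes R: "orthogonal_matrix R" and y: "y \<in> surf" "R *v axis 3 1 = coord y" and [measurable]: "F \<in> borel_measurable borel"
  shows "integral\<^sup>L \<sigma> (\<lambda>x. kern x y * F x)
      = \<bar>det M\<bar> / (4 * pi) * (\<integral>u. 1 / norm (M *v (R *v lift3 u)) ^ 3 * F (pt (R *v stereo u)) \<partial>lborel)"
proof -
  have "integral\<^sup>L \<sigma> (\<lambda>x. kern x y * F x) = (\<integral>u. jac R u * (kern (pt (R *v stereo u)) y * F (pt (R *v stereo u))) \<partial>lborel)"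
    by (rule integral_\<sigma>(2)[OF R]) measurable
  also have "\<dots> = (\<integral>u. \<bar>det M\<bar> / (4 * pi) * (1 / norm (M *v (R *v lift3 u)) ^ 3 * F (pt (R *v stereo u))) \<partial>lborel)"
    by (intro Bochner_Integration.integral_cong refl) (simp only: jac_kern[OF R y] flip: mult.assoc)
  also have "\<dots> = \<bar>det M\<bar> / (4 * pi) * (\<integral>u. 1 / norm (M *v (R *v lift3 u)) ^ 3 * F (pt (R *v stereo u)) \<partial>lborel)"
    by (rule integral_mult_right_zero)
  finally show ?thesis .
qed

lemma pole_rotation:
  assumes "y \<in> surf"
  obtains R where "orthogonal_matrix R" "R *v axis 3 1 = coord y"
  using orthogonal_matrix_exists_basis[of "coord y" 3] assms by (auto simp: surf_iff)

text \<open>This is the solid angle of the ellipsoid seen from a boundary point, as a fraction of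
  the full sphere. It also bounds the kernel in all Fubini arguments below.\<close>

lemma kern_has_integral_half:
  assumes y: "y \<in> surf"
  shows "has_bochner_integral \<sigma> (\<lambda>x. kern x y) (1 / 2)"
proof -
  obtain R where R: "orthogonal_matrix R" "R *v axis 3 1 = coord y" using pole_rotation[OF y] .
  have d: "\<bar>det (M ** R)\<bar> = \<bar>det M\<bar>" using det_orthogonal_matrix[OF R(1)] by (auto simp: det_mul)
  then have "det (M ** R) \<noteq> 0" using det_M by auto
  note i = integral_norm_lift3_3[OF this, unfolded d]
  have eq: "(\<lambda>u. jac R u * kern (pt (R *v stereo u)) y) = (\<lambda>u. \<bar>det M\<bar> / (4 * pi) * (1 / norm ((M ** R) *v lift3 u) ^ 3))"
    by (simp only: jac_kern[OF R(1) y R(2)] fun_eq_iff flip: matrix_vector_mul_assoc) simp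
  have "has_bochner_integral lborel (\<lambda>u. jac R u * kern (pt (R *v stereo u)) y) (\<bar>det M\<bar> / (4 * pi) * (2 * pi / \<bar>det M\<bar>))"
    unfolding eq by (intro has_bochner_integral_mult_right i)
  moreover have "\<bar>det M\<bar> / (4 * pi) * (2 * pi / \<bar>det M\<bar>) = 1 / 2" using det_M by simp
  ultimately show ?thesis
    using integral_\<sigma>[OF R(1), of "\<lambda>x. kern x y"] by (simp add: has_bochner_integral_iff)
qed

lemma integrable_kern_bounded:
  fixes F :: "real^3 \<Rightarrow> real"
  assumes y: "y \<in> surf" and [measurable]: "F \<in> borel_measurable borel" and B: "\<And>x. x \<in> surf \<Longrightarrow> \<bar>F x\<bar> \<le> B"
  shows "integrable \<sigma> (\<lambda>x. kern x y * F x)"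
proof (rule Bochner_Integration.integrable_bound)
  show "integrable \<sigma> (\<lambda>x. B * kern x y)"
    using kern_has_integral_half[OF y] by (intro integrable_mult_right) (simp add: has_bochner_integral_iff)
  show "AE x in \<sigma>. norm (kern x y * F x) \<le> norm (B * kern x y)"
    using AE_surf
  proof eventually_elim
    case (elim x)
    have "\<bar>F x\<bar> * kern x y \<le> B * kern x y" using B[OF elim] kern_nonneg[OF elim y] by (rule mult_right_mono)
    moreover have "B \<ge> 0" using B[OF elim] by linarith
    ultimately show ?case using kern_nonneg[OF elim y] by (simp add: abs_mult mult.commute)
  qed
qed measurable

text \<open>Division by the weight turns the surface measure into \<open>\<bar>det M\<bar>\<close>
  times the area of the unit sphere.\<close>

lemma integral_coord_moment:
  assumes R: "orthogonal_matrix R"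
  shows "integral\<^sup>L \<sigma> (\<lambda>x. (a \<bullet> coord x) * (b \<bullet> coord x) / wt (coord x)) = \<bar>det M\<bar> * sphere_moment (transpose R *v a) (transpose R *v b)"
proof -
  have "integral\<^sup>L \<sigma> (\<lambda>x. (a \<bullet> coord x) * (b \<bullet> coord x) / wt (coord x))
      = (\<integral>u. jac R u * ((a \<bullet> (R *v stereo u)) * (b \<bullet> (R *v stereo u)) / wt (R *v stereo u)) \<partial>lborel)"
    by (subst integral_\<sigma>(2)[OF R]) simp_all
  also have "\<dots> = (\<integral>u. \<bar>det M\<bar> * (((transpose R *v a) \<bullet> stereo u) * ((transpose R *v b) \<bullet> stereo u) * (4 / norm (lift3 u) ^ 4)) \<partial>lborel)"
  proof (intro Bochner_Integration.integral_cong refl)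
    fix u
    have "wt (R *v stereo u) > 0"
      by (rule wt_pos) (metis norm_orthogonal_matrix_mult[OF R] norm_stereo norm_zero zero_neq_one)
    moreover have "a \<bullet> (R *v stereo u) = (transpose R *v a) \<bullet> stereo u" for a
      using cart_eq_matrix_vector_mult_transpose[of R "stereo u" a] by (simp add: inner_commute del: transpose_matrix_vector)
    ultimately show "jac R u * ((a \<bullet> (R *v stereo u)) * (b \<bullet> (R *v stereo u)) / wt (R *v stereo u))
       = \<bar>det M\<bar> * (((transpose R *v a) \<bullet> stereo u) * ((transpose R *v b) \<bullet> stereo u) * (4 / norm (lift3 u) ^ 4))"
      by (simp add: jac_def del: transpose_matrix_vector)
  qed
  finally show ?thesis by (simp only: sphere_moment_def integral_mult_right_zero)
qed

text \<open>The left-hand side of the previous identity does not involve the rotation of the chart.\<close>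

lemma sphere_moment_rotate:
  assumes R: "orthogonal_matrix R"
  shows "sphere_moment (R *v a) (R *v b) = sphere_moment a b"
proof -
  have "\<bar>det M\<bar> * sphere_moment (R *v a) (R *v b) = \<bar>det M\<bar> * sphere_moment (transpose (mat 1) *v a) (transpose (mat 1) *v b)"
    using integral_coord_moment[of "transpose R" a b] integral_coord_moment[of "mat 1" a b] R det_M
    by (auto simp: orthogonal_matrix_transpose orthogonal_matrix_id simp del: transpose_matrix_vector)
  then show ?thesis using det_M by (simp add: transpose_mat del: transpose_matrix_vector)
qed

end

text \<open>A reflection makes the mixed moments vanish, rotations make the three pure ones equal,
  and their sum is the area of the sphere.\<close>

lemma sphere_moment_axis: "sphere_moment (axis i 1) (axis j 1) = (if i = j then 4 / 3 * pi else 0)"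
proof -
  \<comment> \<open>The unit sphere itself serves as the ellipsoid on which rotation invariance is
    read off.\<close>
  interpret ellipsoid_chart 0 "mat 1" by unfold_locales (simp add: det_I)
  show ?thesis
  proof (cases "i = j")
    case False
    define R :: "real^3^3" where "R = (\<chi> k l. if k = l then (if k = i then -1 else 1) else 0)"
    have "transpose R = R" by (auto simp: R_def transpose_def vec_eq_iff)
    moreover have "R ** R = mat 1"
      by (auto simp: R_def matrix_matrix_mult_def vec_eq_iff forall_3 sum_3 mat_def)
    ultimately have R: "orthogonal_matrix R" by (simp add: orthogonal_matrix)
    have "R *v axis i 1 = - axis i 1" "R *v axis j 1 = axis j 1"
      using False unfolding matrix_vector_mult_basis by (auto simp: R_def column_def vec_eq_iff axis_def)
    then have "sphere_moment (axis i 1) (axis j 1) = sphere_moment (- axis i 1) (axis j 1)"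
      using sphere_moment_rotate[OF R, of "axis i 1" "axis j 1"] by simp
    also have "\<dots> = - sphere_moment (axis i 1) (axis j 1)"
      by (simp add: sphere_moment_def)
    finally show ?thesis using False by simp
  next
    case True
    have eq: "sphere_moment (axis k 1) (axis k 1) = sphere_moment (axis i 1) (axis i 1)" for k
    proof -
      obtain R :: "real^3^3" where R: "orthogonal_matrix R" "R *v axis i 1 = axis k 1"
        using orthogonal_matrix_exists_basis[of "axis k 1" i] by (metis norm_axis_1)
      show ?thesis using sphere_moment_rotate[OF R(1), of "axis i 1" "axis i 1"] by (simp add: R(2))
    qed
    have int: "integrable lborel (\<lambda>u. (stereo u $ k) * (stereo u $ k) * (4 / norm (lift3 u) ^ 4))" for k
    proof (rule Bochner_Integration.integrable_bound)
      show "integrable lborel (\<lambda>u. 4 / norm (lift3 u) ^ 4)" using integral_lift3_4 by (simp add: has_bochner_integral_iff)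
      have "(stereo u $ k) * (stereo u $ k) \<le> 1" for u
        using component_le_norm_cart[of "stereo u" k] by (simp add: abs_square_le_1 flip: power2_eq_square)
      then have "(stereo u $ k) * (stereo u $ k) * (4 / norm (lift3 u) ^ 4) \<le> 1 * (4 / norm (lift3 u) ^ 4)" for u
        by (intro mult_right_mono) auto
      then show "AE u in lborel. norm ((stereo u $ k) * (stereo u $ k) * (4 / norm (lift3 u) ^ 4)) \<le> norm (4 / norm (lift3 u) ^ 4)"
        by (simp add: abs_mult)
    qed measurable
    have "(\<Sum>k\<in>UNIV. sphere_moment (axis k 1) (axis k 1)) = (\<Sum>k\<in>(UNIV :: 3 set). sphere_moment (axis i 1) (axis i 1))"
      by (rule sum.cong[OF refl eq])
    then have "3 * sphere_moment (axis i 1) (axis i 1) = (\<Sum>k\<in>UNIV. sphere_moment (axis k 1) (axis k 1))"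
      by simp
    also have "\<dots> = (\<integral>u. (\<Sum>k\<in>UNIV. (stereo u $ k) * (stereo u $ k) * (4 / norm (lift3 u) ^ 4)) \<partial>lborel)"
      unfolding sphere_moment_def using int by (subst Bochner_Integration.integral_sum) (simp_all add: inner_axis inner_commute[of "axis _ _"])
    also have "\<dots> = (\<integral>u. 4 / norm (lift3 u) ^ 4 \<partial>lborel)"
    proof (intro Bochner_Integration.integral_cong refl)
      fix u
      have "(\<Sum>k\<in>UNIV. (stereo u $ k) * (stereo u $ k)) = 1"
        using norm_stereo[of u] unfolding norm_eq_1 by (simp add: inner_vec_def)
      then show "(\<Sum>k\<in>UNIV. (stereo u $ k) * (stereo u $ k) * (4 / norm (lift3 u) ^ 4)) = 4 / norm (lift3 u) ^ 4"
        by (simp only: sum_distrib_right[symmetric] mult_1)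
    qed
    also have "\<dots> = 4 * pi" using integral_lift3_4 by (simp add: has_bochner_integral_iff)
    finally show ?thesis using True by simp
  qed
qed

subsection \<open>Depolarization factors\<close>

definition diag :: "real^'n \<Rightarrow> real^'n^'n" where
  "diag d = (\<chi> i j. if i = j then d $ j else 0)"

lemma diag_mult_vec: "diag d *v v = (\<chi> i. d $ i * v $ i)"
  by (simp add: diag_def matrix_vector_mult_def vec_eq_iff if_distrib if_distribR cong: if_cong)

lemma transpose_diag [simp]: "transpose (diag d) = diag d"
  by (auto simp: diag_def transpose_def vec_eq_iff)

lemma diag_mult_diag_eq_1:
  assumes "\<And>i. d $ i * e $ i = (1::real)"
  shows "diag d ** diag e = mat 1"
proof -
  have "(diag d ** diag e) *v v = mat 1 *v v" for v
    unfolding matrix_vector_mul_assoc[symmetric] diag_mult_vec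
    using assms by (simp add: vec_eq_iff mult.assoc[symmetric])
  then show ?thesis unfolding matrix_eq by blast
qed

lemma det_diag: "det (diag d) = (\<Prod>i\<in>UNIV. d $ i)"
  by (subst det_diagonal) (simp_all add: diag_def)

lemma UNIV_3_prod: "(\<Prod>i\<in>(UNIV :: 3 set). f i) = f 1 * f 2 * f 3"
  for f :: "3 \<Rightarrow> real"
  unfolding UNIV_3 by (simp add: mult.assoc)

lemma norm_sq_3: "(norm v)\<^sup>2 = (\<Sum>i\<in>UNIV. (v $ i)\<^sup>2)" for v :: "real^'n"
  unfolding power2_norm_eq_inner inner_vec_def by (simp add: power2_eq_square)

lemma integral_linear_52:
  fixes A B :: real
  assumes A: "A > 0" and B: "B > 0"
  shows "has_bochner_integral lborel (\<lambda>s. indicator {0..} s * (1 / sqrt (A * s + B) ^ 5)) (2 / 3 / (A * sqrt B ^ 3))"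
proof -
  have pos: "A * s + B > 0" if "s \<ge> 0" for s using that A B by (simp add: add_nonneg_pos)
  have "(\<integral>\<^sup>+s. ennreal (1 / sqrt (A * s + B) ^ 5) * indicator {0..} s \<partial>lborel)
     = ennreal (0 - (- (2 / (3 * A)) / sqrt (A * 0 + B) ^ 3))"
  proof (rule nn_integral_FTC_atLeast)
    fix s :: real assume "0 \<le> s"
    then have p: "A * s + B > 0" by (rule pos)
    define r where "r = sqrt (A * s + B)"
    have r: "r > 0" "A * s + B = r\<^sup>2" using p by (auto simp: r_def)
    have "DERIV (\<lambda>s. - (2 / (3 * A)) / sqrt (A * s + B) ^ 3) s :>
        (2 / (3 * A)) * (3 * r\<^sup>2 * (A * (inverse r / 2))) / (r ^ 3 * r ^ 3)"
      using p r(1) A unfolding r_def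
      by (auto intro!: derivative_eq_intros simp: power2_eq_square) (simp add: field_simps)
    also have "(2 / (3 * A)) * (3 * r\<^sup>2 * (A * (inverse r / 2))) / (r ^ 3 * r ^ 3) = 1 / r ^ 5"
      using r(1) A by (simp add: field_simps eval_nat_numeral)
    finally show "DERIV (\<lambda>s. - (2 / (3 * A)) / sqrt (A * s + B) ^ 3) s :> 1 / sqrt (A * s + B) ^ 5"
      unfolding r_def .
    show "0 \<le> 1 / sqrt (A * s + B) ^ 5" using p by simp
  next
    show "((\<lambda>s. - (2 / (3 * A)) / sqrt (A * s + B) ^ 3) \<longlongrightarrow> 0) at_top"
      using A by real_asymp
  qed measurable
  also have "(\<lambda>s. ennreal (1 / sqrt (A * s + B) ^ 5) * indicator {0..} s)
      = (\<lambda>s. ennreal (indicator {0..} s * (1 / sqrt (A * s + B) ^ 5)))"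
    by (auto simp: indicator_def)
  also have "0 - (- (2 / (3 * A)) / sqrt (A * 0 + B) ^ 3) = 2 / 3 / (A * sqrt B ^ 3)"
    by simp
  finally show ?thesis
    using A B pos by (intro has_bochner_integral_nn_integral) (auto simp: indicator_def less_imp_le)
qed

text \<open>Vectors at height one have norm at least 1, so the norm is bounded by its square. This
  crude form is chosen to cancel a squared norm in a denominator or to be absorbed by a quadratic
  form.\<close>

lemma abs_rotated_lift3_le:
  assumes "orthogonal_matrix R"
  shows "\<bar>(R *v lift3 u) $ j\<bar> \<le> (norm (lift3 u))\<^sup>2"
proof -
  have "\<bar>(R *v lift3 u) $ j\<bar> \<le> norm (R *v lift3 u)" by (rule component_le_norm_cart)
  also have "\<dots> = norm (lift3 u) * 1" by (simp add: norm_orthogonal_matrix_mult[OF assms])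
  also have "\<dots> \<le> norm (lift3 u) * norm (lift3 u)" by (intro mult_left_mono norm_lift3_ge_1) simp
  finally show ?thesis by (simp add: power2_eq_square)
qed

section \<open>Ellipsoids with given axes and the integrals that define the depolarization
  factors\<close>

locale solid_ellipsoid =
  fixes c p :: "real^3" and Q :: "real^3^3"
  assumes orth: "orthogonal_matrix Q" and p_pos: "\<And>j. p $ j > 0"
begin

definition L :: "real^3^3" where "L = Q ** diag p"

lemma abs_det_L: "\<bar>det L\<bar> = p $ 1 * p $ 2 * p $ 3"
proof -
  have "\<bar>det Q\<bar> = 1" using det_orthogonal_matrix[OF orth] by auto
  moreover have "\<bar>p $ 1 * p $ 2 * p $ 3\<bar> = p $ 1 * p $ 2 * p $ 3" using p_pos by (simp add: less_imp_le)
  ultimately show ?thesis by (simp only: L_def det_mul abs_mult det_diag UNIV_3_prod)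
qed

sublocale ellipsoid_chart c L
proof
  have "\<bar>det L\<bar> > 0" unfolding abs_det_L using p_pos by simp
  then show "det L \<noteq> 0" by simp
qed

lemma L_mult_vec: "L *v v = Q *v (diag p *v v)"
  by (simp add: L_def flip: matrix_vector_mul_assoc)

lemma norm_L: "(norm (L *v v))\<^sup>2 = (\<Sum>i\<in>UNIV. (p $ i * v $ i)\<^sup>2)"
proof -
  have "norm (L *v v) = norm (diag p *v v)"
    by (simp add: L_mult_vec norm_orthogonal_matrix_mult[OF orth])
  then show ?thesis by (simp add: norm_sq_3 diag_mult_vec)
qed

definition rp :: "real^3" where "rp = (\<chi> i. 1 / p $ i)"

lemma diag_rp: "diag p ** diag rp = mat 1" "diag rp ** diag p = mat 1"
  using p_pos by (auto intro!: diag_mult_diag_eq_1 simp: rp_def less_imp_neq[symmetric])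

lemma inv_L: "matrix_inv L = diag rp ** transpose Q"
proof -
  have "L ** (diag rp ** transpose Q) = Q ** (diag p ** diag rp) ** transpose Q"
    by (simp only: L_def matrix_mul_assoc)
  also have "\<dots> = mat 1" using orth by (simp add: diag_rp orthogonal_matrix_def)
  finally have "matrix_inv L ** (L ** (diag rp ** transpose Q)) = matrix_inv L" by simp
  then show ?thesis by (simp add: matrix_mul_assoc invertible_M)
qed

lemma coord_nth: "coord x $ j = ((x - c) \<bullet> column j Q) / p $ j"
proof -
  have "(transpose Q *v (x - c)) $ j = (x - c) \<bullet> column j Q"
    by (simp add: matrix_vector_mult_def transpose_def column_def inner_vec_def mult.commute del: transpose_matrix_vector)
  then show ?thesis
    unfolding coord_def inv_L by (simp add: diag_mult_vec rp_def del: transpose_matrix_vector flip: matrix_vector_mul_assoc)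
qed

lemma solid_eq_ellipsoid: "solid = ellipsoid c Q p"
proof -
  have "norm (coord x) < 1 \<longleftrightarrow> (norm (coord x))\<^sup>2 < 1" for x
    by (simp add: abs_square_less_1)
  then show ?thesis by (simp add: solid_def ellipsoid_def norm_sq_3 coord_nth)
qed

lemma nrm_nth: "nrm x $ m = (\<Sum>j\<in>UNIV. Q $ m $ j * (coord x $ j / p $ j)) / wt (coord x)"
proof -
  have "transpose (matrix_inv L) *v v = Q *v (diag rp *v v)" for v
    by (simp add: inv_L matrix_transpose_mul del: transpose_matrix_vector flip: matrix_vector_mul_assoc)
  then show ?thesis
    by (simp add: nrm_def diag_mult_vec rp_def matrix_vector_mult_def[of Q] del: transpose_matrix_vector)
qed

lemma nth_eq_coord: "x $ m = c $ m + (\<Sum>j\<in>UNIV. Q $ m $ j * (p $ j * coord x $ j))"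
proof -
  have "x = c + Q *v (diag p *v coord x)"
    using pt_coord[of x] unfolding pt_def L_mult_vec by simp
  then have "x $ m = (c + Q *v (diag p *v coord x)) $ m" by simp
  then show ?thesis by (simp add: diag_mult_vec matrix_vector_mult_def[of Q])
qed

text \<open>A Gram factor of the form
  \<open>s * (norm w)\<^sup>2 + (norm (L *v (R *v w)))\<^sup>2\<close>. Its diagonal entries are the
  semi-axes of the confocal ellipsoid with parameter \<open>s\<close>, and \<open>dens s\<close> is
  their product.\<close>

definition shift_form :: "real \<Rightarrow> real^3^3 \<Rightarrow> real^3^3" where
  "shift_form s R = diag (\<chi> k. sqrt ((p $ k)\<^sup>2 + s)) ** R"

definition dens :: "real \<Rightarrow> real" where
  "dens s = sqrt (((p $ 1)\<^sup>2 + s) * ((p $ 2)\<^sup>2 + s) * ((p $ 3)\<^sup>2 + s))"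

lemma p_sq_add_pos: "s \<ge> 0 \<Longrightarrow> (p $ k)\<^sup>2 + s > 0"
  using p_pos[of k] by (simp add: add_pos_nonneg)

lemma dens_pos: "s \<ge> 0 \<Longrightarrow> dens s > 0"
  using p_sq_add_pos by (simp add: dens_def)

lemma
  assumes R: "orthogonal_matrix R" and s: "s \<ge> 0"
  shows norm_shift_form: "(norm (shift_form s R *v w))\<^sup>2 = (norm w)\<^sup>2 * s + (norm (L *v (R *v w)))\<^sup>2"
    and det_shift_form: "\<bar>det (shift_form s R)\<bar> = dens s"
proof -
  have "(norm (shift_form s R *v w))\<^sup>2 = (\<Sum>k\<in>UNIV. ((p $ k)\<^sup>2 + s) * ((R *v w) $ k)\<^sup>2)"
    using p_sq_add_pos[OF s]
    unfolding shift_form_def matrix_vector_mul_assoc[symmetric] norm_sq_3 diag_mult_vec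
    by (simp add: power_mult_distrib less_imp_le)
  also have "\<dots> = s * (norm (R *v w))\<^sup>2 + (norm (L *v (R *v w)))\<^sup>2"
    unfolding norm_L by (simp add: norm_sq_3[of "R *v w"] sum_distrib_left sum.distrib power_mult_distrib algebra_simps)
  finally show "(norm (shift_form s R *v w))\<^sup>2 = (norm w)\<^sup>2 * s + (norm (L *v (R *v w)))\<^sup>2"
    by (simp add: norm_orthogonal_matrix_mult[OF R])
  have "\<bar>det R\<bar> = 1" using det_orthogonal_matrix[OF R] by auto
  then show "\<bar>det (shift_form s R)\<bar> = dens s"
    using p_sq_add_pos[OF s]
    by (simp add: shift_form_def det_mul abs_mult det_diag UNIV_3_prod dens_def real_sqrt_mult less_imp_le)
qed

lemma integral_shift_form:
  assumes R: "orthogonal_matrix R" and s: "s > 0"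
  shows "(\<integral>u. (R *v lift3 u) $ j / sqrt ((norm (lift3 u))\<^sup>2 * s + (norm (L *v (R *v lift3 u)))\<^sup>2) ^ 5 \<partial>lborel)
    = 2 * pi / 3 * (R *v axis 3 1) $ j * (1 / (((p $ j)\<^sup>2 + s) * dens s))"
proof -
  have s0: "s \<ge> 0" using s by simp
  let ?N = "shift_form s R"
  have RR: "R ** transpose R = mat 1" "transpose R ** R = mat 1" using R by (simp_all add: orthogonal_matrix_def)
  have d: "det ?N \<noteq> 0" using det_shift_form[OF R s0] dens_pos[OF s0] by auto
  interpret P: posdef3 "transpose ?N ** ?N" by (rule posdef3_gram[OF d])
  define a where "a = transpose R *v axis j 1"
  \<comment> \<open>The inverse of the Gram matrix applied to the third unit vector: the matrix is
    diagonal with entries \<open>(p $ k)\<^sup>2 + s\<close> after conjugation by \<open>R\<close>,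
    which produces the factor belonging to the \<open>j\<close>-th axis.\<close>
  define z where "z = transpose R *v (diag (\<chi> k. 1 / ((p $ k)\<^sup>2 + s)) *v (R *v axis 3 1))"
  have a: "a \<bullet> x = (R *v x) $ j" for x
    using cart_eq_matrix_vector_mult_transpose[of R x "axis j 1"]
    unfolding a_def cart_eq_inner_axis by (metis inner_commute)
  have form: "P.form x = (norm x)\<^sup>2 * s + (norm (L *v (R *v x)))\<^sup>2" for x
    by (simp add: form_gram[OF d] norm_shift_form[OF R s0])
  have sd: "sqrt (det (transpose ?N ** ?N)) = dens s"
    using det_shift_form[OF R s0] by (simp add: det_mul det_transpose)
  have z: "(transpose ?N ** ?N) *v z = axis 3 1"
  proof -
    let ?d = "diag (\<chi> k. sqrt ((p $ k)\<^sup>2 + s))"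
    have dd: "?d ** ?d ** diag (\<chi> k. 1 / ((p $ k)\<^sup>2 + s)) = mat 1"
    proof -
      have "?d *v (?d *v (diag (\<chi> k. 1 / ((p $ k)\<^sup>2 + s)) *v v)) = v" for v
      proof -
        have "sqrt ((p $ k)\<^sup>2 + s) * (sqrt ((p $ k)\<^sup>2 + s) * x / ((p $ k)\<^sup>2 + s)) = x" for k x
          using p_sq_add_pos[OF s0, of k] by (simp flip: mult.assoc)
        then show ?thesis by (simp add: diag_mult_vec vec_eq_iff)
      qed
      then have "(?d ** ?d ** diag (\<chi> k. 1 / ((p $ k)\<^sup>2 + s))) *v v = mat 1 *v v" for v
        by (simp flip: matrix_vector_mul_assoc)
      then show ?thesis by (metis matrix_eq)
    qed
    have "(transpose ?N ** ?N) *v z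
      = (transpose R ** (?d ** ?d) ** (R ** transpose R) ** diag (\<chi> k. 1 / ((p $ k)\<^sup>2 + s)) ** R) *v axis 3 1"
      by (simp only: z_def shift_form_def matrix_transpose_mul transpose_diag matrix_mul_assoc matrix_vector_mul_assoc)
    also have "\<dots> = (transpose R ** (?d ** ?d ** diag (\<chi> k. 1 / ((p $ k)\<^sup>2 + s))) ** R) *v axis 3 1"
      by (simp only: RR matrix_mul_rid matrix_mul_assoc)
    also have "\<dots> = axis 3 1" by (simp only: dd matrix_mul_rid RR matrix_vector_mul_lid)
    finally show ?thesis .
  qed
  have Rz: "R *v z = diag (\<chi> k. 1 / ((p $ k)\<^sup>2 + s)) *v (R *v axis 3 1)"
    by (simp only: z_def matrix_vector_mul_assoc matrix_mul_assoc RR matrix_mul_lid)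
  have int: "integrable lborel (\<lambda>u. (a \<bullet> lift3 u) / sqrt (P.form (lift3 u)) ^ 5)"
  proof (rule Bochner_Integration.integrable_bound)
    show "integrable lborel (\<lambda>u. 1 / s * (1 / norm (?N *v lift3 u) ^ 3))"
      using integral_norm_lift3_3[OF d] by (intro integrable_mult_right) (simp add: has_bochner_integral_iff)
    have "\<bar>a \<bullet> lift3 u\<bar> / sqrt (P.form (lift3 u)) ^ 5 \<le> 1 / s * (1 / norm (?N *v lift3 u) ^ 3)" for u
    proof -
      define n where "n = norm (?N *v lift3 u)"
      have f: "P.form (lift3 u) = n\<^sup>2" "n \<ge> 0" by (simp_all add: n_def form_gram[OF d])
      moreover have "P.form (lift3 u) > 0" by (rule P.form_pos) simp
      ultimately have n: "n > 0" by (metis order_le_less zero_power2 less_irrefl)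
      have "\<bar>a \<bullet> lift3 u\<bar> \<le> (norm (lift3 u))\<^sup>2" unfolding a by (rule abs_rotated_lift3_le[OF R])
      \<comment> \<open>The summand with factor \<open>s\<close> alone bounds the form from below,
        hence the assumption \<open>s > 0\<close>.\<close>
      also have "\<dots> \<le> n\<^sup>2 / s"
        using s form[of "lift3 u"] unfolding f by (simp add: field_simps power2_eq_square)
      finally have "\<bar>a \<bullet> lift3 u\<bar> / n ^ 5 \<le> n\<^sup>2 / s / n ^ 5" using n by (intro divide_right_mono) auto
      also have "\<dots> = 1 / s * (1 / n ^ 3)" using n s by (simp add: field_simps eval_nat_numeral)
      finally show ?thesis using n by (simp add: f(1) n_def[symmetric])
    qed
    then show "AE u in lborel. norm ((a \<bullet> lift3 u) / sqrt (P.form (lift3 u)) ^ 5) \<le> norm (1 / s * (1 / norm (?N *v lift3 u) ^ 3))"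
      using s P.form_lift3_nonneg by (simp add: abs_mult)
  qed measurable
  have "a \<bullet> z = (R *v axis 3 1) $ j / ((p $ j)\<^sup>2 + s)"
    unfolding a Rz by (simp add: diag_mult_vec)
  then show ?thesis
    using P.integral_form_52[OF int z] unfolding sd a form by simp
qed

lemma s_coeff_eq: "s_coeff p j = - (\<bar>det L\<bar> / 2) * (\<integral>s. indicator {0..} s * (1 / (((p $ j)\<^sup>2 + s) * dens s)) \<partial>lborel)"
  unfolding s_coeff_def abs_det_L dens_def set_lebesgue_integral_def by simp

text \<open>
  By \<open>1 / (A B\<^sup>3\<^sup>/\<^sup>2) = 3/2 \<integral>\<^sub>0\<^sup>\<infinity> (A s + B)\<^sup>-\<^sup>5\<^sup>/\<^sup>2 ds\<close> the plane integral reduces to one quadratic form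
  for each \<open>s\<close>, and the remaining integral over \<open>s\<close> is the one that defines \<open>s_coeff\<close>.
\<close>

lemma integral_depolarization:
  assumes R: "orthogonal_matrix R"
  shows "(\<integral>u. (R *v lift3 u) $ j / ((norm (lift3 u))\<^sup>2 * norm (L *v (R *v lift3 u)) ^ 3) \<partial>lborel)
     = - (2 * pi / \<bar>det L\<bar>) * s_coeff p j * (R *v axis 3 1) $ j"
proof -
  define A where "A u = (norm (lift3 u))\<^sup>2" for u
  define B where "B u = (norm (L *v (R *v lift3 u)))\<^sup>2" for u
  define h where "h u s = (R *v lift3 u) $ j * (indicator {0..} s * (1 / sqrt (A u * s + B u) ^ 5))" for u and s :: real
  have A: "A u > 0" for u by (simp add: A_def)
  have "L *v v \<noteq> 0" if "v \<noteq> 0" for v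
    using inj_M[THEN injD, of v 0] that by auto
  moreover have "R *v lift3 u \<noteq> 0" for u
    using norm_orthogonal_matrix_mult[OF R, of "lift3 u"] by (metis norm_eq_zero lift3_neq_0(1))
  ultimately have B: "B u > 0" for u by (simp add: B_def)
  have sB: "sqrt (B u) = norm (L *v (R *v lift3 u))" for u by (simp add: B_def)
  have [measurable]: "(\<lambda>u. (R *v lift3 u) $ j) \<in> borel_measurable borel"
    unfolding cart_eq_inner_axis by measurable
  have [measurable]: "A \<in> borel_measurable borel" "B \<in> borel_measurable borel"
    unfolding A_def[abs_def] B_def[abs_def] by measurable
  have inner: "has_bochner_integral lborel (h u) ((R *v lift3 u) $ j * (2 / 3 / (A u * sqrt (B u) ^ 3)))" for u
    unfolding h_def[abs_def] by (intro has_bochner_integral_mult_right integral_linear_52 A B)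
  have innerabs: "(\<integral>s. norm (h u s) \<partial>lborel) = \<bar>(R *v lift3 u) $ j\<bar> * (2 / 3 / (A u * sqrt (B u) ^ 3))" for u
  proof -
    have "norm (h u s) = \<bar>(R *v lift3 u) $ j\<bar> * (indicator {0..} s * (1 / sqrt (A u * s + B u) ^ 5))" for s
    proof -
      have "0 \<le> indicator {0..} s * (1 / sqrt (A u * s + B u) ^ 5)"
        using A[of u] B[of u] by (auto simp: indicator_def)
      then show ?thesis
        unfolding h_def real_norm_def abs_mult[of "(R *v lift3 u) $ j"] by (simp only: abs_of_nonneg)
    qed
    then show ?thesis
      by (simp only:) (intro has_bochner_integral_integral_eq has_bochner_integral_mult_right integral_linear_52 A B)
  qed
  have det: "det (L ** R) \<noteq> 0" using det_M det_orthogonal_matrix[OF R] by (auto simp: det_mul)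
  \<comment> \<open>The integrand changes sign, so exchanging the integrals needs absolute
    integrability. Integrating the absolute value over \<open>s\<close> leaves a factor
    \<open>1 / A u\<close>, which the bound on the coordinate cancels.\<close>
  have int: "integrable (lborel \<Otimes>\<^sub>M lborel) (\<lambda>(u, s). h u s)"
  proof (rule lborel_pair.Fubini_integrable)
    show "integrable lborel (\<lambda>u. \<integral>s. norm ((\<lambda>(u, s). h u s) (u, s)) \<partial>lborel)"
    proof (simp only: split_conv innerabs, rule Bochner_Integration.integrable_bound)
      show "integrable lborel (\<lambda>u. 2 / 3 * (1 / norm ((L ** R) *v lift3 u) ^ 3))"
        using integral_norm_lift3_3[OF det] by (intro integrable_mult_right) (simp add: has_bochner_integral_iff)
      have "\<bar>(R *v lift3 u) $ j\<bar> * (2 / 3 / (A u * sqrt (B u) ^ 3)) \<le> 2 / 3 * (1 / norm ((L ** R) *v lift3 u) ^ 3)" for u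
      proof -
        have "\<bar>(R *v lift3 u) $ j\<bar> \<le> A u"
          unfolding A_def by (rule abs_rotated_lift3_le[OF R])
        then have "\<bar>(R *v lift3 u) $ j\<bar> * (2 / 3 / (A u * sqrt (B u) ^ 3)) \<le> A u * (2 / 3 / (A u * sqrt (B u) ^ 3))"
          using A[of u] B[of u] by (intro mult_right_mono) auto
        also have "\<dots> = 2 / 3 * (1 / sqrt (B u) ^ 3)" using A[of u] by simp
        finally show ?thesis by (simp add: sB flip: matrix_vector_mul_assoc)
      qed
      then show "AE u in lborel. norm (\<bar>(R *v lift3 u) $ j\<bar> * (2 / 3 / (A u * sqrt (B u) ^ 3))) \<le> norm (2 / 3 * (1 / norm ((L ** R) *v lift3 u) ^ 3))"
        using A B by (simp add: abs_mult less_imp_le)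
    qed measurable
    show "AE u in lborel. integrable lborel (\<lambda>s. (\<lambda>(u, s). h u s) (u, s))"
      using inner by (simp add: has_bochner_integral_iff)
    show "(\<lambda>(u, s). h u s) \<in> borel_measurable (lborel \<Otimes>\<^sub>M lborel)"
      unfolding h_def by measurable
  qed
  have "(\<integral>u. (R *v lift3 u) $ j / (A u * sqrt (B u) ^ 3) \<partial>lborel) = (\<integral>u. 3 / 2 * (\<integral>s. h u s \<partial>lborel) \<partial>lborel)"
    using has_bochner_integral_integral_eq[OF inner] by simp
  also have "\<dots> = 3 / 2 * (\<integral>u. \<integral>s. h u s \<partial>lborel \<partial>lborel)" by (rule integral_mult_right_zero)
  also have "(\<integral>u. \<integral>s. h u s \<partial>lborel \<partial>lborel) = (\<integral>s. \<integral>u. h u s \<partial>lborel \<partial>lborel)"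
    by (rule lborel_pair.Fubini_integral[OF int, symmetric])
  also have "\<dots> = (\<integral>s. 2 * pi / 3 * (R *v axis 3 1) $ j * (indicator {0..} s * (1 / (((p $ j)\<^sup>2 + s) * dens s))) \<partial>lborel)"
  proof (rule integral_cong_AE)
    \<comment> \<open>The formula for the inner integral is available for \<open>s > 0\<close>, and
      the indicator contains the endpoint 0.\<close>
    have "AE s in lborel. s \<noteq> (0::real)" by (rule AE_lborel_singleton)
    then show "AE s in lborel. (\<integral>u. h u s \<partial>lborel) = 2 * pi / 3 * (R *v axis 3 1) $ j * (indicator {0..} s * (1 / (((p $ j)\<^sup>2 + s) * dens s)))"
    proof eventually_elim
      case (elim s)
      show ?case
      proof (cases "s > 0")
        case True
        then show ?thesis using integral_shift_form[OF R True, of j] by (simp add: h_def A_def B_def)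
      next
        case False
        then show ?thesis using elim by (simp add: h_def)
      qed
    qed
    show "(\<lambda>s. \<integral>u. h u s \<partial>lborel) \<in> borel_measurable lborel"
      using lborel_pair.integrable_snd[OF int] by (rule borel_measurable_integrable)
    show "(\<lambda>s. 2 * pi / 3 * (R *v axis 3 1) $ j * (indicator {0..} s * (1 / (((p $ j)\<^sup>2 + s) * dens s)))) \<in> borel_measurable lborel"
      unfolding dens_def by measurable
  qed
  also have "\<dots> = 2 * pi / 3 * (R *v axis 3 1) $ j * (\<integral>s. indicator {0..} s * (1 / (((p $ j)\<^sup>2 + s) * dens s)) \<partial>lborel)"
    by (rule integral_mult_right_zero)
  also have "(\<integral>s. indicator {0..} s * (1 / (((p $ j)\<^sup>2 + s) * dens s)) \<partial>lborel) = - (2 / \<bar>det L\<bar>) * s_coeff p j"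
    using det_M by (simp add: s_coeff_eq)
  finally show ?thesis unfolding sB by (simp add: A_def)
qed

text \<open>With the pole at \<open>y\<close>, the coordinate in the chart is
  \<open>coord y $ j\<close> minus a multiple of the rotated chord direction. The constant part
  yields the eigenvalue 1/2 of the constants, the rest the depolarization integral.\<close>

lemma integral_kern_coord:
  assumes y: "y \<in> surf"
  shows "integral\<^sup>L \<sigma> (\<lambda>x. kern x y * coord x $ j) = (1 / 2 + s_coeff p j) * coord y $ j"
proof -
  obtain R where R: "orthogonal_matrix R" "R *v axis 3 1 = coord y" using pole_rotation[OF y] .
  have d: "\<bar>det (L ** R)\<bar> = \<bar>det L\<bar>" using det_orthogonal_matrix[OF R(1)] by (auto simp: det_mul)
  then have d0: "det (L ** R) \<noteq> 0" using det_M by auto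
  have i: "has_bochner_integral lborel (\<lambda>u. 1 / norm (L *v (R *v lift3 u)) ^ 3) (2 * pi / \<bar>det L\<bar>)"
    using integral_norm_lift3_3[OF d0] unfolding d by (simp flip: matrix_vector_mul_assoc)
  have [measurable]: "(\<lambda>x. coord x $ j) \<in> borel_measurable borel" "(\<lambda>u. (R *v lift3 u) $ j) \<in> borel_measurable borel"
    unfolding cart_eq_inner_axis by measurable
  let ?g = "\<lambda>u. (R *v lift3 u) $ j / ((norm (lift3 u))\<^sup>2 * norm (L *v (R *v lift3 u)) ^ 3)"
  have g: "integrable lborel ?g"
  proof (rule Bochner_Integration.integrable_bound)
    show "integrable lborel (\<lambda>u. 1 / norm (L *v (R *v lift3 u)) ^ 3)" using i by (simp add: has_bochner_integral_iff)
    have "\<bar>(R *v lift3 u) $ j\<bar> / (norm (lift3 u))\<^sup>2 / norm (L *v (R *v lift3 u)) ^ 3 \<le> 1 / norm (L *v (R *v lift3 u)) ^ 3" for u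
    proof (rule divide_right_mono)
      show "\<bar>(R *v lift3 u) $ j\<bar> / (norm (lift3 u))\<^sup>2 \<le> 1"
        using abs_rotated_lift3_le[OF R(1), of u j] by simp
    qed simp
    then show "AE u in lborel. norm (?g u) \<le> norm (1 / norm (L *v (R *v lift3 u)) ^ 3)"
      by (simp add: abs_mult)
  qed measurable
  then have hg: "has_bochner_integral lborel ?g (- (2 * pi / \<bar>det L\<bar>) * s_coeff p j * coord y $ j)"
    using integral_depolarization[OF R(1), of j] unfolding R(2) has_bochner_integral_iff by blast
  have "(\<integral>u. 1 / norm (L *v (R *v lift3 u)) ^ 3 * coord (pt (R *v stereo u)) $ j \<partial>lborel)
      = (\<integral>u. coord y $ j * (1 / norm (L *v (R *v lift3 u)) ^ 3) - 2 * ?g u \<partial>lborel)"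
  proof (intro Bochner_Integration.integral_cong refl)
    fix u
    have eq: "(R *v stereo u) $ j = coord y $ j - 2 / (norm (lift3 u))\<^sup>2 * (R *v lift3 u) $ j"
      by (simp add: stereo_def matrix_vector_mult_diff_distrib matrix_vector_mult_scaleR R(2))
    show "1 / norm (L *v (R *v lift3 u)) ^ 3 * coord (pt (R *v stereo u)) $ j
      = coord y $ j * (1 / norm (L *v (R *v lift3 u)) ^ 3) - 2 * ?g u"
      unfolding coord_pt eq by (simp add: right_diff_distrib diff_divide_distrib)
  qed
  also have "\<dots> = coord y $ j * (2 * pi / \<bar>det L\<bar>) - 2 * (- (2 * pi / \<bar>det L\<bar>) * s_coeff p j * coord y $ j)"
    by (intro has_bochner_integral_integral_eq has_bochner_integral_diff has_bochner_integral_mult_right i hg)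
  finally have "integral\<^sup>L \<sigma> (\<lambda>x. kern x y * coord x $ j)
     = \<bar>det L\<bar> / (4 * pi) * (coord y $ j * (2 * pi / \<bar>det L\<bar>) - 2 * (- (2 * pi / \<bar>det L\<bar>) * s_coeff p j * coord y $ j))"
    by (subst kern_integral[OF R(1) y R(2)]) simp_all
  also have "\<dots> = (1 / 2 + s_coeff p j) * coord y $ j"
    using det_M by (simp add: field_simps)
  finally show ?thesis .
qed

end

subsection \<open>Resolvent and polarization tensor\<close>

context ellipsoid_chart
begin

text \<open>The antipodal map is orthogonal and changes the sign of the integrand, while the
  weighted measure is that of the sphere.\<close>

lemma integral_coord_wt_eq_0: "integral\<^sup>L \<sigma> (\<lambda>x. coord x $ i / wt (coord x)) = 0"
proof -
  have meas: "(\<lambda>x. coord x $ i / wt (coord x)) \<in> borel_measurable borel"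
    unfolding cart_eq_inner_axis by measurable
  have *: "integral\<^sup>L \<sigma> (\<lambda>x. coord x $ i / wt (coord x)) = (\<integral>u. \<bar>det M\<bar> * ((R *v stereo u) $ i * (4 / norm (lift3 u) ^ 4)) \<partial>lborel)"
    if R: "orthogonal_matrix R" for R
    unfolding integral_\<sigma>(2)[OF R meas] coord_pt
  proof (intro Bochner_Integration.integral_cong refl)
    fix u
    have "wt (R *v stereo u) > 0"
      by (rule wt_pos) (metis norm_orthogonal_matrix_mult[OF R] norm_stereo norm_zero zero_neq_one)
    then show "jac R u * ((R *v stereo u) $ i / wt (R *v stereo u)) = \<bar>det M\<bar> * ((R *v stereo u) $ i * (4 / norm (lift3 u) ^ 4))"
      by (simp add: jac_def)
  qed
  define N :: "real^3^3" where "N = diag (\<chi> i. - 1)"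
  have N: "orthogonal_matrix N"
    unfolding orthogonal_matrix N_def transpose_diag by (rule diag_mult_diag_eq_1) simp
  have "(N *v v) $ i = - ((mat 1 *v v) $ i)" for v :: "real^3" by (simp add: N_def diag_mult_vec)
  then have "integral\<^sup>L \<sigma> (\<lambda>x. coord x $ i / wt (coord x)) = - integral\<^sup>L \<sigma> (\<lambda>x. coord x $ i / wt (coord x))"
    using *[OF N] *[OF orthogonal_matrix_id] by simp
  then show ?thesis by simp
qed

text \<open>The Neumann-Poincare operator with normal and measure made explicit. It integrates over
  the second variable of \<open>kern\<close>; integration over the first variable gives the
  adjoint.\<close>

definition double_layer :: "(real^3 \<Rightarrow> complex) \<Rightarrow> real^3 \<Rightarrow> complex" where
  "double_layer \<psi> x = (\<integral>y. kern x y *\<^sub>R \<psi> y \<partial>\<sigma>)"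

lemma NP_operator_solid: "x \<in> surf \<Longrightarrow> NP_operator solid \<psi> x = double_layer \<psi> x"
  unfolding NP_operator_def double_layer_def frontier_solid outward_normal_solid kern_def
  by (simp add: mult.commute flip: integral_scaleR_right)

text \<open>Fubini's theorem moves the operator from \<psi> to the eigenfunction \<open>F\<close> of
  the adjoint. Only integrability of \<psi> enters, so any representative of the resolvent can be
  paired with \<open>F\<close>.\<close>

lemma
  fixes F :: "real^3 \<Rightarrow> real" and \<psi> :: "real^3 \<Rightarrow> complex"
  assumes F [measurable]: "F \<in> borel_measurable borel" and bound: "\<And>x. x \<in> surf \<Longrightarrow> \<bar>F x\<bar> \<le> B"
    and eig: "\<And>y. y \<in> surf \<Longrightarrow> integral\<^sup>L \<sigma> (\<lambda>x. kern x y * F x) = e * F y"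
    and \<psi>: "integrable \<sigma> \<psi>"
  shows integrable_double_layer: "integrable \<sigma> (\<lambda>x. F x *\<^sub>R double_layer \<psi> x)"
    and integral_double_layer: "(\<integral>x. F x *\<^sub>R double_layer \<psi> x \<partial>\<sigma>) = of_real e * (\<integral>x. F x *\<^sub>R \<psi> x \<partial>\<sigma>)"
proof -
  interpret finite_measure \<sigma> by (rule finite_measure_\<sigma>)
  interpret P: pair_sigma_finite \<sigma> \<sigma> ..
  have [measurable]: "\<psi> \<in> borel_measurable borel"
    using borel_measurable_integrable[OF \<psi>] by simp
  define h where "h y x = (kern x y * F x) *\<^sub>R \<psi> y" for x y
  have meas [measurable]: "(\<lambda>(y, x). h y x) \<in> borel_measurable (\<sigma> \<Otimes>\<^sub>M \<sigma>)"
  proof -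
    have "(\<lambda>p. kern (snd p) (fst p)) \<in> borel_measurable (\<sigma> \<Otimes>\<^sub>M \<sigma>)"
      unfolding kern_def by measurable
    then show ?thesis unfolding h_def case_prod_beta by measurable
  qed
  have inner: "integrable \<sigma> (h y)" if "y \<in> surf" for y
    unfolding h_def using integrable_kern_bounded[OF that F bound] by (rule integrable_scaleR_left)
  have B0: "B \<ge> 0" if "y \<in> surf" for y using bound[OF that] by linarith
  have int: "integrable (\<sigma> \<Otimes>\<^sub>M \<sigma>) (\<lambda>(y, x). h y x)"
  proof (rule P.Fubini_integrable[OF meas])
    show "integrable \<sigma> (\<lambda>y. \<integral>x. norm ((\<lambda>(y, x). h y x) (y, x)) \<partial>\<sigma>)"
    proof (rule Bochner_Integration.integrable_bound)
      \<comment> \<open>The factor 1/2 is the integral of the nonnegative kernel over its first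
        variable.\<close>
      show "integrable \<sigma> (\<lambda>y. B * (1 / 2) * norm (\<psi> y))" using \<psi> by simp
      show "(\<lambda>y. \<integral>x. norm ((\<lambda>(y, x). h y x) (y, x)) \<partial>\<sigma>) \<in> borel_measurable \<sigma>"
        by (rule borel_measurable_lebesgue_integral) measurable
      show "AE y in \<sigma>. norm (\<integral>x. norm ((\<lambda>(y, x). h y x) (y, x)) \<partial>\<sigma>) \<le> norm (B * (1 / 2) * norm (\<psi> y))"
        using AE_surf
      proof eventually_elim
        case (elim y)
        have i: "integrable \<sigma> (\<lambda>x. kern x y)" "integral\<^sup>L \<sigma> (\<lambda>x. kern x y) = 1 / 2"
          using kern_has_integral_half[OF elim] by (simp_all add: has_bochner_integral_iff)
        have "(\<integral>x. norm (h y x) \<partial>\<sigma>) \<le> (\<integral>x. B * norm (\<psi> y) * kern x y \<partial>\<sigma>)"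
        proof (rule integral_mono_AE)
          show "integrable \<sigma> (\<lambda>x. norm (h y x))" using inner[OF elim] by simp
          show "integrable \<sigma> (\<lambda>x. B * norm (\<psi> y) * kern x y)" using i(1) by simp
          show "AE x in \<sigma>. norm (h y x) \<le> B * norm (\<psi> y) * kern x y"
            using AE_surf
          proof eventually_elim
            case (elim x)
            have "\<bar>F x\<bar> * (kern x y * norm (\<psi> y)) \<le> B * (kern x y * norm (\<psi> y))"
              using bound[OF elim] kern_nonneg[OF elim \<open>y \<in> surf\<close>] by (intro mult_right_mono) auto
            then show ?case
              using kern_nonneg[OF elim \<open>y \<in> surf\<close>] by (simp add: h_def abs_mult mult_ac)
          qed
        qed
        also have "\<dots> = B * (1 / 2) * norm (\<psi> y)" using i by simp
        finally have "(\<integral>x. norm (h y x) \<partial>\<sigma>) \<le> B * (1 / 2) * norm (\<psi> y)" .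
        moreover have "(\<integral>x. norm (h y x) \<partial>\<sigma>) \<ge> 0" by simp
        ultimately show ?case by simp
      qed
    qed
    show "AE y in \<sigma>. integrable \<sigma> (\<lambda>x. (\<lambda>(y, x). h y x) (y, x))"
      using AE_surf by eventually_elim (simp add: inner)
  qed
  have eq: "(\<integral>y. h y x \<partial>\<sigma>) = F x *\<^sub>R double_layer \<psi> x" for x
    unfolding h_def double_layer_def
    by (simp only: mult.commute[of _ "F x"] integral_scaleR_right flip: scaleR_scaleR)
  show "integrable \<sigma> (\<lambda>x. F x *\<^sub>R double_layer \<psi> x)"
    using P.integrable_snd[OF int] unfolding eq .
  have "(\<integral>x. F x *\<^sub>R double_layer \<psi> x \<partial>\<sigma>) = (\<integral>y. \<integral>x. h y x \<partial>\<sigma> \<partial>\<sigma>)"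
    using P.Fubini_integral[OF int] unfolding eq .
  also have "\<dots> = (\<integral>y. of_real e * (F y *\<^sub>R \<psi> y) \<partial>\<sigma>)"
  proof (rule integral_cong_AE)
    show "AE y in \<sigma>. (\<integral>x. h y x \<partial>\<sigma>) = of_real e * (F y *\<^sub>R \<psi> y)"
      using AE_surf
    proof eventually_elim
      case (elim y)
      have "(\<integral>x. h y x \<partial>\<sigma>) = (\<integral>x. kern x y * F x \<partial>\<sigma>) *\<^sub>R \<psi> y"
        unfolding h_def using integrable_kern_bounded[OF elim F bound] by (rule integral_scaleR_left)
      then show ?case unfolding eig[OF elim] by (simp add: scaleR_conv_of_real)
    qed
    show "(\<lambda>y. \<integral>x. h y x \<partial>\<sigma>) \<in> borel_measurable \<sigma>"
      using P.integrable_fst[OF int] by (rule borel_measurable_integrable)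
  qed measurable
  also have "\<dots> = of_real e * (\<integral>x. F x *\<^sub>R \<psi> x \<partial>\<sigma>)" by (rule integral_mult_right_zero)
  finally show "(\<integral>x. F x *\<^sub>R double_layer \<psi> x \<partial>\<sigma>) = of_real e * (\<integral>x. F x *\<^sub>R \<psi> x \<partial>\<sigma>)" .
qed

end

section \<open>Eigenvalues, eigenfunctions and the trace\<close>

context solid_ellipsoid
begin

text \<open>The reciprocals of \<open>(p $ j)\<^sup>2 + s\<close> sum to the logarithmic derivative
  of the square of \<open>dens\<close>, so the three integrands add up to the derivative of
  \<open>- 2 / dens s\<close>. Only the value at 0 survives, and it cancels the prefactor.\<close>

lemma sum_s_coeff: "s_coeff p 1 + s_coeff p 2 + s_coeff p 3 = - 1"
proof -
  define f where "f j s = 1 / (((p $ j)\<^sup>2 + s) * dens s)" for j s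
  have pp: "(p $ 1)\<^sup>2 + s > 0" "(p $ 2)\<^sup>2 + s > 0" "(p $ 3)\<^sup>2 + s > 0" if "s \<ge> 0" for s
    using p_sq_add_pos[OF that] by auto
  have fpos: "f j s \<ge> 0" if "s \<ge> 0" for j s
    using p_sq_add_pos[OF that, of j] dens_pos[OF that] by (simp add: f_def less_imp_le)
  have [measurable]: "f j \<in> borel_measurable borel" for j
    unfolding f_def[abs_def] dens_def by measurable
  have "(\<integral>\<^sup>+s. ennreal (f 1 s + f 2 s + f 3 s) * indicator {0..} s \<partial>lborel) = ennreal (0 - (- 2 / dens 0))"
  proof (rule nn_integral_FTC_atLeast)
    fix s :: real assume s: "0 \<le> s"
    define x where "x = (p $ 1)\<^sup>2 + s"
    define y where "y = (p $ 2)\<^sup>2 + s"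
    define z where "z = (p $ 3)\<^sup>2 + s"
    have pos: "x > 0" "y > 0" "z > 0" using pp[OF s] by (simp_all add: x_def y_def z_def)
    have q: "x * y * z > 0" using pos by simp
    have "DERIV (\<lambda>s. - 2 / dens s) s :> (x * y + z * (x + y)) / (sqrt (x * y * z) * (x * y * z))"
    proof -
      define G where "G s = ((p $ 1)\<^sup>2 + s) * ((p $ 2)\<^sup>2 + s) * ((p $ 3)\<^sup>2 + s)" for s
      have G: "DERIV G s :> x * y + z * (x + y)" "G s = x * y * z"
        unfolding G_def[abs_def] x_def y_def z_def
        by (auto intro!: derivative_eq_intros simp: algebra_simps)
      have "DERIV (\<lambda>s. - 2 / sqrt (G s)) s :> (x * y + z * (x + y)) * inverse (sqrt (G s)) / G s"
        using q G(2) by (auto intro!: derivative_eq_intros G(1))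
      moreover have "(x * y + z * (x + y)) * inverse (sqrt (G s)) / G s = (x * y + z * (x + y)) / (sqrt (x * y * z) * (x * y * z))"
        unfolding G(2) by (simp add: divide_inverse mult.assoc)
      moreover have "dens = (\<lambda>s. sqrt (G s))" by (simp add: fun_eq_iff dens_def G_def)
      ultimately show ?thesis by metis
    qed
    also have "(x * y + z * (x + y)) / (sqrt (x * y * z) * (x * y * z)) = 1 / (x * sqrt (x * y * z)) + 1 / (y * sqrt (x * y * z)) + 1 / (z * sqrt (x * y * z))"
    proof -
      have "(x * y + z * (x + y)) / (r * (x * y * z)) = 1 / (x * r) + 1 / (y * r) + 1 / (z * r)" if "r \<noteq> 0" for r
        using pos that by (simp add: field_simps)
      moreover have "sqrt (x * y * z) \<noteq> 0" using pos by simp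
      ultimately show ?thesis by blast
    qed
    also have "\<dots> = f 1 s + f 2 s + f 3 s"
      by (simp add: f_def dens_def x_def y_def z_def)
    finally show "DERIV (\<lambda>s. - 2 / dens s) s :> f 1 s + f 2 s + f 3 s" .
    show "0 \<le> f 1 s + f 2 s + f 3 s" using fpos[OF s] by simp
  next
    show "((\<lambda>s. - 2 / dens s) \<longlongrightarrow> 0) at_top" unfolding dens_def by real_asymp
  qed measurable
  also have "0 - (- 2 / dens 0) = 2 / \<bar>det L\<bar>"
  proof -
    have "dens 0 = \<bar>det L\<bar>"
      using p_pos by (simp add: dens_def real_sqrt_mult abs_det_L less_imp_le)
    then show ?thesis by simp
  qed
  also have "(\<lambda>s. ennreal (f 1 s + f 2 s + f 3 s) * indicator {0..} s) = (\<lambda>s. ennreal (indicator {0..} s * (f 1 s + f 2 s + f 3 s)))"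
    by (auto simp: indicator_def)
  finally have sum: "has_bochner_integral lborel (\<lambda>s. indicator {0..} s * (f 1 s + f 2 s + f 3 s)) (2 / \<bar>det L\<bar>)"
    using fpos by (intro has_bochner_integral_nn_integral) (auto simp: indicator_def)
  have int: "integrable lborel (\<lambda>s. indicator {0..} s * f j s)" for j
  proof (rule Bochner_Integration.integrable_bound)
    show "integrable lborel (\<lambda>s. indicator {0..} s * (f 1 s + f 2 s + f 3 s))"
      using sum by (simp add: has_bochner_integral_iff)
    have "f j s \<le> f 1 s + f 2 s + f 3 s" if "s \<ge> 0" for s
      using fpos[OF that, of 1] fpos[OF that, of 2] fpos[OF that, of 3] exhaust_3[of j] by auto
    then show "AE s in lborel. norm (indicator {0..} s * f j s) \<le> norm (indicator {0..} s * (f 1 s + f 2 s + f 3 s))"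
      using fpos by (auto simp: indicator_def)
  qed measurable
  have "s_coeff p 1 + s_coeff p 2 + s_coeff p 3 = - (\<bar>det L\<bar> / 2) * ((\<integral>s. indicator {0..} s * f 1 s \<partial>lborel)
     + (\<integral>s. indicator {0..} s * f 2 s \<partial>lborel) + (\<integral>s. indicator {0..} s * f 3 s \<partial>lborel))"
    unfolding s_coeff_eq f_def by (simp add: algebra_simps)
  also have "(\<integral>s. indicator {0..} s * f 1 s \<partial>lborel) + (\<integral>s. indicator {0..} s * f 2 s \<partial>lborel) + (\<integral>s. indicator {0..} s * f 3 s \<partial>lborel)
     = (\<integral>s. indicator {0..} s * f 1 s + indicator {0..} s * f 2 s + indicator {0..} s * f 3 s \<partial>lborel)"
    using int by (simp add: Bochner_Integration.integral_add)
  also have "\<dots> = 2 / \<bar>det L\<bar>"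
    using has_bochner_integral_integral_eq[OF sum] by (simp add: distrib_left)
  finally show ?thesis using det_M by simp
qed

definition eig :: "3 \<Rightarrow> real" where "eig j = 1 / 2 + s_coeff p j"

text \<open>The component of the normal along the \<open>j\<close>-th axis, that is, the
  \<open>j\<close>-th coordinate divided by the symmetrising weight and the semi-axis.\<close>

definition ncomp :: "3 \<Rightarrow> real^3 \<Rightarrow> real" where
  "ncomp j x = coord x $ j / (p $ j * wt (coord x))"

lemma borel_measurable_coord_nth [measurable]: "(\<lambda>x. coord x $ j) \<in> borel_measurable borel"
  unfolding cart_eq_inner_axis by measurable

lemma borel_measurable_ncomp [measurable]: "ncomp j \<in> borel_measurable borel"
  unfolding ncomp_def[abs_def] by measurable

lemma coord_bound: "x \<in> surf \<Longrightarrow> \<bar>coord x $ j\<bar> \<le> 1"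
  using component_le_norm_cart[of "coord x" j] by (simp add: surf_iff)

lemma ncomp_bound: "\<bar>ncomp j x\<bar> \<le> 1"
proof -
  have "wt (coord x) = norm (diag rp *v coord x)"
    by (simp add: wt_def inv_L matrix_transpose_mul norm_orthogonal_matrix_mult[OF orth]
        del: transpose_matrix_vector flip: matrix_vector_mul_assoc)
  moreover have "\<bar>(diag rp *v coord x) $ j\<bar> \<le> norm (diag rp *v coord x)" by (rule component_le_norm_cart)
  ultimately have "\<bar>coord x $ j / p $ j\<bar> \<le> wt (coord x)" by (simp add: diag_mult_vec rp_def)
  moreover have "wt (coord x) \<ge> 0" by (simp add: wt_def)
  ultimately have "\<bar>coord x $ j / p $ j\<bar> / wt (coord x) \<le> 1"
    \<comment> \<open>A vanishing weight gives quotient 0, so the bound holds at every point and not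
      just on the surface.\<close>
    by (metis div_by_0 divide_le_eq_1_pos order_le_less zero_le_one)
  moreover have "ncomp j x = coord x $ j / p $ j / wt (coord x)" by (simp add: ncomp_def)
  ultimately show ?thesis
    using \<open>wt (coord x) \<ge> 0\<close> by (simp only: abs_divide[of _ "wt _"] abs_of_nonneg)
qed

lemma nrm_ncomp: "nrm x $ m = (\<Sum>j\<in>UNIV. Q $ m $ j * ncomp j x)"
  by (simp add: nrm_nth ncomp_def sum_divide_distrib)

lemma integrable_bounded:
  fixes f :: "real^3 \<Rightarrow> 'b :: {banach, second_countable_topology}"
  assumes "f \<in> borel_measurable borel" "\<And>x. x \<in> surf \<Longrightarrow> norm (f x) \<le> B"
  shows "integrable \<sigma> f"
  using AE_surf assms
  by (intro finite_measure.integrable_const_bound[OF finite_measure_\<sigma>, of f B]) (auto elim: eventually_mono)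

text \<open>By \<open>kern_swap\<close>, an eigenfunction of the adjoint divided by the weight is an
  eigenfunction of the operator with the same eigenvalue.\<close>

lemma integral_kern_ncomp:
  assumes x: "x \<in> surf"
  shows "has_bochner_integral \<sigma> (\<lambda>y. kern x y * ncomp j y) (eig j * ncomp j x)"
proof -
  have "has_bochner_integral \<sigma> (\<lambda>y. kern y x * coord y $ j) (eig j * coord x $ j)"
    using integrable_kern_bounded[OF x borel_measurable_coord_nth coord_bound] integral_kern_coord[OF x]
    by (simp add: has_bochner_integral_iff eig_def)
  then have "has_bochner_integral \<sigma> (\<lambda>y. 1 / (p $ j * wt (coord x)) * (kern y x * coord y $ j)) (1 / (p $ j * wt (coord x)) * (eig j * coord x $ j))"
    by (rule has_bochner_integral_mult_right)
  moreover have "AE y in \<sigma>. 1 / (p $ j * wt (coord x)) * (kern y x * coord y $ j) = kern x y * ncomp j y"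
    using AE_surf
  proof eventually_elim
    case (elim y)
    have "1 / (p $ j * wt (coord x)) * (kern y x * coord y $ j) = (kern y x / wt (coord x)) * (coord y $ j / p $ j)"
      by simp
    also have "\<dots> = kern x y * ncomp j y" unfolding kern_swap[OF x elim, symmetric] by (simp add: ncomp_def)
    finally show ?case .
  qed
  ultimately have "has_bochner_integral \<sigma> (\<lambda>y. kern x y * ncomp j y) (1 / (p $ j * wt (coord x)) * (eig j * coord x $ j))"
    by (subst (asm) has_bochner_integral_cong_AE) simp_all
  then show ?thesis by (simp add: ncomp_def)
qed

text \<open>In the rotated axes this is the divergence theorem for a coordinate field; here it
  follows from the second moments of the sphere and \<open>\<bar>det L\<bar> * 4 / 3 * pi\<close>
  being the volume.\<close>

lemma integral_coord_ncomp: "integral\<^sup>L \<sigma> (\<lambda>x. coord x $ j * ncomp i x) = (if i = j then measure lebesgue solid / p $ j else 0)"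
proof -
  have "integral\<^sup>L \<sigma> (\<lambda>x. coord x $ j * ncomp i x) = integral\<^sup>L \<sigma> (\<lambda>x. 1 / p $ i * ((axis j 1 \<bullet> coord x) * (axis i 1 \<bullet> coord x) / wt (coord x)))"
    by (simp add: ncomp_def inner_axis' )
  also have "\<dots> = 1 / p $ i * (\<bar>det L\<bar> * sphere_moment (axis j 1) (axis i 1))"
    unfolding integral_mult_right_zero integral_coord_moment[OF orthogonal_matrix_id]
    by (simp add: transpose_mat del: transpose_matrix_vector)
  finally show ?thesis by (auto simp: sphere_moment_axis measure_solid)
qed

lemma integral_coord_nrm: "(\<integral>x. coord x $ j * nrm x $ m \<partial>\<sigma>) = Q $ m $ j * (measure lebesgue solid / p $ j)"
proof -
  have "\<bar>coord x $ j * ncomp i x\<bar> \<le> 1 * 1" if "x \<in> surf" for x i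
    unfolding abs_mult using coord_bound[OF that, of j] ncomp_bound[of i x] by (intro mult_mono) auto
  then have int: "integrable \<sigma> (\<lambda>x. coord x $ j * ncomp i x)" for i
    by (intro integrable_bounded[of _ 1]) auto
  have "(\<integral>x. coord x $ j * nrm x $ m \<partial>\<sigma>) = (\<integral>x. (\<Sum>i\<in>UNIV. Q $ m $ i * (coord x $ j * ncomp i x)) \<partial>\<sigma>)"
    by (simp add: nrm_ncomp sum_distrib_left mult_ac)
  also have "\<dots> = (\<Sum>i\<in>UNIV. Q $ m $ i * (\<integral>x. coord x $ j * ncomp i x \<partial>\<sigma>))"
    using int by (subst Bochner_Integration.integral_sum) auto
  also have "\<dots> = Q $ m $ j * (measure lebesgue solid / p $ j)"
    unfolding integral_coord_ncomp by (simp add: if_distrib cong: if_cong)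
  finally show ?thesis .
qed

lemma integral_nrm: "(\<integral>x. nrm x $ m \<partial>\<sigma>) = 0"
proof -
  have int: "integrable \<sigma> (ncomp i)" for i
    using ncomp_bound[of i] by (intro integrable_bounded[of _ 1]) auto
  have z: "integral\<^sup>L \<sigma> (ncomp i) = 0" for i
  proof -
    have "ncomp i = (\<lambda>x. 1 / p $ i * (coord x $ i / wt (coord x)))" by (auto simp: ncomp_def)
    then show ?thesis by (simp only: integral_mult_right_zero integral_coord_wt_eq_0)
  qed
  have "(\<integral>x. nrm x $ m \<partial>\<sigma>) = (\<Sum>i\<in>UNIV. Q $ m $ i * integral\<^sup>L \<sigma> (ncomp i))"
    unfolding nrm_ncomp using int by (subst Bochner_Integration.integral_sum) auto
  then show ?thesis by (simp add: z)
qed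

text \<open>The right-hand side is a combination of three eigenfunctions, so the equation is solved
  by dividing each term by \<open>l - eig j\<close>. This is what makes the choice in
  \<open>NP_resolvent\<close> a genuine solution.\<close>

lemma resolvent_exists:
  assumes l: "\<And>j. l \<noteq> of_real (eig j)"
  shows "\<exists>\<psi>. \<psi> \<in> boundary_L2 solid \<and>
    (AE x in \<sigma>. l * \<psi> x - NP_operator solid \<psi> x = of_real (outward_normal solid x $ m))"
proof -
  define \<psi> where "\<psi> x = (\<Sum>j\<in>UNIV. ncomp j x *\<^sub>R (of_real (Q $ m $ j) / (l - of_real (eig j))))" for x
  have [measurable]: "\<psi> \<in> borel_measurable borel" unfolding \<psi>_def[abs_def] by measurable
  define B where "B = (\<Sum>j\<in>UNIV. norm (of_real (Q $ m $ j) / (l - of_real (eig j))))"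
  have b: "norm (\<psi> x) \<le> B" for x
    unfolding \<psi>_def B_def
  proof (rule order_trans[OF norm_sum sum_mono])
    fix j
    show "norm (ncomp j x *\<^sub>R (of_real (Q $ m $ j) / (l - of_real (eig j)))) \<le> norm (of_real (Q $ m $ j) / (l - of_real (eig j)))"
      unfolding norm_scaleR using mult_right_mono[OF ncomp_bound norm_ge_zero] by simp
  qed
  have "integrable \<sigma> (\<lambda>x. (cmod (\<psi> x))\<^sup>2)"
  proof (rule integrable_bounded)
    show "norm ((cmod (\<psi> x))\<^sup>2) \<le> B\<^sup>2" for x using b[of x] by (simp add: power_mono)
  qed measurable
  then have "\<psi> \<in> boundary_L2 solid" by (simp add: boundary_L2_def frontier_solid)
  moreover have "AE x in \<sigma>. l * \<psi> x - NP_operator solid \<psi> x = of_real (outward_normal solid x $ m)"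
    using AE_surf
  proof eventually_elim
    case (elim x)
    have "double_layer \<psi> x = (\<integral>y. (\<Sum>j\<in>UNIV. (kern x y * ncomp j y) *\<^sub>R (of_real (Q $ m $ j) / (l - of_real (eig j)))) \<partial>\<sigma>)"
      by (simp add: double_layer_def \<psi>_def scaleR_sum_right)
    also have "\<dots> = (\<Sum>j\<in>UNIV. (eig j * ncomp j x) *\<^sub>R (of_real (Q $ m $ j) / (l - of_real (eig j))))"
      by (intro has_bochner_integral_integral_eq has_bochner_integral_sum has_bochner_integral_scaleR_left integral_kern_ncomp[OF elim])
    finally have "l * \<psi> x - double_layer \<psi> x
      = (\<Sum>j\<in>UNIV. l * (ncomp j x *\<^sub>R (of_real (Q $ m $ j) / (l - of_real (eig j))))
          - (eig j * ncomp j x) *\<^sub>R (of_real (Q $ m $ j) / (l - of_real (eig j))))"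
      by (simp add: \<psi>_def sum_distrib_left sum_subtractf)
    also have "\<dots> = (\<Sum>j\<in>UNIV. of_real (Q $ m $ j * ncomp j x))"
    proof (rule sum.cong[OF refl])
      fix j
      have "l - of_real (eig j) \<noteq> 0" using l[of j] by simp
      moreover have "l * (n *\<^sub>R (q / d)) - (e * n) *\<^sub>R (q / d) = q * of_real n"
        if "d = l - of_real e" "d \<noteq> 0" for n e :: real and q d :: complex
      proof -
        have "l * (n *\<^sub>R (q / d)) - (e * n) *\<^sub>R (q / d) = (l - of_real e) * (of_real n * (q / d))"
          by (simp only: scaleR_conv_of_real of_real_mult left_diff_distrib mult.assoc)
        then show ?thesis using that by simp
      qed
      ultimately show "l * (ncomp j x *\<^sub>R (of_real (Q $ m $ j) / (l - of_real (eig j))))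
          - (eig j * ncomp j x) *\<^sub>R (of_real (Q $ m $ j) / (l - of_real (eig j))) = of_real (Q $ m $ j * ncomp j x)"
        by simp
    qed
    also have "\<dots> = of_real (nrm x $ m)" by (simp add: nrm_ncomp)
    finally show ?case by (simp add: NP_operator_solid[OF elim] outward_normal_solid[OF elim])
  qed
  ultimately show ?thesis by blast
qed

text \<open>In the ellipsoid's own axes, \<open>x $ m\<close> is a constant plus a combination of
  coordinates, all eigenfunctions of the adjoint. The equation fixes the pairing of any solution
  with each of them, because a non-real \<open>l\<close> differs from the real eigenvalues.\<close>

lemma polarization_tensor_diag:
  assumes l: "Im l \<noteq> 0"
  shows "polarization_tensor l solid $ m $ m = (\<Sum>j\<in>UNIV. of_real ((Q $ m $ j)\<^sup>2 * measure lebesgue solid) / (l - of_real (eig j)))"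
proof -
  define \<psi> where "\<psi> = NP_resolvent l solid (\<lambda>y. of_real (outward_normal solid y $ m))"
  have l': "l \<noteq> of_real r" for r using l by auto
  have "\<psi> \<in> boundary_L2 solid \<and> (AE x in \<sigma>. l * \<psi> x - NP_operator solid \<psi> x = of_real (outward_normal solid x $ m))"
    unfolding \<psi>_def NP_resolvent_def frontier_solid by (rule someI_ex[OF resolvent_exists[OF l']])
  then have L2: "\<psi> \<in> borel_measurable \<sigma>" "integrable \<sigma> (\<lambda>x. (cmod (\<psi> x))\<^sup>2)"
    and ae: "AE x in \<sigma>. l * \<psi> x - NP_operator solid \<psi> x = of_real (outward_normal solid x $ m)"
    by (simp_all add: boundary_L2_def frontier_solid)
  have [measurable]: "\<psi> \<in> borel_measurable borel" using L2(1) by simp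
  have one: "integrable \<sigma> (\<lambda>x. 1 :: real)" by (rule integrable_bounded) auto
  \<comment> \<open>On a finite measure space a square integrable function is integrable.\<close>
  have \<psi>: "integrable \<sigma> \<psi>"
  proof (rule Bochner_Integration.integrable_bound)
    show "integrable \<sigma> (\<lambda>x. 1 + (cmod (\<psi> x))\<^sup>2)" using one L2(2) by (rule Bochner_Integration.integrable_add)
    have "t \<le> 1 + t\<^sup>2" for t :: real
    proof -
      have "2 * t \<le> 1 + t\<^sup>2" using zero_le_power2[of "t - 1"] by (simp add: power2_diff)
      moreover have "0 \<le> t\<^sup>2" by simp
      ultimately show ?thesis by linarith
    qed
    then show "AE x in \<sigma>. norm (\<psi> x) \<le> norm (1 + (cmod (\<psi> x))\<^sup>2)" by (simp add: abs_of_nonneg add_nonneg_nonneg)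
  qed measurable
  have ae': "AE x in \<sigma>. l * \<psi> x - double_layer \<psi> x = of_real (nrm x $ m)"
    using ae AE_surf by eventually_elim (simp add: NP_operator_solid outward_normal_solid)
  have [measurable]: "(\<lambda>x. nrm x $ m) \<in> borel_measurable borel" unfolding cart_eq_inner_axis by measurable
  \<comment> \<open>Pairing the resolvent equation with an eigenfunction \<open>F\<close> of the
    adjoint. It is used with constants and with coordinates.\<close>
  have key: "(l - of_real e) * (\<integral>x. F x *\<^sub>R \<psi> x \<partial>\<sigma>) = of_real (\<integral>x. F x * nrm x $ m \<partial>\<sigma>)"
    and intF: "integrable \<sigma> (\<lambda>x. F x *\<^sub>R \<psi> x)"
    if F [measurable]: "F \<in> borel_measurable borel" and bound: "\<And>x. x \<in> surf \<Longrightarrow> \<bar>F x\<bar> \<le> 1"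
      and eig: "\<And>y. y \<in> surf \<Longrightarrow> integral\<^sup>L \<sigma> (\<lambda>x. kern x y * F x) = e * F y" for F e
  proof -
    have i1: "integrable \<sigma> (\<lambda>x. F x *\<^sub>R double_layer \<psi> x)"
      and e1: "(\<integral>x. F x *\<^sub>R double_layer \<psi> x \<partial>\<sigma>) = of_real e * (\<integral>x. F x *\<^sub>R \<psi> x \<partial>\<sigma>)"
      using integrable_double_layer[OF F bound eig \<psi>] integral_double_layer[OF F bound eig \<psi>] by blast+
    show i2: "integrable \<sigma> (\<lambda>x. F x *\<^sub>R \<psi> x)"
    proof (rule Bochner_Integration.integrable_bound[OF \<psi>])
      show "AE x in \<sigma>. norm (F x *\<^sub>R \<psi> x) \<le> norm (\<psi> x)"
        using AE_surf
      proof eventually_elim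
        case (elim x)
        show ?case unfolding norm_scaleR using mult_right_mono[OF bound[OF elim] norm_ge_zero, of "\<psi> x"] by simp
      qed
    qed measurable
    have "(l - of_real e) * (\<integral>x. F x *\<^sub>R \<psi> x \<partial>\<sigma>) = (\<integral>x. l * (F x *\<^sub>R \<psi> x) \<partial>\<sigma>) - (\<integral>x. F x *\<^sub>R double_layer \<psi> x \<partial>\<sigma>)"
      unfolding e1 integral_mult_right_zero by (rule left_diff_distrib)
    also have "\<dots> = (\<integral>x. l * (F x *\<^sub>R \<psi> x) - F x *\<^sub>R double_layer \<psi> x \<partial>\<sigma>)"
      using i1 i2 by (intro Bochner_Integration.integral_diff[symmetric] integrable_mult_right)
    also have "\<dots> = (\<integral>x. of_real (F x * nrm x $ m) \<partial>\<sigma>)"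
    proof (rule integral_cong_AE)
      show "AE x in \<sigma>. l * (F x *\<^sub>R \<psi> x) - F x *\<^sub>R double_layer \<psi> x = of_real (F x * nrm x $ m)"
        using ae'
      proof eventually_elim
        case (elim x)
        have "l * (F x *\<^sub>R \<psi> x) - F x *\<^sub>R double_layer \<psi> x = F x *\<^sub>R (l * \<psi> x - double_layer \<psi> x)"
          by (simp add: scaleR_diff_right)
        then show ?case unfolding elim by (simp add: scaleR_conv_of_real)
      qed
      show "(\<lambda>x. l * (F x *\<^sub>R \<psi> x) - F x *\<^sub>R double_layer \<psi> x) \<in> borel_measurable \<sigma>"
        using i1 i2 by (intro borel_measurable_integrable Bochner_Integration.integrable_diff integrable_mult_right)
    qed measurable
    also have "\<dots> = of_real (\<integral>x. F x * nrm x $ m \<partial>\<sigma>)" by (rule integral_complex_of_real)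
    finally show "(l - of_real e) * (\<integral>x. F x *\<^sub>R \<psi> x \<partial>\<sigma>) = of_real (\<integral>x. F x * nrm x $ m \<partial>\<sigma>)" .
  qed
  \<comment> \<open>The normal has mean zero, hence so has the solution, and the centre
    \<open>c\<close> drops out of the tensor.\<close>
  have "(l - of_real (1 / 2)) * (\<integral>x. 1 *\<^sub>R \<psi> x \<partial>\<sigma>) = of_real (\<integral>x. 1 * nrm x $ m \<partial>\<sigma>)"
    using kern_has_integral_half by (intro key) (auto simp: has_bochner_integral_iff)
  then have zero: "(\<integral>x. \<psi> x \<partial>\<sigma>) = 0" using l'[of "1 / 2"] by (simp add: integral_nrm)
  have cI: "integrable \<sigma> (\<lambda>x. coord x $ j *\<^sub>R \<psi> x)" for j
    by (rule intF[OF borel_measurable_coord_nth coord_bound integral_kern_coord])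
  have cE: "(\<integral>x. coord x $ j *\<^sub>R \<psi> x \<partial>\<sigma>) = of_real (Q $ m $ j * (measure lebesgue solid / p $ j)) / (l - of_real (eig j))" for j
  proof -
    have "(l - of_real (eig j)) * (\<integral>x. coord x $ j *\<^sub>R \<psi> x \<partial>\<sigma>) = of_real (\<integral>x. coord x $ j * nrm x $ m \<partial>\<sigma>)"
      unfolding eig_def by (rule key[OF borel_measurable_coord_nth coord_bound integral_kern_coord])
    moreover have nz: "l - of_real (eig j) \<noteq> 0" using l'[of "eig j"] by simp
    ultimately show ?thesis
      unfolding nonzero_eq_divide_eq[OF nz] integral_coord_nrm[symmetric] by (simp only: mult.commute)
  qed
  have "polarization_tensor l solid $ m $ m = (\<integral>x. (x $ m) *\<^sub>R \<psi> x \<partial>\<sigma>)"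
    by (simp add: polarization_tensor_def \<psi>_def frontier_solid)
  also have "\<dots> = (\<integral>x. c $ m *\<^sub>R \<psi> x + (\<Sum>j\<in>UNIV. (Q $ m $ j * p $ j) *\<^sub>R (coord x $ j *\<^sub>R \<psi> x)) \<partial>\<sigma>)"
    by (subst nth_eq_coord) (simp add: scaleR_add_left scaleR_sum_left mult.assoc)
  also have "\<dots> = c $ m *\<^sub>R (\<integral>x. \<psi> x \<partial>\<sigma>) + (\<Sum>j\<in>UNIV. (Q $ m $ j * p $ j) *\<^sub>R (\<integral>x. coord x $ j *\<^sub>R \<psi> x \<partial>\<sigma>))"
    by (intro has_bochner_integral_integral_eq has_bochner_integral_add has_bochner_integral_sum
        has_bochner_integral_scaleR_right has_bochner_integral_integrable \<psi> cI)
  also have "\<dots> = (\<Sum>j\<in>UNIV. of_real ((Q $ m $ j)\<^sup>2 * measure lebesgue solid) / (l - of_real (eig j)))"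
  proof -
    have "(Q $ m $ j * p $ j) *\<^sub>R (of_real (Q $ m $ j * (measure lebesgue solid / p $ j)) / (l - of_real (eig j)))
      = of_real ((Q $ m $ j)\<^sup>2 * measure lebesgue solid) / (l - of_real (eig j))" for j
      using p_pos[of j] by (simp add: scaleR_conv_of_real power2_eq_square)
    then show ?thesis unfolding zero cE by simp
  qed
  finally show ?thesis .
qed

text \<open>The columns of \<open>Q\<close> are unit vectors, so the orientation of the ellipsoid
  disappears on summing the diagonal.\<close>

lemma trace_polarization_tensor:
  assumes l: "Im l \<noteq> 0"
  shows "trace (polarization_tensor l solid) = (\<Sum>j\<in>UNIV. of_real (measure lebesgue solid) / (l - of_real (eig j)))"
proof -
  have col: "(\<Sum>m\<in>UNIV. (Q $ m $ j)\<^sup>2) = 1" for j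
  proof -
    have "(transpose Q ** Q) $ j $ j = 1" using orth by (simp add: orthogonal_matrix_def mat_def)
    then show ?thesis by (simp add: matrix_matrix_mult_def transpose_def power2_eq_square)
  qed
  have "trace (polarization_tensor l solid) = (\<Sum>m\<in>UNIV. \<Sum>j\<in>UNIV. of_real ((Q $ m $ j)\<^sup>2 * measure lebesgue solid) / (l - of_real (eig j)))"
    by (simp add: trace_def polarization_tensor_diag[OF l])
  also have "\<dots> = (\<Sum>j\<in>UNIV. \<Sum>m\<in>UNIV. of_real ((Q $ m $ j)\<^sup>2 * measure lebesgue solid) / (l - of_real (eig j)))"
    by (rule sum.swap)
  also have "\<dots> = (\<Sum>j\<in>UNIV. of_real ((\<Sum>m\<in>UNIV. (Q $ m $ j)\<^sup>2) * measure lebesgue solid) / (l - of_real (eig j)))"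
    by (simp only: sum_divide_distrib of_real_sum sum_distrib_right)
  finally show ?thesis by (simp add: col)
qed

end

section \<open>The scalar inequality and the final estimate\<close>

lemma eventually_resonance_bound:
  fixes a e :: real
  shows "\<forall>\<^sub>F b in at 0. - b / ((a - e)\<^sup>2 + b\<^sup>2) \<le> ((a + e)\<^sup>2 + b\<^sup>2) / (\<bar>b\<bar> * (b\<^sup>2 + 4 * a\<^sup>2))"
proof -
  define d where "d = e\<^sup>2 - a\<^sup>2"
  \<comment> \<open>For \<open>d \<ge> 0\<close> the product \<open>d * (d + 2 * b\<^sup>2)\<close>
    is nonnegative for every \<open>b\<close>; for negative \<open>d\<close> both factors must be
    negative, which restricts \<open>b\<close>.\<close>
  have "\<forall>\<^sub>F b in at (0::real). d \<ge> 0 \<or> 2 * b\<^sup>2 < - d"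
  proof (cases "d \<ge> 0")
    case False
    have "((\<lambda>b::real. 2 * b\<^sup>2) \<longlongrightarrow> 2 * 0\<^sup>2) (at 0)" by (intro tendsto_intros)
    then have "\<forall>\<^sub>F b in at (0::real). 2 * b\<^sup>2 < - d" by (rule order_tendstoD) (use False in simp)
    then show ?thesis by eventually_elim simp
  qed simp
  moreover have "\<forall>\<^sub>F b in at (0::real). b \<noteq> 0" by (simp add: eventually_at_filter)
  ultimately show ?thesis
  proof eventually_elim
    case (elim b)
    define X where "X = (a - e)\<^sup>2 + b\<^sup>2"
    define Y where "Y = (a + e)\<^sup>2 + b\<^sup>2"
    define Z where "Z = b\<^sup>2 + 4 * a\<^sup>2"
    have b: "\<bar>b\<bar> > 0" "b\<^sup>2 > 0" using elim by auto
    have X: "X > 0" using b by (simp add: X_def add_nonneg_pos)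
    have Z: "Z > 0" using b by (simp add: Z_def add_pos_nonneg)
    have "d * (d + 2 * b\<^sup>2) \<ge> 0"
    proof (cases "d \<ge> 0")
      case False
      then have "d + 2 * b\<^sup>2 \<le> 0" using elim by auto
      then show ?thesis using False by (simp add: mult_nonpos_nonpos)
    qed simp
    also have "d * (d + 2 * b\<^sup>2) = X * Y - b\<^sup>2 * Z"
      by (simp add: d_def X_def Y_def Z_def power2_eq_square algebra_simps)
    finally have XY: "\<bar>b\<bar> * (\<bar>b\<bar> * Z) \<le> X * Y" by (simp add: power2_eq_square flip: mult.assoc)
    \<comment> \<open>Passing to the absolute value treats both signs of \<open>b\<close> at once;
      for negative \<open>b\<close> nothing is lost.\<close>
    have "- b / X \<le> \<bar>b\<bar> / X" using X by (intro divide_right_mono) auto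
    also have "\<dots> \<le> Y / (\<bar>b\<bar> * Z)"
      using XY X Z b by (simp add: divide_simps) (simp add: mult_ac)
    finally show ?case by (simp add: X_def Y_def Z_def)
  qed
qed

theorem corollary4p3:
  fixes c p :: "real^3" and Q :: "real^3^3" and D :: "(real^3) set" and a :: real
  assumes "orthogonal_matrix Q"
    and "\<forall>j. p $ j > 0"
    and "D = ellipsoid c Q p"
    and "\<bar>a\<bar> < 1 / 2"
  shows "\<exists>R :: real \<Rightarrow> real.
    R \<in> O[at 0](\<lambda>b. b\<^sup>2 / (4 * a\<^sup>2 + b\<^sup>2)) \<and>
    (\<forall>\<^sub>F b in at 0.
       Im (trace (polarization_tensor (Complex a b) D))
       \<le> measure lebesgue D *
           (3 * a\<^sup>2 + a - 1 / 4 + ((s_coeff p 1)\<^sup>2 + (s_coeff p 2)\<^sup>2 + (s_coeff p 3)\<^sup>2))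
           / (\<bar>b\<bar> * (b\<^sup>2 + 4 * a\<^sup>2))
         + 3 * \<bar>b\<bar> * measure lebesgue D / (b\<^sup>2 + 4 * a\<^sup>2)
         + R b)"
proof (intro exI[of _ "\<lambda>_. 0"] conjI)
  interpret solid_ellipsoid c p Q by unfold_locales (use assms in auto)
  have D: "D = solid" by (simp add: assms(3) solid_eq_ellipsoid)
  define V where "V = measure lebesgue D"
  have V: "V \<ge> 0" by (simp add: V_def)
  show "(\<lambda>_. 0) \<in> O[at 0](\<lambda>b. b\<^sup>2 / (4 * a\<^sup>2 + b\<^sup>2))" by simp
  have "\<forall>\<^sub>F b in at 0. \<forall>j\<in>UNIV. - b / ((a - eig j)\<^sup>2 + b\<^sup>2) \<le> ((a + eig j)\<^sup>2 + b\<^sup>2) / (\<bar>b\<bar> * (b\<^sup>2 + 4 * a\<^sup>2))"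
    by (intro eventually_ball_finite eventually_resonance_bound ballI) simp
  moreover have "\<forall>\<^sub>F b in at (0::real). b \<noteq> 0" by (simp add: eventually_at_filter)
  ultimately show "\<forall>\<^sub>F b in at 0. Im (trace (polarization_tensor (Complex a b) D))
       \<le> measure lebesgue D *
           (3 * a\<^sup>2 + a - 1 / 4 + ((s_coeff p 1)\<^sup>2 + (s_coeff p 2)\<^sup>2 + (s_coeff p 3)\<^sup>2))
           / (\<bar>b\<bar> * (b\<^sup>2 + 4 * a\<^sup>2))
         + 3 * \<bar>b\<bar> * measure lebesgue D / (b\<^sup>2 + 4 * a\<^sup>2) + 0"
  proof eventually_elim
    case (elim b)
    define Z where "Z = b\<^sup>2 + 4 * a\<^sup>2"
    have Im1: "Im (of_real V / (Complex a b - of_real e)) = V * (- b / ((a - e)\<^sup>2 + b\<^sup>2))" for e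
      by (simp add: Im_divide power2_eq_square)
    have "Im (trace (polarization_tensor (Complex a b) D)) = (\<Sum>j\<in>UNIV. V * (- b / ((a - eig j)\<^sup>2 + b\<^sup>2)))"
      using elim unfolding D by (simp add: trace_polarization_tensor Im_sum V_def[symmetric, unfolded D] Im1)
    also have "\<dots> \<le> (\<Sum>j\<in>UNIV. V * (((a + eig j)\<^sup>2 + b\<^sup>2) / (\<bar>b\<bar> * Z)))"
      using elim V by (intro sum_mono mult_left_mono) (auto simp: Z_def)
    also have "\<dots> = V * ((\<Sum>j\<in>UNIV. (a + eig j)\<^sup>2 + b\<^sup>2) / (\<bar>b\<bar> * Z))"
      by (simp only: sum_distrib_left sum_divide_distrib)
    also have "(\<Sum>j\<in>UNIV. (a + eig j)\<^sup>2 + b\<^sup>2)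
      = (3 * a\<^sup>2 + a - 1 / 4 + ((s_coeff p 1)\<^sup>2 + (s_coeff p 2)\<^sup>2 + (s_coeff p 3)\<^sup>2)) + 3 * b\<^sup>2"
    proof -
      \<comment> \<open>With the sum equal to -1, the part without squares of the coefficients is
        \<open>3 * (a + 1 / 2)\<^sup>2 - 2 * (a + 1 / 2)\<close>, which is
        \<open>3 * a\<^sup>2 + a - 1 / 4\<close>.\<close>
      have s: "s_coeff p 3 = - 1 - s_coeff p 1 - s_coeff p 2" using sum_s_coeff by linarith
      show ?thesis unfolding sum_3 eig_def s by (simp add: power2_eq_square algebra_simps)
    qed
    also have "V * ((N + 3 * b\<^sup>2) / (\<bar>b\<bar> * Z)) = V * N / (\<bar>b\<bar> * Z) + 3 * \<bar>b\<bar> * V / Z" for N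
    proof -
      have "3 * b\<^sup>2 / (\<bar>b\<bar> * Z) = 3 * \<bar>b\<bar> / Z"
      proof -
        have "b\<^sup>2 = \<bar>b\<bar> * \<bar>b\<bar>" by (simp add: power2_eq_square)
        then show ?thesis using elim by (simp only: mult.assoc[symmetric]) simp
      qed
      then show ?thesis by (simp add: add_divide_distrib distrib_left mult.commute)
    qed
    finally show ?case by (simp add: V_def Z_def)
  qed
qed

end
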